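(* Let $(\mathcal{A},[\cdot,\cdot]_{\mathcal{A}},a_{\mathcal{A}};\rho)$ be a LieRep pair, with $\rho$ a representation of the Lie algebroid $\mathcal{A}$ on the vector bundle $E$. For $P\in \mathcal{C}^n(E,\mathcal{A})$ and $Q\in \mathcal{C}^m(E,\mathcal{A})$ define $$\begin{aligned} [\![P,Q]\!](u_1,\dots,u_{m+n})={}&\sum_{\sigma\in\mathbb{S}_{(m,1,n-1)}} (-1)^\sigma P\big(\rho(Q(u_{\sigma(1)},\dots,u_{\sigma(m)}))u_{\sigma(m+1)},u_{\sigma(m+2)},\dots,u_{\sigma(m+n)}\big)\\ &-(-1)^{mn}\sum_{\sigma\in\mathbb{S}_{(n,1,m-1)}} (-1)^\sigma Q\big(\rho(P(u_{\sigma(1)},\dots,u_{\sigma(n)}))u_{\sigma(n+1)},u_{\sigma(n+2)},\dots,u_{\sigma(m+n)}\big)\\ &+(-1)^{mn}\sum_{\sigma\in\mathbb{S}_{(n,m)}} (-1)^\sigma \big[P(u_{\sigma(1)},\dots,u_{\sigma(n)}),Q(u_{\sigma(n+1)},\dots,u_{\sigma(m+n)})\big]_{\mathcal{A}} \end{aligned}$$ for $u_1,\dots,u_{m+n}\in\Gamma(E)$. Then $(\mathcal{C}^*(E,\mathcal{A}),[\![\cdot,\cdot]\!])$ is a graded Lie algebra, and its Maurer--Cartan elements are precisely the relative Rota--Baxter operators on $(\mathcal{A};\rho)$.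
   Context: Vector bundles are smooth real vector bundles over a smooth manifold $M$, and bundle maps cover the identity of $M$. A Lie algebroid $(\mathcal{A},[\cdot,\cdot]_{\mathcal{A}},a_{\mathcal{A}})$ is a vector bundle $\mathcal{A}\to M$ with a Lie bracket on $\Gamma(\mathcal{A})$ and a bundle map $a_{\mathcal{A}}:\mathcal{A}\to TM$ (anchor) with $[x,fy]_{\mathcal{A}}=f[x,y]_{\mathcal{A}}+a_{\mathcal{A}}(x)(f)y$ for $f\in C^\infty(M)$, $x,y\in\Gamma(\mathcal{A})$. For a vector bundle $E$, $\mathfrak{D}(E)$ is the Lie algebroid of covariant differential operators: its sections are $\mathbb{R}$-linear $D:\Gamma(E)\to\Gamma(E)$ for which there is a vector field $X_D$ with $D(fu)=fD(u)+X_D(f)u$; bracket is the commutator, anchor is $D\mapsto X_D$. A representation of $\mathcal{A}$ on $E$ is a base-preserving Lie algebroid homomorphism $\rho:\mathcal{A}\to\mathfrak{D}(E)$ (a bundle map compatible with anchors and brackets). A LieRep pair $(\mathcal{A};\rho)$ is a Lie algebroid with a representation $\rho$ on a vector bundle $E$. A relative Rota--Baxter operator on $(\mathcal{A};\rho)$ is a bundle map $T:E\to\mathcal{A}$ with $[T(u),T(v)]_{\mathcal{A}}=T(\rho(T(u))(v)-\rho(T(v))(u))$ for all $u,v\in\Gamma(E)$. $\mathcal{C}^k(E,\mathcal{A})=\Gamma(\mathrm{Hom}(\wedge^kE,\mathcal{A}))$ and $\mathcal{C}^*(E,\mathcal{A})=\oplus_{k\ge0}\mathcal{C}^k(E,\mathcal{A})$,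 with $\mathcal{C}^k(E,\mathcal{A})$ in degree $k$. $\mathbb{S}_{(i_1,\dots,i_k)}$ is the set of permutations $\sigma$ of $\{1,\dots,i_1+\cdots+i_k\}$ that are increasing on each of the consecutive blocks of lengths $i_1,\dots,i_k$ (unshuffles), and $(-1)^\sigma$ is the sign; a sum whose index set involves a block of length $-1$ is zero. A Maurer--Cartan element of a graded Lie algebra is a degree $1$ element $\theta$ with $[\theta,\theta]=0$. *)

theory Defs
  imports "HOL-Analysis.Analysis" "HOL-Combinatorics.Permutations" "HOL-Library.Function_Algebras"
begin

text \<open>Functions into a real vector space form a real vector space under the pointwise operations;
  addition is provided by \<^theory>\<open>HOL-Library.Function_Algebras\<close>.\<close>

instantiation "fun" :: (type, real_vector) real_vector
begin

definition scaleR_fun :: "real \<Rightarrow> ('a \<Rightarrow> 'b) \<Rightarrow> 'a \<Rightarrow> 'b" where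
  "scaleR_fun c f = (\<lambda>x. c *\<^sub>R f x)"

instance
  by standard (auto simp: scaleR_fun_def plus_fun_def fun_eq_iff scaleR_add_right scaleR_add_left)

end


section \<open>Lie algebras and graded Lie algebras\<close>

definition bilinear_on :: "'v::real_vector set \<Rightarrow> ('v \<Rightarrow> 'v \<Rightarrow> 'v) \<Rightarrow> bool" where
  "bilinear_on V br \<longleftrightarrow>
     (\<forall>x\<in>V. \<forall>y\<in>V. \<forall>z\<in>V. \<forall>c d.
        br (c *\<^sub>R x + d *\<^sub>R y) z = c *\<^sub>R br x z + d *\<^sub>R br y z \<and>
        br z (c *\<^sub>R x + d *\<^sub>R y) = c *\<^sub>R br z x + d *\<^sub>R br z y)"

definition lie_algebra_on :: "'v::real_vector set \<Rightarrow> ('v \<Rightarrow> 'v \<Rightarrow> 'v) \<Rightarrow> bool" where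
  "lie_algebra_on V br \<longleftrightarrow>
     subspace V \<and> (\<forall>x\<in>V. \<forall>y\<in>V. br x y \<in> V) \<and> bilinear_on V br \<and>
     (\<forall>x\<in>V. br x x = 0) \<and>
     (\<forall>x\<in>V. \<forall>y\<in>V. \<forall>z\<in>V. br x (br y z) + br y (br z x) + br z (br x y) = 0)"

text \<open>The underlying space is the internal direct sum of the homogeneous parts \<open>V k\<close>,
  i.e. \<open>span (\<Union>k. V k)\<close> with the family \<open>V\<close> independent.\<close>

definition graded_lie_algebra :: "(nat \<Rightarrow> 'v::real_vector set) \<Rightarrow> ('v \<Rightarrow> 'v \<Rightarrow> 'v) \<Rightarrow> bool" where
  "graded_lie_algebra V br \<longleftrightarrow>
     (\<forall>k. subspace (V k)) \<and>
     (\<forall>c K. (\<forall>k. c k \<in> V k) \<and> finite K \<and> (\<Sum>k\<in>K. c k) = 0 \<longrightarrow> (\<forall>k\<in>K. c k = 0)) \<and>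
     bilinear_on (span (\<Union>k. V k)) br \<and>
     (\<forall>i j. \<forall>x\<in>V i. \<forall>y\<in>V j. br x y \<in> V (i + j)) \<and>
     (\<forall>i j. \<forall>x\<in>V i. \<forall>y\<in>V j. br x y = - ((-1) ^ (i * j) *\<^sub>R br y x)) \<and>
     (\<forall>i j k. \<forall>x\<in>V i. \<forall>y\<in>V j. \<forall>z\<in>V k.
        br x (br y z) = br (br x y) z + (-1) ^ (i * j) *\<^sub>R br y (br x z))"

definition maurer_cartan_elements :: "(nat \<Rightarrow> 'v::real_vector set) \<Rightarrow> ('v \<Rightarrow> 'v \<Rightarrow> 'v) \<Rightarrow> 'v set" where
  "maurer_cartan_elements V br = {\<theta> \<in> V 1. br \<theta> \<theta> = 0}"


section \<open>Smooth manifolds\<close>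

text \<open>The model space \<open>\<real>\<^sup>n\<close> is \<^const>\<open>Euclidean_space\<close> \<open>n\<close>, the sequences vanishing from index \<open>n\<close> on;
  this includes \<open>n = 0\<close>.\<close>

definition partial_deriv :: "nat \<Rightarrow> ((nat \<Rightarrow> real) \<Rightarrow> real) \<Rightarrow> (nat \<Rightarrow> real) \<Rightarrow> real" where
  "partial_deriv i f x = deriv (\<lambda>t. f (x(i := t))) (x i)"

primrec Ck_on :: "nat \<Rightarrow> nat \<Rightarrow> (nat \<Rightarrow> real) set \<Rightarrow> ((nat \<Rightarrow> real) \<Rightarrow> real) \<Rightarrow> bool" where
  "Ck_on n 0 W f \<longleftrightarrow> continuous_on W f"
| "Ck_on n (Suc k) W f \<longleftrightarrow>
     continuous_on W f \<and>
     (\<forall>i<n. (\<forall>x\<in>W. (\<lambda>t. f (x(i := t))) differentiable (at (x i))) \<and> Ck_on n k W (partial_deriv i f))"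

definition Cinf_on :: "nat \<Rightarrow> (nat \<Rightarrow> real) set \<Rightarrow> ((nat \<Rightarrow> real) \<Rightarrow> real) \<Rightarrow> bool" where
  "Cinf_on n W f \<longleftrightarrow> (\<forall>k. Ck_on n k W f)"

record 'm manifold =
  mdim :: nat
  charts :: "('m set \<times> ('m \<Rightarrow> nat \<Rightarrow> real)) set"

text \<open>The manifold is the whole type \<open>'m\<close>; being Hausdorff and second countable is part of its sort.\<close>

definition smooth_manifold :: "'m::{t2_space, second_countable_topology} manifold \<Rightarrow> bool" where
  "smooth_manifold M \<longleftrightarrow>
     (\<Union>(U, \<phi>)\<in>charts M. U) = UNIV \<and>
     (\<forall>(U, \<phi>)\<in>charts M. open U \<and> openin (Euclidean_space (mdim M)) (\<phi> ` U) \<and>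
        homeomorphism U (\<phi> ` U) \<phi> (inv_into U \<phi>)) \<and>
     (\<forall>(U, \<phi>)\<in>charts M. \<forall>(V, \<psi>)\<in>charts M. \<forall>i<mdim M.
        Cinf_on (mdim M) (\<phi> ` (U \<inter> V)) (\<lambda>y. \<psi> (inv_into U \<phi> y) i))"

text \<open>Smoothness on an open subset \<open>W\<close>.\<close>

definition smooth_fun_on :: "'m manifold \<Rightarrow> 'm set \<Rightarrow> ('m \<Rightarrow> real) \<Rightarrow> bool" where
  "smooth_fun_on M W f \<longleftrightarrow>
     (\<forall>(U, \<phi>)\<in>charts M. Cinf_on (mdim M) (\<phi> ` (U \<inter> W)) (\<lambda>y. f (inv_into U \<phi> y)))"

definition smooth_funs :: "'m manifold \<Rightarrow> ('m \<Rightarrow> real) set" where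
  "smooth_funs M = {f. smooth_fun_on M UNIV f}"


section \<open>Smooth vector bundles\<close>

text \<open>The fibres are finite-dimensional subspaces of an ambient real vector space \<open>'e\<close>, which carries
  no further structure. Every family of vector spaces arises in this way, e.g. inside its direct sum.
  The smooth structure is an atlas of local frames \<open>(U, r, e)\<close>, equivalently of local trivialisations
  \<open>U \<times> \<real>\<^sup>r \<rightarrow> E\<bar>\<^bsub>U\<^esub>\<close>, \<open>(x, c) \<mapsto> \<Sum>i<r. c\<^sub>i e\<^sub>i(x)\<close>, with smooth transition matrices.\<close>

record ('m, 'e) vbundle =
  fibre :: "'m \<Rightarrow> 'e set"
  frames :: "('m set \<times> nat \<times> (nat \<Rightarrow> 'm \<Rightarrow> 'e)) set"

definition smooth_section_on ::
    "'m manifold \<Rightarrow> ('m, 'e::real_vector) vbundle \<Rightarrow> 'm set \<Rightarrow> ('m \<Rightarrow> 'e) \<Rightarrow> bool" where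
  "smooth_section_on M E W u \<longleftrightarrow>
     (\<forall>x\<in>W. u x \<in> fibre E x) \<and>
     (\<forall>(U, r, e)\<in>frames E. \<exists>c. (\<forall>i<r. smooth_fun_on M (U \<inter> W) (c i)) \<and>
        (\<forall>x\<in>U \<inter> W. u x = (\<Sum>i<r. c i x *\<^sub>R e i x)))"

definition vector_bundle ::
    "'m::topological_space manifold \<Rightarrow> ('m, 'e::real_vector) vbundle \<Rightarrow> bool" where
  "vector_bundle M E \<longleftrightarrow>
     (\<forall>x. subspace (fibre E x)) \<and>
     (\<Union>(U, r, e)\<in>frames E. U) = UNIV \<and>
     (\<forall>(U, r, e)\<in>frames E. open U \<and>
        (\<forall>x\<in>U. inj_on (\<lambda>i. e i x) {..<r} \<and> independent ((\<lambda>i. e i x) ` {..<r}) \<and>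
           span ((\<lambda>i. e i x) ` {..<r}) = fibre E x) \<and>
        (\<forall>i<r. smooth_section_on M E U (e i)))"

definition sections :: "'m manifold \<Rightarrow> ('m, 'e::real_vector) vbundle \<Rightarrow> ('m \<Rightarrow> 'e) set" where
  "sections M E = {u. smooth_section_on M E UNIV u}"

definition fun_smult :: "('m \<Rightarrow> real) \<Rightarrow> ('m \<Rightarrow> 'e::real_vector) \<Rightarrow> 'm \<Rightarrow> 'e" (infixr "\<cdot>\<^sub>C" 75) where
  "f \<cdot>\<^sub>C u = (\<lambda>x. f x *\<^sub>R u x)"

text \<open>Smooth bundle maps over the identity. The value outside the fibres is fixed to be \<open>0\<close>, so that
  equality of functions is equality of bundle maps.\<close>

definition bundle_map :: "'m manifold \<Rightarrow> ('m, 'e::real_vector) vbundle \<Rightarrow> ('m, 'a::real_vector) vbundle \<Rightarrow>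
    ('m \<Rightarrow> 'e \<Rightarrow> 'a) \<Rightarrow> bool" where
  "bundle_map M E A T \<longleftrightarrow>
     (\<forall>x. \<forall>v. v \<notin> fibre E x \<longrightarrow> T x v = 0) \<and>
     (\<forall>x. \<forall>v\<in>fibre E x. T x v \<in> fibre A x) \<and>
     (\<forall>x. \<forall>v\<in>fibre E x. \<forall>w\<in>fibre E x. \<forall>c d.
        T x (c *\<^sub>R v + d *\<^sub>R w) = c *\<^sub>R T x v + d *\<^sub>R T x w) \<and>
     (\<forall>(U, r, e)\<in>frames E. \<forall>i<r. smooth_section_on M A U (\<lambda>x. T x (e i x)))"

definition on_sections :: "('m \<Rightarrow> 'e \<Rightarrow> 'a) \<Rightarrow> ('m \<Rightarrow> 'e) \<Rightarrow> 'm \<Rightarrow> 'a" where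
  "on_sections T u = (\<lambda>x. T x (u x))"


section \<open>The tangent bundle\<close>

text \<open>Tangent vectors are derivations of the algebra of smooth functions (extended by \<open>0\<close> to all
  functions); the chart \<open>(U, \<phi>)\<close> gives the local frame of coordinate vector fields over \<open>U\<close>.\<close>

definition derivations_at :: "'m manifold \<Rightarrow> 'm \<Rightarrow> (('m \<Rightarrow> real) \<Rightarrow> real) set" where
  "derivations_at M x = {\<delta>.
     (\<forall>f. f \<notin> smooth_funs M \<longrightarrow> \<delta> f = 0) \<and>
     (\<forall>f\<in>smooth_funs M. \<forall>g\<in>smooth_funs M. \<forall>c d.
        \<delta> (\<lambda>y. c * f y + d * g y) = c * \<delta> f + d * \<delta> g) \<and>
     (\<forall>f\<in>smooth_funs M. \<forall>g\<in>smooth_funs M.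
        \<delta> (\<lambda>y. f y * g y) = f x * \<delta> g + \<delta> f * g x)}"

definition coord_vector :: "'m manifold \<Rightarrow> 'm set \<Rightarrow> ('m \<Rightarrow> nat \<Rightarrow> real) \<Rightarrow> nat \<Rightarrow> 'm \<Rightarrow> ('m \<Rightarrow> real) \<Rightarrow> real" where
  "coord_vector M U \<phi> i x f =
     (if f \<in> smooth_funs M then partial_deriv i (\<lambda>y. f (inv_into U \<phi> y)) (\<phi> x) else 0)"

definition tangent_bundle :: "'m manifold \<Rightarrow> ('m, ('m \<Rightarrow> real) \<Rightarrow> real) vbundle" where
  "tangent_bundle M =
     \<lparr>fibre = derivations_at M, frames = (\<lambda>(U, \<phi>). (U, mdim M, coord_vector M U \<phi>)) ` charts M\<rparr>"

definition apply_field :: "('m \<Rightarrow> ('m \<Rightarrow> real) \<Rightarrow> real) \<Rightarrow> ('m \<Rightarrow> real) \<Rightarrow> 'm \<Rightarrow> real" where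
  "apply_field X f = (\<lambda>x. X x f)"


section \<open>Lie algebroids and representations\<close>

text \<open>The bracket matters only on smooth sections; its values elsewhere are arbitrary.\<close>

definition lie_algebroid ::
    "'m::topological_space manifold \<Rightarrow> ('m, 'a::real_vector) vbundle \<Rightarrow>
     (('m \<Rightarrow> 'a) \<Rightarrow> ('m \<Rightarrow> 'a) \<Rightarrow> ('m \<Rightarrow> 'a)) \<Rightarrow> ('m \<Rightarrow> 'a \<Rightarrow> ('m \<Rightarrow> real) \<Rightarrow> real) \<Rightarrow> bool" where
  "lie_algebroid M A br an \<longleftrightarrow>
     vector_bundle M A \<and>
     lie_algebra_on (sections M A) br \<and>
     bundle_map M A (tangent_bundle M) an \<and>
     (\<forall>f\<in>smooth_funs M. \<forall>x\<in>sections M A. \<forall>y\<in>sections M A.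
        br x (f \<cdot>\<^sub>C y) = f \<cdot>\<^sub>C br x y + apply_field (on_sections an x) f \<cdot>\<^sub>C y)"

text \<open>\<open>D\<close> is a section of \<open>\<DD>(E)\<close> and \<open>X\<close> is its anchor \<open>X\<^sub>D\<close>.\<close>

definition covariant_diff_op ::
    "'m manifold \<Rightarrow> ('m, 'e::real_vector) vbundle \<Rightarrow> (('m \<Rightarrow> 'e) \<Rightarrow> 'm \<Rightarrow> 'e) \<Rightarrow>
     ('m \<Rightarrow> ('m \<Rightarrow> real) \<Rightarrow> real) \<Rightarrow> bool" where
  "covariant_diff_op M E D X \<longleftrightarrow>
     X \<in> sections M (tangent_bundle M) \<and>
     (\<forall>u\<in>sections M E. D u \<in> sections M E) \<and>
     (\<forall>u\<in>sections M E. \<forall>v\<in>sections M E. \<forall>c d.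
        D (c *\<^sub>R u + d *\<^sub>R v) = c *\<^sub>R D u + d *\<^sub>R D v) \<and>
     (\<forall>f\<in>smooth_funs M. \<forall>u\<in>sections M E. D (f \<cdot>\<^sub>C u) = f \<cdot>\<^sub>C D u + apply_field X f \<cdot>\<^sub>C u)"

text \<open>The bundle \<open>\<DD>(E)\<close> is determined by its sections: an element of its fibre at \<open>x\<close> is a map
  \<open>u \<mapsto> (D u)(x)\<close> on \<open>\<Gamma>(E)\<close>, for a section \<open>D\<close> of \<open>\<DD>(E)\<close>. Accordingly a bundle map \<open>\<A> \<rightarrow> \<DD>(E)\<close> is a
  family of linear maps \<open>\<rho> x\<close> from the fibre of \<open>\<A>\<close> to functions \<open>\<Gamma>(E) \<rightarrow> E\<^sub>x\<close> that takes smooth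
  sections of \<open>\<A>\<close> to sections of \<open>\<DD>(E)\<close>.\<close>

definition rep_op :: "('m \<Rightarrow> 'a \<Rightarrow> ('m \<Rightarrow> 'e) \<Rightarrow> 'e) \<Rightarrow> ('m \<Rightarrow> 'a) \<Rightarrow> ('m \<Rightarrow> 'e) \<Rightarrow> 'm \<Rightarrow> 'e" where
  "rep_op \<rho> a u = (\<lambda>x. \<rho> x (a x) u)"

definition lie_algebroid_rep ::
    "'m manifold \<Rightarrow> ('m, 'a::real_vector) vbundle \<Rightarrow>
     (('m \<Rightarrow> 'a) \<Rightarrow> ('m \<Rightarrow> 'a) \<Rightarrow> ('m \<Rightarrow> 'a)) \<Rightarrow> ('m \<Rightarrow> 'a \<Rightarrow> ('m \<Rightarrow> real) \<Rightarrow> real) \<Rightarrow>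
     ('m, 'e::real_vector) vbundle \<Rightarrow> ('m \<Rightarrow> 'a \<Rightarrow> ('m \<Rightarrow> 'e) \<Rightarrow> 'e) \<Rightarrow> bool" where
  "lie_algebroid_rep M A br an E \<rho> \<longleftrightarrow>
     (\<forall>x. \<forall>a\<in>fibre A x. \<forall>b\<in>fibre A x. \<forall>c d. \<forall>u\<in>sections M E.
        \<rho> x (c *\<^sub>R a + d *\<^sub>R b) u = c *\<^sub>R \<rho> x a u + d *\<^sub>R \<rho> x b u) \<and>
     (\<forall>a\<in>sections M A. covariant_diff_op M E (rep_op \<rho> a) (on_sections an a)) \<and>
     (\<forall>a\<in>sections M A. \<forall>b\<in>sections M A. \<forall>u\<in>sections M E.
        rep_op \<rho> (br a b) u = rep_op \<rho> a (rep_op \<rho> b u) - rep_op \<rho> b (rep_op \<rho> a u))"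

definition lie_rep_pair ::
    "'m::topological_space manifold \<Rightarrow> ('m, 'a::real_vector) vbundle \<Rightarrow>
     (('m \<Rightarrow> 'a) \<Rightarrow> ('m \<Rightarrow> 'a) \<Rightarrow> ('m \<Rightarrow> 'a)) \<Rightarrow> ('m \<Rightarrow> 'a \<Rightarrow> ('m \<Rightarrow> real) \<Rightarrow> real) \<Rightarrow>
     ('m, 'e::real_vector) vbundle \<Rightarrow> ('m \<Rightarrow> 'a \<Rightarrow> ('m \<Rightarrow> 'e) \<Rightarrow> 'e) \<Rightarrow> bool" where
  "lie_rep_pair M A br an E \<rho> \<longleftrightarrow>
     lie_algebroid M A br an \<and> vector_bundle M E \<and> lie_algebroid_rep M A br an E \<rho>"

definition relative_rota_baxter ::
    "'m manifold \<Rightarrow> ('m, 'a::real_vector) vbundle \<Rightarrow> (('m \<Rightarrow> 'a) \<Rightarrow> ('m \<Rightarrow> 'a) \<Rightarrow> ('m \<Rightarrow> 'a)) \<Rightarrow>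
     ('m, 'e::real_vector) vbundle \<Rightarrow> ('m \<Rightarrow> 'a \<Rightarrow> ('m \<Rightarrow> 'e) \<Rightarrow> 'e) \<Rightarrow> ('m \<Rightarrow> 'e \<Rightarrow> 'a) \<Rightarrow> bool" where
  "relative_rota_baxter M A br E \<rho> T \<longleftrightarrow>
     bundle_map M E A T \<and>
     (\<forall>u\<in>sections M E. \<forall>v\<in>sections M E.
        br (on_sections T u) (on_sections T v) =
        on_sections T (rep_op \<rho> (on_sections T u) v - rep_op \<rho> (on_sections T v) u))"


section \<open>Cochains and the bracket\<close>

text \<open>A section of \<open>Hom(\<Lambda>\<^sup>k E, \<A>)\<close> is a smooth family of alternating \<open>k\<close>-linear maps on the fibres, the
  arguments forming a list of length \<open>k\<close>; on all other lists the value is \<open>0\<close>. So the spaces of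
  cochains of different degrees lie in one function space, in which their sum is direct.\<close>

definition cochains ::
    "'m manifold \<Rightarrow> ('m, 'e::real_vector) vbundle \<Rightarrow> ('m, 'a::real_vector) vbundle \<Rightarrow> nat \<Rightarrow>
     ('m \<Rightarrow> 'e list \<Rightarrow> 'a) set" where
  "cochains M E A k = {P.
     (\<forall>x vs. \<not> (length vs = k \<and> set vs \<subseteq> fibre E x) \<longrightarrow> P x vs = 0) \<and>
     (\<forall>x vs. length vs = k \<and> set vs \<subseteq> fibre E x \<longrightarrow>
        P x vs \<in> fibre A x \<and>
        (\<forall>i<k. \<forall>v\<in>fibre E x. \<forall>w\<in>fibre E x. \<forall>c d.
           P x (vs[i := c *\<^sub>R v + d *\<^sub>R w]) = c *\<^sub>R P x (vs[i := v]) + d *\<^sub>R P x (vs[i := w])) \<and>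
        (\<forall>i<k. \<forall>j<k. i \<noteq> j \<and> vs ! i = vs ! j \<longrightarrow> P x vs = 0)) \<and>
     (\<forall>(U, r, e)\<in>frames E. \<forall>js. length js = k \<and> set js \<subseteq> {..<r} \<longrightarrow>
        smooth_section_on M A U (\<lambda>x. P x (map (\<lambda>j. e j x) js)))}"

definition eval_cochain :: "('m \<Rightarrow> 'e list \<Rightarrow> 'a) \<Rightarrow> ('m \<Rightarrow> 'e) list \<Rightarrow> 'm \<Rightarrow> 'a" where
  "eval_cochain P us = (\<lambda>x. P x (map (\<lambda>u. u x) us))"

text \<open>Permutations of \<open>{0, \<dots>, N - 1}\<close> that are increasing on each of the consecutive blocks.\<close>

definition unshuffles :: "nat list \<Rightarrow> (nat \<Rightarrow> nat) set" where
  "unshuffles bs = {\<sigma>. \<sigma> permutes {..<sum_list bs} \<and>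
     (\<forall>j<length bs. strict_mono_on {sum_list (take j bs)..<sum_list (take (Suc j) bs)} \<sigma>)}"

text \<open>The sum over \<open>\<SS>\<^bsub>(m,1,n-1)\<^esub>\<close> of \<open>P(\<rho>(Q(u\<^sub>\<sigma>\<^sub>1, \<dots>)) u, \<dots>)\<close>; it is \<open>0\<close> if \<open>n = 0\<close>. Indices are shifted
  by one since positions in lists start at \<open>0\<close>.\<close>

definition insertion_sum ::
    "('m \<Rightarrow> 'a \<Rightarrow> ('m \<Rightarrow> 'e) \<Rightarrow> 'e) \<Rightarrow> nat \<Rightarrow> nat \<Rightarrow> ('m \<Rightarrow> 'e list \<Rightarrow> 'a::real_vector) \<Rightarrow>
     ('m \<Rightarrow> 'e list \<Rightarrow> 'a) \<Rightarrow> ('m \<Rightarrow> 'e) list \<Rightarrow> 'm \<Rightarrow> 'a" where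
  "insertion_sum \<rho> n m P Q us =
     (if n = 0 then 0 else
       (\<Sum>\<sigma>\<in>unshuffles [m, 1, n - 1]. of_int (sign \<sigma>) *\<^sub>R
          eval_cochain P
            (rep_op \<rho> (eval_cochain Q (map (\<lambda>i. us ! \<sigma> i) [0..<m])) (us ! \<sigma> m)
             # map (\<lambda>i. us ! \<sigma> i) [m + 1..<m + n])))"

definition bracket_formula ::
    "(('m \<Rightarrow> 'a) \<Rightarrow> ('m \<Rightarrow> 'a) \<Rightarrow> ('m \<Rightarrow> 'a)) \<Rightarrow> ('m \<Rightarrow> 'a \<Rightarrow> ('m \<Rightarrow> 'e) \<Rightarrow> 'e) \<Rightarrow> nat \<Rightarrow> nat \<Rightarrow>
     ('m \<Rightarrow> 'e list \<Rightarrow> 'a::real_vector) \<Rightarrow> ('m \<Rightarrow> 'e list \<Rightarrow> 'a) \<Rightarrow> ('m \<Rightarrow> 'e) list \<Rightarrow> 'm \<Rightarrow> 'a" where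
  "bracket_formula br \<rho> n m P Q us =
     insertion_sum \<rho> n m P Q us
     - (-1) ^ (m * n) *\<^sub>R insertion_sum \<rho> m n Q P us
     + (-1) ^ (m * n) *\<^sub>R
         (\<Sum>\<sigma>\<in>unshuffles [n, m]. of_int (sign \<sigma>) *\<^sub>R
            br (eval_cochain P (map (\<lambda>i. us ! \<sigma> i) [0..<n]))
               (eval_cochain Q (map (\<lambda>i. us ! \<sigma> i) [n..<m + n])))"

text \<open>The formula prescribes the values of the bracket on smooth sections; the bracket of cochains of
  degrees \<open>n\<close> and \<open>m\<close> is the cochain of degree \<open>n + m\<close> having these values. That it exists is a claim.\<close>

definition homogeneous_bracket ::
    "'m manifold \<Rightarrow> ('m, 'a::real_vector) vbundle \<Rightarrow> (('m \<Rightarrow> 'a) \<Rightarrow> ('m \<Rightarrow> 'a) \<Rightarrow> ('m \<Rightarrow> 'a)) \<Rightarrow>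
     ('m, 'e::real_vector) vbundle \<Rightarrow> ('m \<Rightarrow> 'a \<Rightarrow> ('m \<Rightarrow> 'e) \<Rightarrow> 'e) \<Rightarrow> nat \<Rightarrow> nat \<Rightarrow>
     ('m \<Rightarrow> 'e list \<Rightarrow> 'a) \<Rightarrow> ('m \<Rightarrow> 'e list \<Rightarrow> 'a) \<Rightarrow> 'm \<Rightarrow> 'e list \<Rightarrow> 'a" where
  "homogeneous_bracket M A br E \<rho> n m P Q =
     (THE R. R \<in> cochains M E A (n + m) \<and>
        (\<forall>us. length us = m + n \<and> set us \<subseteq> sections M E \<longrightarrow>
           eval_cochain R us = bracket_formula br \<rho> n m P Q us))"

definition degree_part :: "nat \<Rightarrow> ('m \<Rightarrow> 'e list \<Rightarrow> 'a::zero) \<Rightarrow> 'm \<Rightarrow> 'e list \<Rightarrow> 'a" where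
  "degree_part k P = (\<lambda>x vs. if length vs = k then P x vs else 0)"

text \<open>Bilinear extension to the direct sum of all \<open>cochains M E A k\<close>.\<close>

definition cochain_bracket ::
    "'m manifold \<Rightarrow> ('m, 'a::real_vector) vbundle \<Rightarrow> (('m \<Rightarrow> 'a) \<Rightarrow> ('m \<Rightarrow> 'a) \<Rightarrow> ('m \<Rightarrow> 'a)) \<Rightarrow>
     ('m, 'e::real_vector) vbundle \<Rightarrow> ('m \<Rightarrow> 'a \<Rightarrow> ('m \<Rightarrow> 'e) \<Rightarrow> 'e) \<Rightarrow>
     ('m \<Rightarrow> 'e list \<Rightarrow> 'a) \<Rightarrow> ('m \<Rightarrow> 'e list \<Rightarrow> 'a) \<Rightarrow> 'm \<Rightarrow> 'e list \<Rightarrow> 'a" where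
  "cochain_bracket M A br E \<rho> P Q =
     (\<Sum>n\<in>{n. degree_part n P \<noteq> 0}. \<Sum>m\<in>{m. degree_part m Q \<noteq> 0}.
        homogeneous_bracket M A br E \<rho> n m (degree_part n P) (degree_part m Q))"

text \<open>A bundle map \<open>E \<rightarrow> \<A>\<close> as a cochain of degree \<open>1\<close>.\<close>

definition as_cochain :: "('m \<Rightarrow> 'e \<Rightarrow> 'a::zero) \<Rightarrow> 'm \<Rightarrow> 'e list \<Rightarrow> 'a" where
  "as_cochain T = (\<lambda>x vs. if length vs = 1 then T x (hd vs) else 0)"

end

theory Submission
  imports Defs
begin

text \<open>
  On \<open>\<real>\<close>-multilinear maps from \<open>\<Gamma>(E)\<close> to \<open>\<Gamma>(\<A>)\<close> the bracket is the antisymmetrisation of the bilinear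
  operation \<open>{P, Q} = D\<^sub>Q P - D\<^sub>P Q + [P, Q]\<close>, where \<open>D\<^sub>Q P\<close> is the sum over all arguments of \<open>P\<close> of the
  maps obtained by applying \<open>\<rho>(Q)\<close> to that argument, and \<open>P\<close> and \<open>Q\<close> have separate arguments. Since
  \<open>[D\<^sub>R, D\<^sub>Q] P = D\<^bsub>[Q,R]\<^esub> P\<close> when the arguments of \<open>Q\<close> and \<open>R\<close> are frozen, this is the bracket of an
  action Lie algebra, and it satisfies the Jacobi identity before antisymmetrisation; the Koszul signs
  come from permuting blocks of arguments. It is also \<open>C\<^sup>\<infinity>\<close>-linear in each argument before
  antisymmetrisation, because the derivative terms cancel. Bump functions turn \<open>C\<^sup>\<infinity>\<close>-multilinear maps on
  sections into bundle maps.
\<close>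

section \<open>Antisymmetrisation\<close>

text \<open>On alternating cochains an unshuffle sum is the signed sum over all permutations divided
  by the factorials of the block lengths, and an inner full antisymmetrisation is absorbed by an
  outer one at the price of a factorial. Working with full sums therefore spares the Jacobi identity
  every comparison of nested shuffles; what is left are identities between values on concatenated
  lists, and each sign is that of exchanging two adjacent blocks. The signs of the two derivative
  terms of \<open>{P, Q}\<close> are those of the action Lie algebra in which x acts by the vector
  field v \<mapsto> - \<rho>(x) v. The obstacle on the geometric side is that the bracket and \<rho>
  take global sections, whereas a cochain is a family of maps on fibres. So the cochain with the
  prescribed values has to be constructed and shown unique: unique because each vector of a fibre is
  the value of a global section, and existing because a C^infty-multilinear map has at x a value
  that depends on its arguments at x alone.\<close>

definition alt :: "('v list \<Rightarrow> 'w::real_vector) \<Rightarrow> 'v list \<Rightarrow> 'w" where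
  "alt F w = (\<Sum>\<sigma> | \<sigma> permutes {..<length w}. of_int (sign \<sigma>) *\<^sub>R F (permute_list \<sigma> w))"

lemma sign_comp_permutes:
  assumes "p permutes S" "q permutes S" "finite S"
  shows "sign (p \<circ> q) = sign p * sign q"
  by (meson assms permutation_permutes sign_compose)

lemma of_int_sign_self [simp]: "(of_int (sign \<sigma>) :: 'a::ring_1) * of_int (sign \<sigma>) = 1"
  by (metis of_int_1 of_int_mult sign_idempotent)

lemma alt_cong:
  assumes "\<And>v. length v = length w \<Longrightarrow> set v = set w \<Longrightarrow> F v = G v"
  shows "alt F w = alt G w"
  unfolding alt_def by (rule sum.cong) (auto simp: assms)

lemma alt_add: "alt (\<lambda>v. F v + G v) w = alt F w + alt G w"
  by (simp add: alt_def scaleR_add_right sum.distrib)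

lemma alt_scaleR: "alt (\<lambda>v. c *\<^sub>R F v) w = c *\<^sub>R alt F w"
  by (simp add: alt_def scaleR_sum_right mult.commute)

lemma alt_minus: "alt (\<lambda>v. - F v) w = - alt F w"
  using alt_scaleR[of "-1" F w] by simp

lemma alt_diff: "alt (\<lambda>v. F v - G v) w = alt F w - alt G w"
  using alt_add[of F "\<lambda>v. - G v" w] by (simp add: alt_minus)

lemma alt_zero [simp]: "alt (\<lambda>v. 0) w = 0"
  by (simp add: alt_def)

lemma alt_sum: "alt (\<lambda>v. \<Sum>i\<in>I. F i v) w = (\<Sum>i\<in>I. alt (F i) w)"
  by (induction I rule: infinite_finite_induct) (simp_all add: alt_add)

text \<open>Left translation of the summation index by \<open>\<tau>\<close>;
  \<open>alt_comp_permute\<close> uses right translation. So permuting the list outside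
  \<open>alt\<close> or inside \<open>F\<close> costs the same sign, and one may be traded for the
  other.\<close>

lemma alt_permute:
  assumes "\<tau> permutes {..<length w}"
  shows "alt F (permute_list \<tau> w) = of_int (sign \<tau>) *\<^sub>R alt F w"
proof -
  have "alt F w = (\<Sum>\<sigma> | \<sigma> permutes {..<length w}. of_int (sign (\<tau> \<circ> \<sigma>)) *\<^sub>R F (permute_list (\<tau> \<circ> \<sigma>) w))"
    unfolding alt_def by (rule setum_permutations_compose_left) (rule assms)
  also have "\<dots> = of_int (sign \<tau>) *\<^sub>R alt F (permute_list \<tau> w)"
    unfolding alt_def scaleR_sum_right
    by (rule sum.cong) (auto simp: sign_comp_permutes[OF assms] permute_list_compose)
  finally show ?thesis by (simp)
qed

lemma alt_comp_permute:
  assumes "\<tau> permutes {..<length w}"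
  shows "alt (\<lambda>v. F (permute_list \<tau> v)) w = of_int (sign \<tau>) *\<^sub>R alt F w"
proof -
  have "alt F w = (\<Sum>\<sigma> | \<sigma> permutes {..<length w}. of_int (sign (\<sigma> \<circ> \<tau>)) *\<^sub>R F (permute_list (\<sigma> \<circ> \<tau>) w))"
    unfolding alt_def by (rule sum_permutations_compose_right) (rule assms)
  also have "\<dots> = of_int (sign \<tau>) *\<^sub>R alt (\<lambda>v. F (permute_list \<tau> v)) w"
    unfolding alt_def scaleR_sum_right
    by (rule sum.cong) (auto simp: sign_comp_permutes[OF _ assms] permute_list_compose[OF assms] mult.commute)
  finally show ?thesis by (simp)
qed

text \<open>By \<open>alt_comp_permute\<close> each of the k! inner terms contributes
  \<open>alt F w\<close>, its sign occurring twice. This removes the inner antisymmetrisation from a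
  nested bracket.\<close>

lemma alt_absorb:
  assumes "k \<le> length w"
  shows "alt (\<lambda>v. \<Sum>\<tau> | \<tau> permutes {..<k}. of_int (sign \<tau>) *\<^sub>R F (permute_list \<tau> v)) w = fact k *\<^sub>R alt F w"
proof -
  have "alt (\<lambda>v. \<Sum>\<tau> | \<tau> permutes {..<k}. of_int (sign \<tau>) *\<^sub>R F (permute_list \<tau> v)) w
      = (\<Sum>\<tau> | \<tau> permutes {..<k}. alt F w)"
    unfolding alt_sum alt_scaleR
  proof (rule sum.cong, goal_cases)
    case (2 \<tau>)
    then have "\<tau> permutes {..<length w}"
      using assms by (auto intro: permutes_subset)
    then show ?case by (simp add: alt_comp_permute)
  qed simp
  also have "\<dots> = fact k *\<^sub>R alt F w"
    by (simp only: sum_constant_scaleR) (simp add: card_permutations)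
  finally show ?thesis .
qed

lemma permute_list_transpose:
  assumes "i < length w" "j < length w"
  shows "permute_list (Transposition.transpose i j) w = w[i := w ! j, j := w ! i]"
  using assms by (intro nth_equalityI)
    (auto simp: permute_list_def nth_list_update transpose_def)

lemma alt_swap:
  assumes "i < length w" "j < length w" "i \<noteq> j"
  shows "alt F (w[i := w ! j, j := w ! i]) = - alt F w"
  using alt_permute[of "Transposition.transpose i j" w F] assms
  by (simp add: permute_list_transpose permutes_swap_id sign_swap_id)

lemma alt_comp_swap:
  assumes "i < length w" "j < length w" "i \<noteq> j"
  shows "alt (\<lambda>v. F (v[i := v ! j, j := v ! i])) w = - alt F w"
proof -
  have "alt (\<lambda>v. F (v[i := v ! j, j := v ! i])) w = alt (\<lambda>v. F (permute_list (Transposition.transpose i j) v)) w"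
    by (rule alt_cong) (use assms in \<open>simp add: permute_list_transpose\<close>)
  then show ?thesis
    using alt_comp_permute[of "Transposition.transpose i j" w F] assms
    by (simp add: permutes_swap_id sign_swap_id)
qed

lemma alt_eq_nth:
  assumes "i < length w" "j < length w" "i \<noteq> j" "w ! i = w ! j"
  shows "alt F w = 0"
proof -
  have "w[i := w ! j, j := w ! i] = w"
    using assms by (metis list_update_id)
  then have "alt F w = - alt F w"
    using alt_swap[of i w j F] assms by simp
  then show ?thesis
    by (metis add.right_inverse real_vector_affinity_eq scaleR_half_double scaleR_zero_right)
qed

lemma alt_2: "alt F [u, v] = F [u, v] - F [v, u]"
proof -
  have "{\<sigma>. \<sigma> permutes {..<length [u, v]}} = {id, Transposition.transpose 0 (Suc 0)}"
    by (auto simp: numeral_2_eq_2 lessThan_Suc permutes_doubleton_iff insert_commute)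
  moreover have "id \<noteq> Transposition.transpose 0 (Suc 0)"
    by (metis id_apply transpose_apply_first zero_neq_one One_nat_def)
  moreover have "permute_list (Transposition.transpose 0 (Suc 0)) [u, v] = [v, u]"
    by (simp add: permute_list_transpose)
  ultimately show ?thesis
    unfolding alt_def by (simp add: sign_swap_id)
qed

subsection \<open>Exchanging blocks\<close>

lemma alt_move_element: "alt F (xs @ zs @ y # ws) = (-1) ^ length zs *\<^sub>R alt F (xs @ y # zs @ ws)"
proof (induction zs arbitrary: xs)
  case (Cons z zs)
  have "alt F (xs @ z # zs @ y # ws) = (-1) ^ length zs *\<^sub>R alt F (xs @ z # y # zs @ ws)"
    using Cons.IH[of "xs @ [z]"] by simp
  moreover have "alt F (xs @ z # y # zs @ ws) = - alt F (xs @ y # z # zs @ ws)"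
    using alt_swap[of "length xs" "xs @ y # z # zs @ ws" "Suc (length xs)" F]
    by (simp add: nth_append list_update_append)
  ultimately show ?case by simp
qed simp

text \<open>The elements of \<open>as\<close> pass \<open>bs\<close> one at a time, each at the cost
  of one sign per element of \<open>bs\<close>; the product is the Koszul sign of the two
  blocks.\<close>

lemma alt_swap_blocks:
  "alt F (xs @ as @ bs @ ws) = (-1) ^ (length as * length bs) *\<^sub>R alt F (xs @ bs @ as @ ws)"
proof (induction as arbitrary: xs)
  case (Cons a as)
  have "alt F (xs @ a # as @ bs @ ws) = (-1) ^ (length as * length bs) *\<^sub>R alt F (xs @ a # bs @ as @ ws)"
    using Cons.IH[of "xs @ [a]"] by simp
  moreover have "alt F (xs @ bs @ a # as @ ws) = (-1) ^ length bs *\<^sub>R alt F (xs @ a # bs @ as @ ws)"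
    by (rule alt_move_element)
  ultimately show ?case by (simp add: power_add flip: power_mult_distrib)
qed simp

text \<open>The rearrangement of \<open>c @ b @ a\<close> into \<open>c @ a @ b\<close> that occurs
  in the last term of the Jacobi identity and, with \<open>r = 0\<close>, in skew symmetry. It is
  given on lists because the terms to be compared are split into blocks, not indexed by
  permutations.\<close>

definition bswap :: "nat \<Rightarrow> nat \<Rightarrow> 'v list \<Rightarrow> 'v list" where
  "bswap r q w = take r w @ drop (r + q) w @ take q (drop r w)"

lemma bswap_append [simp]: "length c = r \<Longrightarrow> length b = q \<Longrightarrow> bswap r q (c @ b @ a) = c @ a @ b"
  by (simp add: bswap_def)

lemma bswap_0_append [simp]: "length b = q \<Longrightarrow> bswap 0 q (b @ a) = a @ b"
  by (simp add: bswap_def)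

lemma bswap_map: "bswap r q (map f w) = map f (bswap r q w)"
  by (simp add: bswap_def take_map drop_map)

text \<open>Applying \<open>bswap\<close> to the list of indices produces the permutation; since
  \<open>bswap\<close> commutes with \<open>map\<close>, the same one serves every list of length
  \<open>n\<close>.\<close>

lemma bswap_permute_list:
  assumes "r + q \<le> n"
  obtains \<tau> where "\<tau> permutes {..<n}" "\<And>w::'v list. length w = n \<Longrightarrow> bswap r q w = permute_list \<tau> w"
proof -
  define l where "l = bswap r q [0..<n]"
  have mset: "mset l = mset [0..<n]"
  proof -
    have "mset l = mset (take r [0..<n]) + mset (drop (r + q) [0..<n]) + mset (take q (drop r [0..<n]))"
      by (simp add: l_def bswap_def)
    also have "\<dots> = mset (take r [0..<n] @ take q (drop r [0..<n]) @ drop q (drop r [0..<n]))"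
      by (simp add: add.commute add.left_commute)
    finally show ?thesis by (simp only: append_take_drop_id)
  qed
  then obtain \<tau> where \<tau>: "\<tau> permutes {..<length [0..<n]}" "permute_list \<tau> [0..<n] = l"
    using mset_eq_permutation by metis
  have "bswap r q w = permute_list \<tau> w" if "length w = n" for w :: "'v list"
  proof -
    have "w = map ((!) w) [0..<n]"
      using that map_nth by metis
    then have "bswap r q w = map ((!) w) l" "permute_list \<tau> w = map ((!) w) (permute_list \<tau> [0..<n])"
      unfolding l_def using \<tau>(1) by (metis bswap_map, metis permute_list_map)
    then show ?thesis using \<tau>(2) by simp
  qed
  with \<tau>(1) show ?thesis by (intro that) auto
qed

text \<open>The permutation behind \<open>bswap\<close> is moved from inside \<open>alt\<close> to
  the list outside, where \<open>alt_swap_blocks\<close> evaluates its sign; no inversions have to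
  be counted.\<close>

lemma alt_comp_bswap:
  assumes "r + q \<le> length w"
  shows "alt (\<lambda>v. F (bswap r q v)) w = (-1) ^ (q * (length w - r - q)) *\<^sub>R alt F w"
proof -
  obtain \<tau> where \<tau>: "\<tau> permutes {..<length w}"
    "\<And>v::'a list. length v = length w \<Longrightarrow> bswap r q v = permute_list \<tau> v"
    using bswap_permute_list[OF assms] by blast
  have "alt (\<lambda>v. F (bswap r q v)) w = alt (\<lambda>v. F (permute_list \<tau> v)) w"
    by (rule alt_cong) (simp add: \<tau>)
  also have "\<dots> = alt F (bswap r q w)"
    by (simp add: alt_comp_permute[OF \<tau>(1)] alt_permute[OF \<tau>(1)] \<tau>(2))
  also have "\<dots> = alt F (take r w @ drop (r + q) w @ take q (drop r w) @ [])"
    by (simp add: bswap_def)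
  also have "\<dots> = (-1) ^ (length (drop (r + q) w) * length (take q (drop r w))) *\<^sub>R
      alt F (take r w @ take q (drop r w) @ drop (r + q) w @ [])"
    by (rule alt_swap_blocks)
  also have "take r w @ take q (drop r w) @ drop (r + q) w @ [] = w"
    by (metis append.right_neutral append_take_drop_id drop_drop add.commute)
  finally show ?thesis
    using assms by (simp add: mult.commute)
qed

subsection \<open>Unshuffles\<close>

text \<open>At the least point i that is moved, both the image and the preimage of i exceed i, since
  smaller points are fixed; i and its preimage then contradict monotonicity.\<close>

lemma strict_mono_on_permutes_id:
  fixes \<tau> :: "nat \<Rightarrow> nat"
  assumes "\<tau> permutes S" "strict_mono_on S \<tau>"
  shows "\<tau> = id"
proof -
  have "\<tau> i = i" for i
  proof (induction i rule: less_induct)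
    case (less i)
    show ?case
    proof (rule ccontr)
      assume ne: "\<tau> i \<noteq> i"
      then have i: "i \<in> S"
        using assms(1) by (meson permutes_not_in)
      obtain j where j: "\<tau> j = i" "j \<in> S"
        using assms(1) i by (metis permutes_in_image permutes_surj surjD)
      have "\<tau> i > i"
        using less.IH ne permutes_inj[OF assms(1)] by (metis injD linorder_neqE_nat)
      moreover have "j > i"
        using less.IH j ne by (metis linorder_neqE_nat)
      ultimately show False
        using assms(2) i j unfolding strict_mono_on_def by fastforce
    qed
  qed
  then show ?thesis by auto
qed

text \<open>Rearrangement: among all permutations of the positions in \<open>S\<close>, one that maximises
  \<open>\<Sum>i. i * \<sigma> (\<tau> i)\<close> sorts the values of \<open>\<sigma>\<close>.\<close>

lemma exists_sorting_permutation:
  fixes \<sigma> :: "nat \<Rightarrow> nat"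
  assumes "finite S" "inj \<sigma>"
  shows "\<exists>\<tau>. \<tau> permutes S \<and> strict_mono_on S (\<sigma> \<circ> \<tau>)"
proof -
  let ?c = "\<lambda>\<tau>. \<Sum>i\<in>S. int i * int (\<sigma> (\<tau> i))"
  have fin: "finite {\<tau>. \<tau> permutes S}"
    using assms(1) by (rule finite_permutations)
  have "{\<tau>. \<tau> permutes S} \<noteq> {}"
    using permutes_id by blast
  then obtain \<tau> where \<tau>: "\<tau> permutes S" and "?c \<tau> = Max (?c ` {\<tau>. \<tau> permutes S})"
    using Max_in[of "?c ` {\<tau>. \<tau> permutes S}"] fin permutes_id[of S]
    by (metis (no_types, lifting) empty_iff finite_imageI image_iff image_is_empty mem_Collect_eq)
  then have max: "\<And>\<tau>'. \<tau>' permutes S \<Longrightarrow> ?c \<tau>' \<le> ?c \<tau>"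
    using fin by simp
  have "\<sigma> (\<tau> i) < \<sigma> (\<tau> j)" if ij: "i \<in> S" "j \<in> S" "i < j" for i j
  proof (rule ccontr)
    assume "\<not> \<sigma> (\<tau> i) < \<sigma> (\<tau> j)"
    moreover have "\<sigma> (\<tau> i) \<noteq> \<sigma> (\<tau> j)"
      using assms(2) permutes_inj[OF \<tau>] ij by (metis injD nat_neq_iff)
    ultimately have gt: "\<sigma> (\<tau> j) < \<sigma> (\<tau> i)" by simp
    let ?t = "\<tau> \<circ> Transposition.transpose i j"
    have S: "S = insert i (insert j (S - {i, j}))" using ij by auto
    have eq: "(\<Sum>k\<in>S - {i, j}. int k * int (\<sigma> (?t k))) = (\<Sum>k\<in>S - {i, j}. int k * int (\<sigma> (\<tau> k)))"
      by (rule sum.cong) (auto simp: transpose_def)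
    have exp: "?c t = int i * int (\<sigma> (t i)) + (int j * int (\<sigma> (t j)) + (\<Sum>k\<in>S - {i, j}. int k * int (\<sigma> (t k))))" for t
      by (subst S) (use ij assms(1) in auto)
    \<comment> \<open>Undoing an inversion raises the sum by the product of the two gaps, against
      maximality.\<close>
    have "?c ?t - ?c \<tau> = (int j - int i) * (int (\<sigma> (\<tau> i)) - int (\<sigma> (\<tau> j)))"
      unfolding exp eq by (simp add: algebra_simps)
    also have "\<dots> > 0"
      using ij gt by simp
    finally have "?c ?t > ?c \<tau>" by simp
    moreover have "?t permutes S"
      using \<tau> ij by (simp add: permutes_compose permutes_swap_id)
    ultimately show False using max by force
  qed
  then show ?thesis
    using \<tau> by (auto simp: strict_mono_on_def)
qed

text \<open>Every permutation factors uniquely as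
  \<open>\<sigma> \<circ> \<alpha> \<circ> \<beta>\<close> with \<open>\<sigma>\<close> increasing
  on both blocks, \<open>\<alpha>\<close> permuting \<open>S\<close> and \<open>\<beta>\<close>
  permuting \<open>T\<close>. Passing from \<open>\<sigma>\<close> to the product changes
  \<open>F\<close> and the sign of the permutation by the same factor, so the summand stays
  constant. Positions outside \<open>S\<close> and \<open>T\<close> are free, as the middle block of
  length 1 requires.\<close>

lemma sum_permutes_strict_mono_on:
  fixes F :: "(nat \<Rightarrow> nat) \<Rightarrow> 'w::real_vector"
  assumes S: "S \<subseteq> {..<N}" and T: "T \<subseteq> {..<N}" and disj: "S \<inter> T = {}"
    and swapS: "\<And>\<sigma> a b. \<sigma> permutes {..<N} \<Longrightarrow> a \<in> S \<Longrightarrow> b \<in> S \<Longrightarrow> a \<noteq> b \<Longrightarrow> F (\<sigma> \<circ> Transposition.transpose a b) = - F \<sigma>"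
    and swapT: "\<And>\<sigma> a b. \<sigma> permutes {..<N} \<Longrightarrow> a \<in> T \<Longrightarrow> b \<in> T \<Longrightarrow> a \<noteq> b \<Longrightarrow> F (\<sigma> \<circ> Transposition.transpose a b) = - F \<sigma>"
  shows "(\<Sum>\<sigma> | \<sigma> permutes {..<N}. of_int (sign \<sigma>) *\<^sub>R F \<sigma>) =
    (fact (card S) * fact (card T)) *\<^sub>R
      (\<Sum>\<sigma> | \<sigma> permutes {..<N} \<and> strict_mono_on S \<sigma> \<and> strict_mono_on T \<sigma>. of_int (sign \<sigma>) *\<^sub>R F \<sigma>)"
proof -
  have fS: "finite S" and fT: "finite T"
    using S T finite_subset by blast+
  \<comment> \<open>Transpositions generate the permutations of a block, so \<open>F\<close>
    transforms by the sign of any of them.\<close>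
  have inv: "\<forall>\<sigma>. \<sigma> permutes {..<N} \<longrightarrow> F (\<sigma> \<circ> \<tau>) = of_int (sign \<tau>) *\<^sub>R F \<sigma>"
    if R: "\<tau> permutes R" "finite R" "R \<subseteq> {..<N}"
      and sw: "\<And>\<sigma> a b. \<sigma> permutes {..<N} \<Longrightarrow> a \<in> R \<Longrightarrow> b \<in> R \<Longrightarrow> a \<noteq> b \<Longrightarrow> F (\<sigma> \<circ> Transposition.transpose a b) = - F \<sigma>" for R \<tau>
    using R(1,2)
  proof (induction rule: permutes_induct)
    case (swap a b p)
    have p: "p permutes {..<N}" and t: "Transposition.transpose a b permutes {..<N}"
      using swap R(3) by (auto intro: permutes_subset permutes_swap_id)
    show ?case
    proof (intro allI impI)
      fix \<sigma> assume \<sigma>: "\<sigma> permutes {..<N}"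
      then have "\<sigma> \<circ> Transposition.transpose a b permutes {..<N}"
        using t by (rule permutes_compose[rotated])
      then have "F (\<sigma> \<circ> Transposition.transpose a b \<circ> p) = of_int (sign p) *\<^sub>R F (\<sigma> \<circ> Transposition.transpose a b)"
        using swap.IH by blast
      then show "F (\<sigma> \<circ> (Transposition.transpose a b \<circ> p)) = of_int (sign (Transposition.transpose a b \<circ> p)) *\<^sub>R F \<sigma>"
        using sw[OF \<sigma> swap.hyps(1,2,3)] swap.hyps(3)
        by (simp add: sign_comp_permutes[OF t p] sign_swap_id comp_assoc)
    qed
  qed simp
  have invS: "F (\<sigma> \<circ> \<tau>) = of_int (sign \<tau>) *\<^sub>R F \<sigma>" if "\<tau> permutes S" "\<sigma> permutes {..<N}" for \<sigma> \<tau>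
    using inv[OF that(1) fS S swapS] that(2) by blast
  have invT: "F (\<sigma> \<circ> \<tau>) = of_int (sign \<tau>) *\<^sub>R F \<sigma>" if "\<tau> permutes T" "\<sigma> permutes {..<N}" for \<sigma> \<tau>
    using inv[OF that(1) fT T swapT] that(2) by blast
  let ?U = "{\<sigma>. \<sigma> permutes {..<N} \<and> strict_mono_on S \<sigma> \<and> strict_mono_on T \<sigma>}"
  let ?PS = "{\<tau>. \<tau> permutes S}" and ?PT = "{\<tau>. \<tau> permutes T}"
  let ?h = "\<lambda>(\<sigma>, \<alpha>, \<beta>). \<sigma> \<circ> \<alpha> \<circ> \<beta>"
  have fixS: "\<alpha> x = x" if "\<alpha> permutes S" "x \<in> T" for \<alpha> x
    using that disj by (metis disjoint_iff permutes_not_in)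
  have fixT: "\<alpha> x = x" if "\<alpha> permutes T" "x \<in> S" for \<alpha> x
    using that disj by (metis disjoint_iff permutes_not_in)
  have perm: "\<alpha> permutes {..<N}" if "\<alpha> permutes S \<or> \<alpha> permutes T" for \<alpha>
    using that S T by (auto intro: permutes_subset)
  have bij: "bij_betw ?h (?U \<times> ?PS \<times> ?PT) {\<sigma>. \<sigma> permutes {..<N}}"
  proof (rule bij_betwI')
    fix x y assume x: "x \<in> ?U \<times> ?PS \<times> ?PT" and y: "y \<in> ?U \<times> ?PS \<times> ?PT"
    obtain \<sigma> \<alpha> \<beta> \<sigma>' \<alpha>' \<beta>' where xy: "x = (\<sigma>, \<alpha>, \<beta>)" "y = (\<sigma>', \<alpha>', \<beta>')"
      by (metis prod_cases3)
    have *: "\<sigma> permutes {..<N}" "strict_mono_on S \<sigma>" "strict_mono_on T \<sigma>" "\<alpha> permutes S" "\<beta> permutes T"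
      "\<sigma>' permutes {..<N}" "strict_mono_on S \<sigma>'" "strict_mono_on T \<sigma>'" "\<alpha>' permutes S" "\<beta>' permutes T"
      using x y xy by auto
    show "(?h x = ?h y) = (x = y)"
    proof
      assume "?h x = ?h y"
      then have e: "\<sigma> \<circ> \<alpha> \<circ> \<beta> = \<sigma>' \<circ> \<alpha>' \<circ> \<beta>'" by (simp add: xy)
      \<comment> \<open>Two factorisations of one permutation differ on a block by a permutation
        \<open>\<gamma>\<close> that turns one increasing map into another, and so is increasing
        itself.\<close>
      have mono_id: "\<gamma> = id" if "\<gamma> permutes R" "strict_mono_on R \<sigma>" "strict_mono_on R (\<sigma> \<circ> \<gamma>)" for \<gamma> R
      proof (rule strict_mono_on_permutes_id[OF that(1)])
        show "strict_mono_on R \<gamma>"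
        proof (rule strict_mono_onI)
          fix r s assume rs: "r \<in> R" "s \<in> R" "r < s"
          then have "\<sigma> (\<gamma> r) < \<sigma> (\<gamma> s)"
            using that(3) unfolding strict_mono_on_def by auto
          moreover have "\<gamma> r \<in> R" "\<gamma> s \<in> R"
            using that(1) rs permutes_in_image by fastforce+
          ultimately show "\<gamma> r < \<gamma> s"
            using that(2) unfolding strict_mono_on_def by (metis less_asym linorder_neqE_nat)
        qed
      qed
      have "\<alpha> \<circ> inv \<alpha>' = id"
      proof (rule mono_id)
        show "\<alpha> \<circ> inv \<alpha>' permutes S"
          using * by (simp add: permutes_compose permutes_inv)
        have "(\<sigma> \<circ> (\<alpha> \<circ> inv \<alpha>')) x = \<sigma>' x" if "x \<in> S" for x
        proof -
          have z: "inv \<alpha>' x \<in> S"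
            using that * by (metis permutes_in_image permutes_inv)
          have "\<sigma> (\<alpha> (inv \<alpha>' x)) = \<sigma>' (\<alpha>' (inv \<alpha>' x))"
            using fun_cong[OF e, of "inv \<alpha>' x"] fixT[OF *(5) z] fixT[OF *(10) z] by simp
          then show ?thesis
            using * by (simp add: permutes_inverses)
        qed
        then show "strict_mono_on S (\<sigma> \<circ> (\<alpha> \<circ> inv \<alpha>'))"
          using *(7) unfolding strict_mono_on_def by simp
      qed (use * in auto)
      then have \<alpha>: "\<alpha> = \<alpha>'"
        using * by (metis comp_assoc comp_id fun.map_id permutes_inv_o(2) id_comp)
      have "\<beta> \<circ> inv \<beta>' = id"
      proof (rule mono_id)
        show "\<beta> \<circ> inv \<beta>' permutes T"
          using * by (simp add: permutes_compose permutes_inv)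
        have "(\<sigma> \<circ> (\<beta> \<circ> inv \<beta>')) x = \<sigma>' x" if "x \<in> T" for x
        proof -
          have z: "inv \<beta>' x \<in> T"
            using that * by (metis permutes_in_image permutes_inv)
          have "\<beta> (inv \<beta>' x) \<in> T" "\<beta>' (inv \<beta>' x) \<in> T"
            using z * by (meson permutes_in_image)+
          then have "\<sigma> (\<beta> (inv \<beta>' x)) = \<sigma>' (\<beta>' (inv \<beta>' x))"
            using fun_cong[OF e, of "inv \<beta>' x"] fixS[OF *(4)] fixS[OF *(9)] by simp
          then show ?thesis
            using * by (simp add: permutes_inverses)
        qed
        then show "strict_mono_on T (\<sigma> \<circ> (\<beta> \<circ> inv \<beta>'))"
          using *(8) unfolding strict_mono_on_def by simp
      qed (use * in auto)
      then have \<beta>: "\<beta> = \<beta>'"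
        using * by (metis comp_assoc comp_id fun.map_id permutes_inv_o(2) id_comp)
      have "\<sigma> = \<sigma>'"
      proof
        fix x
        obtain z where "\<alpha> (\<beta> z) = x"
          using * by (metis permutes_surj surjD)
        then show "\<sigma> x = \<sigma>' x"
          using fun_cong[OF e, of z] \<alpha> \<beta> by simp
      qed
      then show "x = y" using \<alpha> \<beta> xy by simp
    qed simp
  next
    fix x assume "x \<in> ?U \<times> ?PS \<times> ?PT"
    then show "?h x \<in> {\<sigma>. \<sigma> permutes {..<N}}"
      using perm by (auto intro!: permutes_compose)
  next
    fix \<pi> assume "\<pi> \<in> {\<sigma>. \<sigma> permutes {..<N}}"
    then have \<pi>: "\<pi> permutes {..<N}" by simp
    \<comment> \<open>\<open>T\<close> is sorted first and \<open>S\<close> afterwards; as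
      \<open>\<alpha>\<close> fixes \<open>T\<close> pointwise, the second sorting does not disturb
      the first.\<close>
    obtain \<beta> where \<beta>: "\<beta> permutes T" "strict_mono_on T (\<pi> \<circ> \<beta>)"
      using exists_sorting_permutation[OF fT permutes_inj[OF \<pi>]] by blast
    obtain \<alpha> where \<alpha>: "\<alpha> permutes S" "strict_mono_on S (\<pi> \<circ> \<beta> \<circ> \<alpha>)"
      using exists_sorting_permutation[OF fS, of "\<pi> \<circ> \<beta>"] permutes_inj[OF \<pi>] permutes_inj[OF \<beta>(1)]
      by (metis inj_compose)
    have "strict_mono_on T (\<pi> \<circ> \<beta> \<circ> \<alpha>)"
      using \<beta>(2) fixS[OF \<alpha>(1)] unfolding strict_mono_on_def by simp
    moreover have "\<pi> \<circ> \<beta> \<circ> \<alpha> permutes {..<N}"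
      using \<pi> \<alpha>(1) \<beta>(1) perm by (auto intro!: permutes_compose)
    ultimately have "(\<pi> \<circ> \<beta> \<circ> \<alpha>, inv \<alpha>, inv \<beta>) \<in> ?U \<times> ?PS \<times> ?PT"
      using \<alpha> \<beta> by (auto intro: permutes_inv)
    moreover have "\<pi> = \<pi> \<circ> \<beta> \<circ> \<alpha> \<circ> inv \<alpha> \<circ> inv \<beta>"
      using \<alpha>(1) \<beta>(1) by (simp add: fun_eq_iff permutes_inverses)
    ultimately show "\<exists>x\<in>?U \<times> ?PS \<times> ?PT. \<pi> = ?h x"
      by (intro bexI[of _ "(\<pi> \<circ> \<beta> \<circ> \<alpha>, inv \<alpha>, inv \<beta>)"]) simp_all
  qed
  have "(\<Sum>\<sigma> | \<sigma> permutes {..<N}. of_int (sign \<sigma>) *\<^sub>R F \<sigma>)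
      = (\<Sum>x\<in>?U \<times> ?PS \<times> ?PT. of_int (sign (?h x)) *\<^sub>R F (?h x))"
    by (rule sum.reindex_bij_betw[OF bij, symmetric])
  also have "\<dots> = (\<Sum>x\<in>?U \<times> ?PS \<times> ?PT. of_int (sign (fst x)) *\<^sub>R F (fst x))"
  proof (rule sum.cong, goal_cases)
    case (2 x)
    obtain \<sigma> \<alpha> \<beta> where x: "x = (\<sigma>, \<alpha>, \<beta>)" by (metis prod_cases3)
    with 2 have *: "\<sigma> permutes {..<N}" "\<alpha> permutes S" "\<beta> permutes T" by auto
    then have **: "\<alpha> permutes {..<N}" "\<beta> permutes {..<N}" using perm by auto
    then have "\<sigma> \<circ> \<alpha> permutes {..<N}" using * by (auto intro: permutes_compose)
    then have "F (\<sigma> \<circ> \<alpha> \<circ> \<beta>) = (of_int (sign \<beta>) * of_int (sign \<alpha>)) *\<^sub>R F \<sigma>"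
      "sign (\<sigma> \<circ> \<alpha> \<circ> \<beta>) = sign \<sigma> * sign \<alpha> * sign \<beta>"
      using invT[OF *(3)] invS[OF *(2,1)] * ** by (simp_all add: sign_comp_permutes[of _ "{..<N}"])
    then show ?case
      by (cases \<alpha> rule: sign_cases; cases \<beta> rule: sign_cases) (simp_all add: x)
  qed simp
  also have "\<dots> = (\<Sum>\<sigma>\<in>?U. \<Sum>y\<in>?PS \<times> ?PT. of_int (sign \<sigma>) *\<^sub>R F \<sigma>)"
    unfolding sum.cartesian_product by (simp add: case_prod_unfold)
  also have "\<dots> = (\<Sum>\<sigma>\<in>?U. (fact (card S) * fact (card T)) *\<^sub>R of_int (sign \<sigma>) *\<^sub>R F \<sigma>)"
    by (simp only: sum_constant_scaleR card_cartesian_product card_permutations[OF refl fS]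
        card_permutations[OF refl fT] of_nat_mult of_nat_fact)
  finally show ?thesis by (simp only: scaleR_sum_right)
qed

section \<open>Lie algebra representations and multilinear maps\<close>

lemma permute_list_update:
  assumes "\<sigma> permutes {..<length w}" "i < length w"
  shows "permute_list \<sigma> (w[\<sigma> i := x]) = (permute_list \<sigma> w)[i := x]"
proof (rule nth_equalityI)
  fix j assume "j < length (permute_list \<sigma> (w[\<sigma> i := x]))"
  then have "j < length w" by simp
  then show "permute_list \<sigma> (w[\<sigma> i := x]) ! j = (permute_list \<sigma> w)[i := x] ! j"
    using assms permutes_in_image[OF assms(1)] permutes_inj[OF assms(1)]
    by (auto simp: permute_list_nth nth_list_update inj_eq)
qed simp

text \<open>For \<open>\<phi> = r x\<close> this is the derivative of a polynomial map along the
  linear field v \<mapsto> r x v, with the arguments kept apart. Successive derivatives compose in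
  reversed order, which determines the sign in \<open>der_commutator\<close>.\<close>

definition der :: "('v list \<Rightarrow> 'w::comm_monoid_add) \<Rightarrow> ('v \<Rightarrow> 'v) \<Rightarrow> 'v list \<Rightarrow> 'w" where
  "der F \<phi> w = (\<Sum>j<length w. F (w[j := \<phi> (w ! j)]))"

lemma der_append:
  "der F \<phi> (c @ b) = der (\<lambda>v. F (v @ b)) \<phi> c + der (\<lambda>v. F (c @ v)) \<phi> b"
proof -
  have "der F \<phi> (c @ b) = (\<Sum>j\<in>{0..<length c + length b}. F ((c @ b)[j := \<phi> ((c @ b) ! j)]))"
    by (simp add: der_def atLeast0LessThan)
  also have "\<dots> = (\<Sum>j\<in>{0..<length c}. F ((c @ b)[j := \<phi> ((c @ b) ! j)]))
      + (\<Sum>j\<in>{length c..<length c + length b}. F ((c @ b)[j := \<phi> ((c @ b) ! j)]))"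
    by (rule sum.atLeastLessThan_concat[symmetric]) auto
  also have "(\<Sum>j\<in>{length c..<length c + length b}. F ((c @ b)[j := \<phi> ((c @ b) ! j)]))
      = (\<Sum>j\<in>{0..<length b}. F ((c @ b)[j + length c := \<phi> ((c @ b) ! (j + length c))]))"
    using sum.shift_bounds_nat_ivl[of "\<lambda>j. F ((c @ b)[j := \<phi> ((c @ b) ! j)])" 0 "length c" "length b"]
    by (simp add: add.commute)
  finally show ?thesis
    by (simp add: der_def atLeast0LessThan list_update_append nth_append)
qed

text \<open>The derivation treats all positions alike: reindexing its sum by \<open>\<sigma>\<close>
  moves it through the permutation of the arguments.\<close>

lemma der_alt: "der (alt F) \<phi> b = alt (der F \<phi>) b"
proof -
  have "der (alt F) \<phi> b = (\<Sum>\<sigma> | \<sigma> permutes {..<length b}. \<Sum>j<length b.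
      of_int (sign \<sigma>) *\<^sub>R F (permute_list \<sigma> (b[j := \<phi> (b ! j)])))"
    unfolding der_def alt_def by (subst sum.swap) simp
  also have "\<dots> = alt (der F \<phi>) b"
    unfolding alt_def
  proof (rule sum.cong, goal_cases)
    case (2 \<sigma>)
    then have \<sigma>: "\<sigma> permutes {..<length b}" by simp
    have "(\<Sum>j<length b. F (permute_list \<sigma> (b[j := \<phi> (b ! j)]))) =
        (\<Sum>i<length b. F (permute_list \<sigma> (b[\<sigma> i := \<phi> (b ! \<sigma> i)])))"
      by (rule sum.reindex_bij_betw[OF permutes_imp_bij[OF \<sigma>], symmetric])
    also have "\<dots> = der F \<phi> (permute_list \<sigma> b)"
      unfolding der_def using \<sigma> by (simp add: permute_list_update permute_list_nth)
    finally show ?case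
      by (simp flip: scaleR_sum_right)
  qed simp
  finally show ?thesis .
qed

text \<open>Models \<open>\<Gamma>(\<A>)\<close> acting on \<open>\<Gamma>(E)\<close>. Skew
  symmetry, the Jacobi identity and the comparison with unshuffles are proved at this level. Carrier
  sets are used because smooth sections form a subset of a function type.\<close>

locale lie_representation =
  fixes \<gg> :: "'g::real_vector set" and br :: "'g \<Rightarrow> 'g \<Rightarrow> 'g"
    and V :: "'v::real_vector set" and r :: "'g \<Rightarrow> 'v \<Rightarrow> 'v"
  assumes lie: "lie_algebra_on \<gg> br"
    and subspaceV: "subspace V"
    and r_closed: "x \<in> \<gg> \<Longrightarrow> v \<in> V \<Longrightarrow> r x v \<in> V"
    and r_linear: "x \<in> \<gg> \<Longrightarrow> v \<in> V \<Longrightarrow> w \<in> V \<Longrightarrow> r x (c *\<^sub>R v + d *\<^sub>R w) = c *\<^sub>R r x v + d *\<^sub>R r x w"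
    and r_linear_left: "x \<in> \<gg> \<Longrightarrow> y \<in> \<gg> \<Longrightarrow> v \<in> V \<Longrightarrow> r (c *\<^sub>R x + d *\<^sub>R y) v = c *\<^sub>R r x v + d *\<^sub>R r y v"
    and r_bracket: "x \<in> \<gg> \<Longrightarrow> y \<in> \<gg> \<Longrightarrow> v \<in> V \<Longrightarrow> r (br x y) v = r x (r y v) - r y (r x v)"
begin

lemma subspace_g: "subspace \<gg>"
  using lie by (simp add: lie_algebra_on_def)

lemma g_closed:
  "x \<in> \<gg> \<Longrightarrow> y \<in> \<gg> \<Longrightarrow> x + y \<in> \<gg>" "x \<in> \<gg> \<Longrightarrow> y \<in> \<gg> \<Longrightarrow> x - y \<in> \<gg>"
  "x \<in> \<gg> \<Longrightarrow> c *\<^sub>R x \<in> \<gg>" "0 \<in> \<gg>" "x \<in> \<gg> \<Longrightarrow> - x \<in> \<gg>"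
  "x \<in> \<gg> \<Longrightarrow> y \<in> \<gg> \<Longrightarrow> br x y \<in> \<gg>"
  using subspace_g lie
  by (auto simp: subspace_add subspace_diff subspace_scale subspace_0 subspace_neg lie_algebra_on_def)

lemma g_sum: "(\<And>i. i \<in> I \<Longrightarrow> f i \<in> \<gg>) \<Longrightarrow> (\<Sum>i\<in>I. f i) \<in> \<gg>"
  using subspace_g by (rule subspace_sum)

lemma br_linear:
  assumes "x \<in> \<gg>" "y \<in> \<gg>" "z \<in> \<gg>"
  shows "br (c *\<^sub>R x + d *\<^sub>R y) z = c *\<^sub>R br x z + d *\<^sub>R br y z"
    "br z (c *\<^sub>R x + d *\<^sub>R y) = c *\<^sub>R br z x + d *\<^sub>R br z y"
  using lie assms by (auto simp: lie_algebra_on_def bilinear_on_def)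

lemma br_simps:
  assumes "x \<in> \<gg>" "y \<in> \<gg>" "z \<in> \<gg>"
  shows "br (x + y) z = br x z + br y z" "br (x - y) z = br x z - br y z"
    "br z (x + y) = br z x + br z y" "br z (x - y) = br z x - br z y"
  using br_linear[OF assms, of 1 1] br_linear[OF assms, of 1 "-1"] by simp_all

lemma br_scaleR:
  assumes "x \<in> \<gg>" "z \<in> \<gg>"
  shows "br (c *\<^sub>R x) z = c *\<^sub>R br x z" "br z (c *\<^sub>R x) = c *\<^sub>R br z x"
  using br_linear[OF assms(1,1,2), of c 0] by simp_all

lemma br_zero: "x \<in> \<gg> \<Longrightarrow> br 0 x = 0" "x \<in> \<gg> \<Longrightarrow> br x 0 = 0"
  using br_scaleR(1)[of x x 0] br_scaleR(2)[of x x 0] by simp_all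

lemma br_sum:
  assumes "\<And>i. i \<in> I \<Longrightarrow> f i \<in> \<gg>" "y \<in> \<gg>"
  shows "br (\<Sum>i\<in>I. f i) y = (\<Sum>i\<in>I. br (f i) y)" "br y (\<Sum>i\<in>I. f i) = (\<Sum>i\<in>I. br y (f i))"
  using assms by (induction I rule: infinite_finite_induct) (simp_all add: br_simps g_sum br_zero)

lemma br_skew:
  assumes "x \<in> \<gg>" "y \<in> \<gg>"
  shows "br y x = - br x y"
proof -
  have "br (x + y) (x + y) = 0" "br x x = 0" "br y y = 0"
    using lie assms g_closed by (auto simp: lie_algebra_on_def)
  then have "br x y + br y x = 0"
    using assms by (simp add: br_simps g_closed add.commute)
  then show ?thesis by (metis add.commute eq_neg_iff_add_eq_0)
qed

lemma br_minus: "x \<in> \<gg> \<Longrightarrow> y \<in> \<gg> \<Longrightarrow> br (- x) y = - br x y" "x \<in> \<gg> \<Longrightarrow> y \<in> \<gg> \<Longrightarrow> br y (- x) = - br y x"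
  using br_scaleR[of x y "-1"] by simp_all

lemma br_jacobi:
  assumes "x \<in> \<gg>" "y \<in> \<gg>" "z \<in> \<gg>"
  shows "br x (br y z) = br (br x y) z + br y (br x z)"
proof -
  have "br x (br y z) + br y (br z x) + br z (br x y) = 0"
    using lie assms by (auto simp: lie_algebra_on_def)
  moreover have "br y (br z x) = - br y (br x z)"
    using br_skew[OF assms(1,3)] br_minus(2)[OF g_closed(6)[OF assms(1,3)] assms(2)] by simp
  moreover have "br z (br x y) = - br (br x y) z"
    by (rule br_skew) (use assms g_closed in auto)
  ultimately show ?thesis by (simp add: algebra_simps)
qed

definition multilin :: "nat \<Rightarrow> ('v list \<Rightarrow> 'g) \<Rightarrow> bool" where
  "multilin k F \<longleftrightarrow> (\<forall>ws. length ws = k \<and> set ws \<subseteq> V \<longrightarrow> F ws \<in> \<gg> \<and>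
     (\<forall>i<k. \<forall>v\<in>V. \<forall>w\<in>V. \<forall>c d.
       F (ws[i := c *\<^sub>R v + d *\<^sub>R w]) = c *\<^sub>R F (ws[i := v]) + d *\<^sub>R F (ws[i := w])))"

text \<open>The condition that skew symmetry and the absorption of an inner antisymmetrisation put
  on the inner map; it passes to \<open>pb\<close> without a case distinction on slots.\<close>

definition gvalued :: "nat \<Rightarrow> ('v list \<Rightarrow> 'g) \<Rightarrow> bool" where
  "gvalued k F \<longleftrightarrow> (\<forall>ws. length ws = k \<and> set ws \<subseteq> V \<longrightarrow> F ws \<in> \<gg>)"

definition lin :: "('v \<Rightarrow> 'v) \<Rightarrow> bool" where
  "lin \<phi> \<longleftrightarrow> (\<forall>v\<in>V. \<phi> v \<in> V \<and> (\<forall>w\<in>V. \<forall>c d. \<phi> (c *\<^sub>R v + d *\<^sub>R w) = c *\<^sub>R \<phi> v + d *\<^sub>R \<phi> w))"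

text \<open>The operation \<open>{P, Q}\<close> of the overview on one list. The arguments of
  \<open>Q\<close> come first, to agree with the unshuffles of type (m, 1, n - 1), whose first block
  is fed to \<open>Q\<close>.\<close>

definition pb :: "nat \<Rightarrow> ('v list \<Rightarrow> 'g) \<Rightarrow> ('v list \<Rightarrow> 'g) \<Rightarrow> 'v list \<Rightarrow> 'g" where
  "pb m P Q w = der P (r (Q (take m w))) (drop m w) - der Q (r (P (drop m w))) (take m w)
     + br (P (drop m w)) (Q (take m w))"

lemma lin_r: "x \<in> \<gg> \<Longrightarrow> lin (r x)"
  by (simp add: lin_def r_closed r_linear)

lemma multilin_gvalued: "multilin k F \<Longrightarrow> gvalued k F"
  by (simp add: multilin_def gvalued_def)

lemma gvaluedD: "gvalued k F \<Longrightarrow> length ws = k \<Longrightarrow> set ws \<subseteq> V \<Longrightarrow> F ws \<in> \<gg>"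
  by (simp add: gvalued_def)

lemma multilinD:
  assumes "multilin k F" "length ws = k" "set ws \<subseteq> V" "i < k" "v \<in> V" "w \<in> V"
  shows "F (ws[i := c *\<^sub>R v + d *\<^sub>R w]) = c *\<^sub>R F (ws[i := v]) + d *\<^sub>R F (ws[i := w])"
  using assms by (simp add: multilin_def)

lemma multilin_diff:
  assumes "multilin k F" "length ws = k" "set ws \<subseteq> V" "i < k" "v \<in> V" "w \<in> V"
  shows "F (ws[i := v - w]) = F (ws[i := v]) - F (ws[i := w])"
  using multilinD[OF assms, of 1 "-1"] by simp

lemma set_update_V: "set ws \<subseteq> V \<Longrightarrow> x \<in> V \<Longrightarrow> set (ws[i := x]) \<subseteq> V"
  using set_update_subset_insert by fastforce

lemma set_update_lin: "lin \<phi> \<Longrightarrow> set ws \<subseteq> V \<Longrightarrow> j < length ws \<Longrightarrow> set (ws[j := \<phi> (ws ! j)]) \<subseteq> V"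
  by (rule set_update_V) (auto simp: lin_def subset_iff)

lemma gvalued_der:
  assumes "gvalued k F" "lin \<phi>"
  shows "gvalued k (der F \<phi>)"
  unfolding gvalued_def der_def
  by (intro allI impI g_sum gvaluedD[OF assms(1)] set_update_lin[OF assms(2)]) simp_all

lemma der_in:
  assumes "gvalued (length a) F" "lin \<phi>" "set a \<subseteq> V"
  shows "der F \<phi> a \<in> \<gg>"
  using gvalued_der[OF assms(1,2)] assms(3) by (simp add: gvalued_def)

lemma multilin_der:
  assumes F: "multilin k F" and \<phi>: "lin \<phi>"
  shows "multilin k (der F \<phi>)"
  unfolding multilin_def
proof (intro allI impI conjI ballI)
  fix ws assume "length ws = k \<and> set ws \<subseteq> V"
  then have ws: "length ws = k" "set ws \<subseteq> V" by auto
  then show "der F \<phi> ws \<in> \<gg>"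
    using gvalued_der[OF multilin_gvalued[OF F] \<phi>] by (simp add: gvalued_def)
  fix i v w and c d :: real assume i: "i < k" "v \<in> V" "w \<in> V"
  have V: "ws ! j \<in> V" "\<phi> (ws ! j) \<in> V" if "j < k" for j
    using ws that \<phi> by (auto simp: lin_def subset_iff)
  have "F (ws[i := c *\<^sub>R v + d *\<^sub>R w, j := \<phi> (ws[i := c *\<^sub>R v + d *\<^sub>R w] ! j)]) =
      c *\<^sub>R F (ws[i := v, j := \<phi> (ws[i := v] ! j)]) + d *\<^sub>R F (ws[i := w, j := \<phi> (ws[i := w] ! j)])"
    if j: "j < k" for j
  proof (cases "j = i")
    case True
    have "\<phi> (c *\<^sub>R v + d *\<^sub>R w) = c *\<^sub>R \<phi> v + d *\<^sub>R \<phi> w" "\<phi> v \<in> V" "\<phi> w \<in> V"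
      using \<phi> i by (auto simp: lin_def)
    then show ?thesis
      using True ws i multilinD[OF F ws] by simp
  next
    case False
    then have sw: "ws[i := x, j := y] = ws[j := y, i := x]" for x y
      by (metis list_update_swap)
    show ?thesis
      using False ws i j multilinD[OF F _ set_update_V[OF ws(2) V(2)[OF j]] i] by (simp add: sw)
  qed
  then show "der F \<phi> (ws[i := c *\<^sub>R v + d *\<^sub>R w]) = c *\<^sub>R der F \<phi> (ws[i := v]) + d *\<^sub>R der F \<phi> (ws[i := w])"
    unfolding der_def by (simp add: ws sum.distrib scaleR_sum_right)
qed

lemma nth_V: "set ws \<subseteq> V \<Longrightarrow> j < length ws \<Longrightarrow> ws ! j \<in> V"
  by (auto simp: subset_iff)

lemma der_r_linear:
  assumes "multilin (length a) P" "set a \<subseteq> V" "x \<in> \<gg>" "y \<in> \<gg>"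
  shows "der P (r (c *\<^sub>R x + d *\<^sub>R y)) a = c *\<^sub>R der P (r x) a + d *\<^sub>R der P (r y) a"
proof -
  have "P (a[j := r (c *\<^sub>R x + d *\<^sub>R y) (a ! j)]) = c *\<^sub>R P (a[j := r x (a ! j)]) + d *\<^sub>R P (a[j := r y (a ! j)])"
    if "j < length a" for j
    using that assms nth_V[OF assms(2)]
    by (simp add: r_linear_left r_closed multilinD[OF assms(1) refl assms(2)])
  then show ?thesis
    by (simp add: der_def sum.distrib scaleR_sum_right)
qed

lemma der_r_simps:
  assumes "multilin (length a) P" "set a \<subseteq> V" "x \<in> \<gg>" "y \<in> \<gg>"
  shows "der P (r (x + y)) a = der P (r x) a + der P (r y) a"
    "der P (r (x - y)) a = der P (r x) a - der P (r y) a"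
  using der_r_linear[OF assms, of 1 1] der_r_linear[OF assms, of 1 "-1"] by simp_all

lemma der_r_scaleR:
  assumes "multilin (length a) P" "set a \<subseteq> V" "x \<in> \<gg>"
  shows "der P (r (c *\<^sub>R x)) a = c *\<^sub>R der P (r x) a"
  using der_r_linear[OF assms assms(3), of c 0] by simp

lemma der_r_zero:
  assumes "multilin (length a) P" "set a \<subseteq> V"
  shows "der P (r 0) a = 0"
  using der_r_scaleR[OF assms g_closed(4), of 0] by simp

lemma der_r_sum:
  assumes "multilin (length a) P" "set a \<subseteq> V" "\<And>i. i \<in> I \<Longrightarrow> x i \<in> \<gg>"
  shows "der P (r (\<Sum>i\<in>I. x i)) a = (\<Sum>i\<in>I. der P (r (x i)) a)"
  using assms(3)
  by (induction I rule: infinite_finite_induct)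
    (simp_all add: der_r_simps[OF assms(1,2)] der_r_zero[OF assms(1,2)] g_sum)

text \<open>Derivations acting on two different slots commute, so these terms cancel in the
  difference; where both act on the same slot, \<open>r_bracket\<close> applies.\<close>

lemma der_commutator:
  assumes P: "multilin (length a) P" and a: "set a \<subseteq> V" and x: "x \<in> \<gg>" and y: "y \<in> \<gg>"
  shows "der P (r (br x y)) a = der (der P (r x)) (r y) a - der (der P (r y)) (r x) a"
proof -
  let ?n = "length a"
  let ?T = "\<lambda>x y i j. P (a[i := r y (a ! i), j := r x (a[i := r y (a ! i)] ! j)])"
  have D: "der (der P (r x)) (r y) a = (\<Sum>i<?n. \<Sum>j<?n. ?T x y i j)" for x y
    by (simp add: der_def)
  have off: "?T y x j i = ?T x y i j" if "i < ?n" "j < ?n" "i \<noteq> j" for i j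
    using that by (simp add: list_update_swap[of i j])
  have diag: "?T x y i i - ?T y x i i = P (a[i := r (br x y) (a ! i)])" if "i < ?n" for i
    using that x y nth_V[OF a that]
    by (simp add: r_bracket r_closed multilin_diff[OF P refl a])
  have inner: "(\<Sum>j<?n. ?T x y i j) - (\<Sum>j<?n. ?T y x j i) = P (a[i := r (br x y) (a ! i)])" if i: "i < ?n" for i
  proof -
    have "(\<Sum>j<?n. ?T x y i j) - (\<Sum>j<?n. ?T y x j i) = (\<Sum>j<?n. ?T x y i j - ?T y x j i)"
      by (rule sum_subtractf[symmetric])
    also have "\<dots> = (\<Sum>j<?n. if j = i then ?T x y i i - ?T y x i i else 0)"
      by (rule sum.cong) (use off[OF i] in auto)
    also have "\<dots> = P (a[i := r (br x y) (a ! i)])"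
      using i diag[OF i] by (subst sum.delta) simp_all
    finally show ?thesis .
  qed
  have "der (der P (r x)) (r y) a - der (der P (r y)) (r x) a =
      (\<Sum>i<?n. \<Sum>j<?n. ?T x y i j) - (\<Sum>i<?n. \<Sum>j<?n. ?T y x j i)"
    unfolding D by (subst (2) sum.swap) (rule refl)
  also have "\<dots> = (\<Sum>i<?n. (\<Sum>j<?n. ?T x y i j) - (\<Sum>j<?n. ?T y x j i))"
    by (rule sum_subtractf[symmetric])
  also have "\<dots> = (\<Sum>i<?n. P (a[i := r (br x y) (a ! i)]))"
    by (rule sum.cong) (simp_all add: inner)
  finally show ?thesis by (simp add: der_def)
qed

lemma pb_append: "length b = m \<Longrightarrow>
  pb m P Q (b @ a) = der P (r (Q b)) a - der Q (r (P a)) b + br (P a) (Q b)"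
  by (simp add: pb_def)

lemma pb_in:
  assumes "gvalued (length a) P" "gvalued m Q" "length b = m" "set a \<subseteq> V" "set b \<subseteq> V"
  shows "pb m P Q (b @ a) \<in> \<gg>"
  using assms by (simp add: pb_append g_closed der_in lin_r gvaluedD)

lemma gvalued_pb:
  assumes "gvalued n P" "gvalued m Q"
  shows "gvalued (m + n) (pb m P Q)"
  unfolding gvalued_def
proof (intro allI impI, elim conjE)
  fix w assume w: "length w = m + n" "set w \<subseteq> V"
  have "pb m P Q (take m w @ drop m w) \<in> \<gg>"
    by (rule pb_in) (use assms w in \<open>auto dest: in_set_takeD in_set_dropD\<close>)
  then show "pb m P Q w \<in> \<gg>" by simp
qed

text \<open>The product rule for a fixed x: the derivation falls on the block of \<open>R\<close> or
  on that of \<open>Q\<close>, and linearity of \<open>r\<close> and \<open>br\<close> draws the sum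
  over the slots of a block into the inner map. The terms with two successive derivatives are the
  ones that \<open>der_commutator\<close> produces on the other side of the Jacobi identity.\<close>

lemma der_pb:
  assumes Q: "multilin (length b) Q" and R: "multilin (length c) R" and x: "x \<in> \<gg>"
    and V: "set b \<subseteq> V" "set c \<subseteq> V"
  shows "der (pb (length c) Q R) (r x) (c @ b) =
    der Q (r (der R (r x) c)) b - der (der R (r (Q b))) (r x) c + br (Q b) (der R (r x) c)
    + (der (der Q (r (R c))) (r x) b - der R (r (der Q (r x) b)) c + br (der Q (r x) b) (R c))"
proof -
  have gQ: "gvalued (length b) Q" and gR: "gvalued (length c) R"
    using Q R multilin_gvalued by auto
  have inR: "R (c[j := r x (c ! j)]) \<in> \<gg>" if "j < length c" for j
    using gvaluedD[OF gR] set_update_lin[OF lin_r[OF x] V(2) that] by simp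
  have inQ: "Q (b[j := r x (b ! j)]) \<in> \<gg>" if "j < length b" for j
    using gvaluedD[OF gQ] set_update_lin[OF lin_r[OF x] V(1) that] by simp
  have Qb: "Q b \<in> \<gg>" and Rc: "R c \<in> \<gg>"
    using gvaluedD[OF gQ refl V(1)] gvaluedD[OF gR refl V(2)] by auto
  have "der (\<lambda>v. pb (length c) Q R (v @ b)) (r x) c =
      (\<Sum>j<length c. der Q (r (R (c[j := r x (c ! j)]))) b - der R (r (Q b)) (c[j := r x (c ! j)])
        + br (Q b) (R (c[j := r x (c ! j)])))"
    by (simp add: der_def[of "\<lambda>v. pb (length c) Q R (v @ b)"] pb_append)
  also have "\<dots> = der Q (r (der R (r x) c)) b - der (der R (r (Q b))) (r x) c + br (Q b) (der R (r x) c)"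
    unfolding der_def[of R "r x"] der_def[of "der R (r (Q b))"]
    by (subst der_r_sum[OF Q V(1)], use inR in simp, subst br_sum(2), use inR Qb in simp_all,
      simp add: sum.distrib sum_subtractf)
  finally have 1: "der (\<lambda>v. pb (length c) Q R (v @ b)) (r x) c = \<dots>" .
  have "der (\<lambda>v. pb (length c) Q R (c @ v)) (r x) b =
      (\<Sum>j<length b. der Q (r (R c)) (b[j := r x (b ! j)]) - der R (r (Q (b[j := r x (b ! j)]))) c
        + br (Q (b[j := r x (b ! j)])) (R c))"
    unfolding pb_append[OF refl] by (simp only: der_def[of "\<lambda>v. _ v - _ v + _ v"])
  also have "\<dots> = der (der Q (r (R c))) (r x) b - der R (r (der Q (r x) b)) c + br (der Q (r x) b) (R c)"
    unfolding der_def[of Q "r x"] der_def[of "der Q (r (R c))"]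
    by (subst der_r_sum[OF R V(2)], use inQ in simp, subst br_sum(1), use inQ Rc in simp_all,
      simp add: sum.distrib sum_subtractf)
  finally show ?thesis
    using 1 by (simp add: der_append)
qed

text \<open>Up to the order of the arguments, \<^term>\<open>pb\<close> is the bracket of the action Lie algebra of
  \<open>\<gg>\<close>-valued polynomial functions on \<open>V\<close>, which satisfies the Jacobi identity before
  antisymmetrisation.\<close>

lemma pb_jacobi:
  assumes P: "multilin (length a) P" and Q: "multilin (length b) Q" and R: "multilin (length c) R"
    and V: "set a \<subseteq> V" "set b \<subseteq> V" "set c \<subseteq> V"
  shows "pb (length c + length b) P (pb (length c) Q R) (c @ b @ a) =
    pb (length c) (pb (length b) P Q) R (c @ b @ a) + pb (length c + length a) Q (pb (length c) P R) (c @ a @ b)"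
proof -
  note g = multilin_gvalued[OF P] multilin_gvalued[OF Q] multilin_gvalued[OF R]
  have x: "P a \<in> \<gg>" "Q b \<in> \<gg>" "R c \<in> \<gg>"
    using g V by (auto intro: gvaluedD)
  note in1 = der_in[OF g(1) lin_r V(1)] der_in[OF g(2) lin_r V(2)] der_in[OF g(3) lin_r V(3)]
  have e1: "pb (length c + length b) P (pb (length c) Q R) (c @ b @ a) =
     der P (r (pb (length c) Q R (c @ b))) a - der (pb (length c) Q R) (r (P a)) (c @ b)
     + br (P a) (pb (length c) Q R (c @ b))"
    using pb_append[of "c @ b" "length c + length b"] by simp
  have e2: "pb (length c + length a) Q (pb (length c) P R) (c @ a @ b) =
     der Q (r (pb (length c) P R (c @ a))) b - der (pb (length c) P R) (r (Q b)) (c @ a)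
     + br (Q b) (pb (length c) P R (c @ a))"
    using pb_append[of "c @ a" "length c + length a"] by simp
  have e3: "pb (length c) (pb (length b) P Q) R (c @ b @ a) =
     der (pb (length b) P Q) (r (R c)) (b @ a) - der R (r (pb (length b) P Q (b @ a))) c
     + br (pb (length b) P Q (b @ a)) (R c)"
    by (simp add: pb_append)
  \<comment> \<open>The bracket part of the operator is replaced by a commutator of second
    derivatives, so that both sides end in the same kinds of terms.\<close>
  have expand: "der F (r (x - y + br z w)) d = der F (r x) d - der F (r y) d
      + (der (der F (r z)) (r w) d - der (der F (r w)) (r z) d)"
    if "multilin (length d) F" "set d \<subseteq> V" "x \<in> \<gg>" "y \<in> \<gg>" "z \<in> \<gg>" "w \<in> \<gg>" for F d x y z w
    using that by (simp add: der_r_simps g_closed der_commutator)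
  have bexpand: "br w (x - y + z) = br w x - br w y + br w z" "br (x - y + z) w = br x w - br y w + br z w"
    if "x \<in> \<gg>" "y \<in> \<gg>" "z \<in> \<gg>" "w \<in> \<gg>" for x y z w
    using that by (simp_all add: br_simps g_closed)
  have d: "der P (r (Q b)) a \<in> \<gg>" "der P (r (R c)) a \<in> \<gg>" "der Q (r (P a)) b \<in> \<gg>" "der Q (r (R c)) b \<in> \<gg>"
    "der R (r (P a)) c \<in> \<gg>" "der R (r (Q b)) c \<in> \<gg>"
    using in1 x by auto
  note b = g_closed(6)[OF x(1,2)] g_closed(6)[OF x(1,3)] g_closed(6)[OF x(2,3)]
  \<comment> \<open>Second derivatives match on both sides, and double brackets do by
    \<open>br_jacobi\<close>. On the right \<open>Q b\<close> meets \<open>der P (r (R c)) a\<close>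
    in both orders, and \<open>br_skew\<close> cancels this pair.\<close>
  show ?thesis
    unfolding e1 e2 e3 der_pb[OF Q R x(1) V(2,3)] der_pb[OF P R x(2) V(1,3)] der_pb[OF P Q x(3) V(1,2)]
      pb_append[OF refl] expand[OF P V(1) d(4,6) x(2,3)] expand[OF Q V(2) d(2,5) x(1,3)]
      expand[OF R V(3) d(1,3) x(1,2)] bexpand(1)[OF d(4,6) b(3) x(1)] bexpand(1)[OF d(2,5) b(2) x(2)]
      bexpand(2)[OF d(1,3) b(1) x(3)] br_jacobi[OF x] br_skew[OF x(2) d(2)]
    by simp
qed

end

section \<open>Antisymmetrised brackets\<close>

lemma permute_list_append:
  assumes "\<sigma> permutes {..<length b}"
  shows "permute_list \<sigma> (b @ a) = permute_list \<sigma> b @ a"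
proof (rule nth_equalityI)
  fix i assume "i < length (permute_list \<sigma> (b @ a))"
  then have i: "i < length b + length a" by simp
  have \<sigma>: "\<sigma> permutes {..<length (b @ a)}"
    using assms by (rule permutes_subset) simp
  show "permute_list \<sigma> (b @ a) ! i = (permute_list \<sigma> b @ a) ! i"
  proof (cases "i < length b")
    case True
    then have "\<sigma> i < length b"
      using permutes_in_image[OF assms] by simp
    then show ?thesis
      using True i by (simp add: permute_list_nth[OF \<sigma>] permute_list_nth[OF assms] nth_append)
  next
    case False
    then have "\<sigma> i = i"
      using permutes_not_in[OF assms] by simp
    then show ?thesis
      using False i by (simp add: permute_list_nth[OF \<sigma>] nth_append)
  qed
qed simp

text \<open>Entry \<open>i\<close> of \<open>w\<close> stands at position
  \<open>inv \<sigma> i\<close> after permuting. In this form a property of \<open>F\<close> in each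
  slot, such as linearity, passes to \<open>alt F\<close>.\<close>

lemma alt_update:
  assumes "i < length w"
  shows "alt F (w[i := x]) =
    (\<Sum>\<sigma> | \<sigma> permutes {..<length w}. of_int (sign \<sigma>) *\<^sub>R F ((permute_list \<sigma> w)[inv \<sigma> i := x]))"
  unfolding alt_def
proof (rule sum.cong, simp, goal_cases)
  case (1 \<sigma>)
  then have \<sigma>: "\<sigma> permutes {..<length w}" by simp
  have "inv \<sigma> i < length w" "\<sigma> (inv \<sigma> i) = i"
    using permutes_in_image[OF permutes_inv[OF \<sigma>], of i] assms permutes_inverses(1)[OF \<sigma>] by auto
  then show ?case
    using permute_list_update[OF \<sigma>, of "inv \<sigma> i" x] by simp
qed

lemma inv_permutes_less: "\<sigma> permutes {..<k::nat} \<Longrightarrow> i < k \<Longrightarrow> inv \<sigma> i < k"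
  using permutes_in_image[OF permutes_inv, of \<sigma> "{..<k}" i] by simp

lemma unshuffles_2:
  "unshuffles [n, m] = {\<sigma>. \<sigma> permutes {..<n + m} \<and> strict_mono_on {..<n} \<sigma> \<and> strict_mono_on {n..<n + m} \<sigma>}"
  by (auto simp: unshuffles_def All_less_Suc numeral_2_eq_2 atLeast0LessThan less_Suc_eq)

text \<open>On the one-point middle block monotonicity is automatic. For \<open>n = 0\<close> the
  difference \<open>n - 1\<close> would be truncated to 0 and the block lengths would add up to
  \<open>m + 1\<close> instead of \<open>m\<close>.\<close>

lemma unshuffles_3:
  "n \<noteq> 0 \<Longrightarrow> unshuffles [m, 1, n - 1] =
    {\<sigma>. \<sigma> permutes {..<m + n} \<and> strict_mono_on {..<m} \<sigma> \<and> strict_mono_on {Suc m..<m + n} \<sigma>}"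
  by (auto simp: unshuffles_def All_less_Suc numeral_3_eq_3 atLeast0LessThan less_Suc_eq)
    (auto simp: strict_mono_on_def)

context lie_representation
begin

definition asym :: "nat \<Rightarrow> ('v list \<Rightarrow> 'g) \<Rightarrow> bool" where
  "asym k F \<longleftrightarrow> (\<forall>ws i j. length ws = k \<and> set ws \<subseteq> V \<and> i < k \<and> j < k \<and> i \<noteq> j \<and> ws ! i = ws ! j \<longrightarrow> F ws = 0)"

text \<open>Polarisation: \<open>F\<close> vanishes with the sum of the two entries in both places,
  and so do the two diagonal terms of the four in its expansion.\<close>

lemma asym_swap:
  assumes F: "multilin k F" "asym k F" and ws: "length ws = k" "set ws \<subseteq> V" and ij: "i < k" "j < k" "i \<noteq> j"
  shows "F (ws[i := ws ! j, j := ws ! i]) = - F ws"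
proof -
  let ?v = "ws ! i" and ?w = "ws ! j"
  have V: "?v \<in> V" "?w \<in> V" "?v + ?w \<in> V"
    using ws ij subspaceV by (auto simp: subset_iff intro!: subspace_add)
  have add: "F (us[l := x + y]) = F (us[l := x]) + F (us[l := y])"
    if "length us = k" "set us \<subseteq> V" "l < k" "x \<in> V" "y \<in> V" for us l x y
    using multilinD[OF F(1) that, of 1 1] by simp
  have z: "F (ws[i := x, j := x]) = 0" if "x \<in> V" for x
    using F(2) ws ij that set_update_V unfolding asym_def by (smt (verit) length_list_update nth_list_update)
  have e: "F (ws[i := ?v + ?w, j := x]) = F (ws[j := x, i := ?v]) + F (ws[j := x, i := ?w])" if "x \<in> V" for x
    unfolding list_update_swap[OF ij(3), of ws "?v + ?w" x]
    using ws ij V that by (intro add set_update_V) auto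
  have "0 = F (ws[i := ?v + ?w, j := ?v + ?w])"
    using z V by simp
  also have "\<dots> = F (ws[i := ?v + ?w, j := ?v]) + F (ws[i := ?v + ?w, j := ?w])"
    using ws ij V by (intro add set_update_V) auto
  finally have "0 = F (ws[j := ?v, i := ?v]) + F (ws[j := ?v, i := ?w]) + (F (ws[j := ?w, i := ?v]) + F (ws[j := ?w, i := ?w]))"
    using e V by simp
  moreover have "F (ws[j := ?v, i := ?v]) = 0" "F (ws[j := ?w, i := ?w]) = 0"
    unfolding list_update_swap[OF ij(3), symmetric] using z V by blast+
  moreover have "ws[j := ?w, i := ?v] = ws" by simp
  ultimately show ?thesis
    using list_update_swap[OF ij(3), of ws ?w ?v] by (simp add: eq_neg_iff_add_eq_0)
qed

lemma gvalued_alt: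
  assumes "gvalued k F"
  shows "gvalued k (alt F)"
  unfolding gvalued_def alt_def
  using assms by (intro allI impI g_sum g_closed(3) gvaluedD[OF assms]) auto

lemma multilin_alt:
  assumes F: "multilin k F"
  shows "multilin k (alt F)"
  unfolding multilin_def
proof (intro allI impI conjI ballI)
  fix ws assume "length ws = k \<and> set ws \<subseteq> V"
  then have ws: "length ws = k" "set ws \<subseteq> V" by auto
  then show "alt F ws \<in> \<gg>"
    using gvalued_alt[OF multilin_gvalued[OF F]] by (simp add: gvalued_def)
  fix i v w and c d :: real assume i: "i < k" "v \<in> V" "w \<in> V"
  have "F ((permute_list \<sigma> ws)[inv \<sigma> i := c *\<^sub>R v + d *\<^sub>R w]) =
      c *\<^sub>R F ((permute_list \<sigma> ws)[inv \<sigma> i := v]) + d *\<^sub>R F ((permute_list \<sigma> ws)[inv \<sigma> i := w])"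
    if "\<sigma> permutes {..<k}" for \<sigma>
    by (rule multilinD[OF F]) (use that ws i inv_permutes_less in auto)
  then show "alt F (ws[i := c *\<^sub>R v + d *\<^sub>R w]) = c *\<^sub>R alt F (ws[i := v]) + d *\<^sub>R alt F (ws[i := w])"
    using ws i by (simp add: alt_update scaleR_sum_right sum.distrib[symmetric])
      (rule sum.cong, simp_all add: algebra_simps)
qed

lemma multilin_scaleR:
  assumes "multilin k F"
  shows "multilin k (\<lambda>w. c *\<^sub>R F w)"
  using assms by (auto simp: multilin_def g_closed scaleR_add_right mult.commute)

lemma multilin_pb:
  assumes P: "multilin n P" and Q: "multilin m Q"
  shows "multilin (m + n) (pb m P Q)"
  unfolding multilin_def
proof (intro allI impI conjI ballI)
  fix ws assume "length ws = m + n \<and> set ws \<subseteq> V"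
  moreover define b a where "b = take m ws" and "a = drop m ws"
  ultimately have ws: "ws = b @ a" "length b = m" "length a = n" "set b \<subseteq> V" "set a \<subseteq> V"
    by (auto dest: in_set_takeD in_set_dropD)
  have g: "P a \<in> \<gg>" "Q b \<in> \<gg>"
    using P Q ws by (auto intro: gvaluedD multilin_gvalued)
  show "pb m P Q ws \<in> \<gg>"
    unfolding ws(1) using ws P Q by (intro pb_in) (auto intro: multilin_gvalued)
  fix i v w and c d :: real assume i: "i < m + n" "v \<in> V" "w \<in> V"
  show "pb m P Q (ws[i := c *\<^sub>R v + d *\<^sub>R w]) = c *\<^sub>R pb m P Q (ws[i := v]) + d *\<^sub>R pb m P Q (ws[i := w])"
  proof (cases "i < m")
    case True
    have in_g: "Q (b[i := x]) \<in> \<gg>" if "x \<in> V" for x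
      using Q ws that by (intro gvaluedD[OF multilin_gvalued[OF Q]] set_update_V) auto
    have "Q (b[i := c *\<^sub>R v + d *\<^sub>R w]) = c *\<^sub>R Q (b[i := v]) + d *\<^sub>R Q (b[i := w])"
      using multilinD[OF Q] True ws i by simp
    moreover have "der Q (r (P a)) (b[i := c *\<^sub>R v + d *\<^sub>R w]) =
        c *\<^sub>R der Q (r (P a)) (b[i := v]) + d *\<^sub>R der Q (r (P a)) (b[i := w])"
      using multilinD[OF multilin_der[OF Q lin_r[OF g(1)]]] True ws i by simp
    ultimately show ?thesis
      using True ws i P g in_g
      by (simp add: list_update_append pb_append der_r_linear br_linear algebra_simps)
  next
    case False
    let ?i = "i - m"
    have in_g: "P (a[?i := x]) \<in> \<gg>" if "x \<in> V" for x
      using P ws that by (intro gvaluedD[OF multilin_gvalued[OF P]] set_update_V) auto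
    have "P (a[?i := c *\<^sub>R v + d *\<^sub>R w]) = c *\<^sub>R P (a[?i := v]) + d *\<^sub>R P (a[?i := w])"
      using multilinD[OF P] False ws i by simp
    moreover have "der P (r (Q b)) (a[?i := c *\<^sub>R v + d *\<^sub>R w]) =
        c *\<^sub>R der P (r (Q b)) (a[?i := v]) + d *\<^sub>R der P (r (Q b)) (a[?i := w])"
      using multilinD[OF multilin_der[OF P lin_r[OF g(2)]]] False ws i by simp
    ultimately show ?thesis
      using False ws i Q g in_g
      by (simp add: list_update_append pb_append der_r_linear br_linear algebra_simps)
  qed
qed

lemma alt_cong_V:
  assumes "set w \<subseteq> V" "\<And>v. length v = length w \<Longrightarrow> set v \<subseteq> V \<Longrightarrow> F v = G v"
  shows "alt F w = alt G w"
  using assms by (intro alt_cong) auto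

lemma pb_split:
  assumes "length w = m + n" "set w \<subseteq> V"
  obtains b a where "w = b @ a" "length b = m" "length a = n" "set b \<subseteq> V" "set a \<subseteq> V"
proof
  show "w = take m w @ drop m w" "length (take m w) = m" "length (drop m w) = n"
    "set (take m w) \<subseteq> V" "set (drop m w) \<subseteq> V"
    using assms by (auto dest: in_set_takeD in_set_dropD)
qed

text \<open>Already before antisymmetrising, exchanging \<open>P\<close> with \<open>Q\<close>
  together with their blocks of arguments changes only the sign: the derivative terms trade places
  and \<open>br\<close> is skew. The Koszul sign is that of the block exchange.\<close>

lemma alt_pb_swap:
  assumes P: "gvalued n P" and Q: "gvalued m Q" and w: "length w = m + n" "set w \<subseteq> V"
  shows "alt (pb m P Q) w = - ((-1) ^ (m * n) *\<^sub>R alt (pb n Q P) w)"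
proof -
  have "alt (pb m P Q) w = alt (\<lambda>v. - pb n Q P (bswap 0 m v)) w"
  proof (rule alt_cong_V[OF w(2)])
    fix v assume "length v = length w" "set v \<subseteq> V"
    then obtain b a where v: "v = b @ a" "length b = m" "length a = n" "set b \<subseteq> V" "set a \<subseteq> V"
      using pb_split w(1) by metis
    then have "br (P a) (Q b) = - br (Q b) (P a)"
      by (intro br_skew gvaluedD[OF P] gvaluedD[OF Q])
    then show "pb m P Q v = - pb n Q P (bswap 0 m v)"
      using v by (simp add: pb_append)
  qed
  then show ?thesis
    using alt_comp_bswap[of 0 m w "pb n Q P"] w by (simp add: alt_minus)
qed

text \<open>All three terms of \<open>pb\<close> are linear in \<open>F\<close>, so an
  antisymmetrised \<open>F\<close> becomes an antisymmetrisation over the leading block, which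
  \<open>alt_absorb\<close> removes. The constant \<open>c\<close> carries the normalisation of the
  inner bracket.\<close>

lemma alt_pb_right:
  assumes P: "multilin p P" and F: "gvalued k F" and w: "length w = k + p" "set w \<subseteq> V"
  shows "alt (pb k P (\<lambda>v. c *\<^sub>R alt F v)) w = (c * fact k) *\<^sub>R alt (pb k P F) w"
proof -
  have "alt (pb k P (\<lambda>v. c *\<^sub>R alt F v)) w =
      alt (\<lambda>v. c *\<^sub>R (\<Sum>\<sigma> | \<sigma> permutes {..<k}. of_int (sign \<sigma>) *\<^sub>R pb k P F (permute_list \<sigma> v))) w"
  proof (rule alt_cong_V[OF w(2)])
    fix v assume "length v = length w" "set v \<subseteq> V"
    then obtain b a where v: "v = b @ a" "length b = k" "length a = p" "set b \<subseteq> V" "set a \<subseteq> V"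
      using pb_split w(1) by metis
    have Pa: "P a \<in> \<gg>"
      using v by (intro gvaluedD[OF multilin_gvalued[OF P]])
    have Fb: "F (permute_list \<sigma> b) \<in> \<gg>" if "\<sigma> permutes {..<k}" for \<sigma>
      using v that by (intro gvaluedD[OF F]) auto
    have altF: "alt F b \<in> \<gg>"
      using gvaluedD[OF gvalued_alt[OF F]] v by simp
    note P' = P[folded v(3)]
    have 1: "der P (r (alt F b)) a =
        (\<Sum>\<sigma> | \<sigma> permutes {..<k}. of_int (sign \<sigma>) *\<^sub>R der P (r (F (permute_list \<sigma> b))) a)"
      unfolding alt_def v(2)
      by (subst der_r_sum[OF P' v(5)]) (use Fb in \<open>auto simp: g_closed der_r_scaleR[OF P' v(5)]\<close>)
    have 2: "br (P a) (alt F b) = (\<Sum>\<sigma> | \<sigma> permutes {..<k}. of_int (sign \<sigma>) *\<^sub>R br (P a) (F (permute_list \<sigma> b)))"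
      unfolding alt_def v(2)
      by (subst br_sum(2)) (use Fb Pa in \<open>auto simp: g_closed br_scaleR\<close>)
    have 3: "der (alt F) (r (P a)) b =
        (\<Sum>\<sigma> | \<sigma> permutes {..<k}. of_int (sign \<sigma>) *\<^sub>R der F (r (P a)) (permute_list \<sigma> b))"
      unfolding der_alt by (simp add: alt_def v)
    have 4: "der (\<lambda>v. c *\<^sub>R alt F v) (r (P a)) b = c *\<^sub>R der (alt F) (r (P a)) b"
      by (simp add: der_def scaleR_sum_right)
    have "pb k P (\<lambda>v. c *\<^sub>R alt F v) v =
        c *\<^sub>R (der P (r (alt F b)) a - der (alt F) (r (P a)) b + br (P a) (alt F b))"
      using v altF Pa by (simp add: pb_append 4 der_r_scaleR[OF P' v(5)] br_scaleR algebra_simps)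
    also have "\<dots> = c *\<^sub>R (\<Sum>\<sigma> | \<sigma> permutes {..<k}. of_int (sign \<sigma>) *\<^sub>R pb k P F (permute_list \<sigma> v))"
      unfolding 1 2 3 using v
      by (simp add: permute_list_append pb_append algebra_simps sum.distrib sum_subtractf)
    finally show "pb k P (\<lambda>v. c *\<^sub>R alt F v) v = \<dots>" .
  qed
  then show ?thesis
    using alt_absorb[of k w "pb k P F"] w by (simp add: alt_scaleR)
qed

lemma gvalued_scaleR: "gvalued k F \<Longrightarrow> gvalued k (\<lambda>v. c *\<^sub>R F v)"
  by (simp add: gvalued_def g_closed)

text \<open>Here the arguments of \<open>F\<close> form the trailing block, whereas
  \<open>alt_absorb\<close> treats the leading one; skew symmetry brings them to the front and back
  again.\<close>

lemma alt_pb_left: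
  assumes R: "multilin p R" and F: "gvalued k F" and w: "length w = p + k" "set w \<subseteq> V"
  shows "alt (pb p (\<lambda>v. c *\<^sub>R alt F v) R) w = (c * fact k) *\<^sub>R alt (pb p F R) w"
proof -
  have w': "length w = k + p" using w by simp
  have "alt (pb p (\<lambda>v. c *\<^sub>R alt F v) R) w = - ((-1) ^ (p * k) *\<^sub>R alt (pb k R (\<lambda>v. c *\<^sub>R alt F v)) w)"
    by (rule alt_pb_swap[OF gvalued_scaleR[OF gvalued_alt[OF F]] multilin_gvalued[OF R] w])
  also have "\<dots> = (c * fact k) *\<^sub>R - ((-1) ^ (p * k) *\<^sub>R alt (pb k R F) w)"
    by (simp add: alt_pb_right[OF R F w' w(2)] mult.commute mult.left_commute)
  also have "\<dots> = (c * fact k) *\<^sub>R alt (pb p F R) w"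
    by (subst alt_pb_swap[OF F multilin_gvalued[OF R] w]) simp
  finally show ?thesis .
qed

text \<open>Over each unshuffle of type (n, m) lie n! m! permutations. In an insertion sum only m!
  (n - 1)! lie over an unshuffle, and the remaining factor n comes from the slots of
  \<open>P\<close> summed in \<open>der\<close>.\<close>

definition bf :: "nat \<Rightarrow> nat \<Rightarrow> ('v list \<Rightarrow> 'g) \<Rightarrow> ('v list \<Rightarrow> 'g) \<Rightarrow> 'v list \<Rightarrow> 'g" where
  "bf n m P Q w = (1 / (fact n * fact m)) *\<^sub>R alt (pb m P Q) w"

lemma bf_skew:
  assumes "multilin n P" "multilin m Q" "length w = m + n" "set w \<subseteq> V"
  shows "bf n m P Q w = - ((-1) ^ (n * m) *\<^sub>R bf m n Q P w)"
  using alt_pb_swap[OF multilin_gvalued[OF assms(1)] multilin_gvalued[OF assms(2)] assms(3,4)]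
  by (simp add: bf_def mult.commute)

text \<open>Once the inner antisymmetrisations are absorbed, all three terms have the constant 1 /
  (i! j! k!), and \<open>pb_jacobi\<close> applies under \<open>alt\<close>. Its last term has the
  blocks of lengths j and i in exchanged order, whence the sign.\<close>

lemma bf_jacobi:
  assumes P: "multilin i P" and Q: "multilin j Q" and R: "multilin k R"
    and w: "length w = i + j + k" "set w \<subseteq> V"
  shows "bf i (j + k) P (bf j k Q R) w =
    bf (i + j) k (bf i j P Q) R w + (-1) ^ (i * j) *\<^sub>R bf j (i + k) Q (bf i k P R) w"
proof -
  let ?c = "1 / (fact i * fact j * fact k) :: real"
  have gv: "gvalued (j + k) (pb k Q R)" "gvalued (i + j) (pb j P Q)" "gvalued (i + k) (pb k P R)"
    using gvalued_pb[OF multilin_gvalued[OF Q] multilin_gvalued[OF R]]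
      gvalued_pb[OF multilin_gvalued[OF P] multilin_gvalued[OF Q]]
      gvalued_pb[OF multilin_gvalued[OF P] multilin_gvalued[OF R]] by (simp_all add: add.commute)
  have 1: "bf i (j + k) P (bf j k Q R) w = ?c *\<^sub>R alt (pb (j + k) P (pb k Q R)) w"
    unfolding bf_def by (subst alt_pb_right[OF P gv(1)]) (use w in \<open>auto simp: field_simps\<close>)
  have 2: "bf (i + j) k (bf i j P Q) R w = ?c *\<^sub>R alt (pb k (pb j P Q) R) w"
    unfolding bf_def by (subst alt_pb_left[OF R gv(2)]) (use w in \<open>auto simp: field_simps\<close>)
  have 3: "bf j (i + k) Q (bf i k P R) w = ?c *\<^sub>R alt (pb (i + k) Q (pb k P R)) w"
    unfolding bf_def by (subst alt_pb_right[OF Q gv(3)]) (use w in \<open>auto simp: field_simps\<close>)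
  have "alt (pb (j + k) P (pb k Q R)) w =
      alt (\<lambda>v. pb k (pb j P Q) R v + pb (i + k) Q (pb k P R) (bswap k j v)) w"
  proof (rule alt_cong_V[OF w(2)])
    fix v assume v: "length v = length w" "set v \<subseteq> V"
    obtain c v' where c: "v = c @ v'" "length c = k" "length v' = j + i" "set c \<subseteq> V" "set v' \<subseteq> V"
      using pb_split[of v k "j + i" thesis] v w by simp
    obtain b a where b: "v' = b @ a" "length b = j" "length a = i" "set b \<subseteq> V" "set a \<subseteq> V"
      using pb_split[OF c(3,5)] by metis
    show "pb (j + k) P (pb k Q R) v = pb k (pb j P Q) R v + pb (i + k) Q (pb k P R) (bswap k j v)"
      using pb_jacobi[of a P b Q c R] P Q R b c by (simp add: add.commute[of j k] add.commute[of i k])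
  qed
  also have "\<dots> = alt (pb k (pb j P Q) R) w + (-1) ^ (i * j) *\<^sub>R alt (pb (i + k) Q (pb k P R)) w"
    using alt_comp_bswap[of k j w] w by (simp add: alt_add mult.commute)
  finally show ?thesis
    unfolding 1 2 3 by (simp add: scaleR_add_right mult.commute)
qed

subsection \<open>The bracket formula\<close>

definition ins :: "nat \<Rightarrow> nat \<Rightarrow> ('v list \<Rightarrow> 'g) \<Rightarrow> ('v list \<Rightarrow> 'g) \<Rightarrow> 'v list \<Rightarrow> 'g" where
  "ins n m P Q us = (if n = 0 then 0 else
    (\<Sum>\<sigma>\<in>unshuffles [m, 1, n - 1]. of_int (sign \<sigma>) *\<^sub>R
      P (r (Q (map (\<lambda>i. us ! \<sigma> i) [0..<m])) (us ! \<sigma> m) # map (\<lambda>i. us ! \<sigma> i) [m + 1..<m + n])))"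

lemma permute_list_slices:
  assumes "length us = N"
  shows "m \<le> N \<Longrightarrow> map (\<lambda>i. us ! \<sigma> i) [0..<m] = take m (permute_list \<sigma> us)"
    "map (\<lambda>i. us ! \<sigma> i) [m..<N] = drop m (permute_list \<sigma> us)"
  using assms by (auto simp: permute_list_def take_map drop_map take_upt)

lemma r_minus: "x \<in> \<gg> \<Longrightarrow> v \<in> V \<Longrightarrow> r (- x) v = - r x v"
  using r_linear_left[of x x v "-1" 0] by simp

lemma multilin_minus_Cons:
  assumes "multilin (Suc (length ws)) P" "v \<in> V" "set ws \<subseteq> V"
  shows "P (- v # ws) = - P (v # ws)"
  using multilinD[OF assms(1), of "v # ws" 0 v v "-1" 0] assms by simp

lemma permute_list_comp_transpose:
  assumes "\<sigma> permutes {..<length us}" "a < length us" "b < length us"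
  shows "permute_list (\<sigma> \<circ> Transposition.transpose a b) us =
    (permute_list \<sigma> us)[a := permute_list \<sigma> us ! b, b := permute_list \<sigma> us ! a]"
  using assms
  by (subst permute_list_compose) (simp_all add: permutes_swap_id permute_list_transpose)

text \<open>As \<open>P\<close> alternates, the n terms of \<open>der\<close> agree after
  antisymmetrisation, so the inserted section may be assumed to sit in the first slot. What remains
  is alternating in the m arguments of \<open>Q\<close> and in the last n - 1 of \<open>P\<close>,
  and the sum over permutations collapses to unshuffles.\<close>

lemma ins_alt:
  assumes P: "multilin n P" "asym n P" and Q: "multilin m Q" "asym m Q"
    and us: "length us = m + n" "set us \<subseteq> V"
  shows "(fact n * fact m) *\<^sub>R ins n m P Q us = alt (\<lambda>w. der P (r (Q (take m w))) (drop m w)) us"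
proof (cases "n = 0")
  case True
  \<comment> \<open>For n = 0 \<open>der\<close> runs over an empty list of slots, in accordance
    with the convention for a block of length -1.\<close>
  then show ?thesis using us by (simp add: ins_def alt_def der_def)
next
  case False
  define K where "K j w = P ((drop m w)[j := r (Q (take m w)) (w ! (m + j))])" for j w
  have Qin: "Q (take m w) \<in> \<gg>" if "length w = m + n" "set w \<subseteq> V" for w
    using that by (intro gvaluedD[OF multilin_gvalued[OF Q(1)]]) (auto dest: in_set_takeD)
  have rin: "r (Q (take m w)) (w ! i) \<in> V" if "length w = m + n" "set w \<subseteq> V" "i < m + n" for w i
    using that Qin by (auto intro!: r_closed simp: subset_iff)
  have K0: "K 0 w = P (r (Q (take m w)) (w ! m) # drop (Suc m) w)" if "length w = m + n" for w
    using that False unfolding K_def by (subst Cons_nth_drop_Suc[symmetric]) simp_all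
  have Kj: "alt (K j) us = alt (K 0) us" if j: "j < n" for j
  proof (cases "j = 0")
    case False
    \<comment> \<open>Moving the inserted vector from slot j to slot 0 of \<open>P\<close> gives one
      sign; exchanging the entries m and m + j of \<open>w\<close> under \<open>alt\<close> gives
      the other.\<close>
    have "alt (K j) us = alt (\<lambda>w. - K 0 (w[m := w ! (m + j), m + j := w ! m])) us"
    proof (rule alt_cong_V[OF us(2)])
      fix w assume "length w = length us" "set w \<subseteq> V"
      then have w: "length w = m + n" "set w \<subseteq> V" using us by auto
      define d where "d = (drop m w)[j := r (Q (take m w)) (w ! (m + j))]"
      have d: "length d = n" "set d \<subseteq> V"
        using w j rin[OF w, of "m + j"] unfolding d_def
        by (simp, intro set_update_V) (auto dest: in_set_dropD)
      have "P (d[0 := d ! j, j := d ! 0]) = - P d"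
        using asym_swap[OF P d, of 0 j] j False by simp
      moreover have "d[0 := d ! j, j := d ! 0] =
          (drop m (w[m := w ! (m + j), m + j := w ! m]))[0 := r (Q (take m w)) (w ! (m + j))]"
        using w j False by (intro nth_equalityI) (auto simp: d_def nth_list_update)
      ultimately show "K j w = - K 0 (w[m := w ! (m + j), m + j := w ! m])"
        using w j False by (simp add: K_def d_def nth_list_update)
    qed
    then show ?thesis
      using alt_comp_swap[of m us "m + j" "K 0"] us j False by (simp add: alt_minus)
  qed simp
  have "alt (\<lambda>w. der P (r (Q (take m w))) (drop m w)) us = alt (\<lambda>w. \<Sum>j<n. K j w) us"
    by (rule alt_cong) (use us in \<open>simp add: der_def K_def\<close>)
  also have "\<dots> = real n *\<^sub>R alt (K 0) us"
  proof -
    have "(\<Sum>j<n. alt (K j) us) = (\<Sum>j<n. alt (K 0) us)"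
      by (rule sum.cong[OF refl]) (rule Kj, simp)
    then show ?thesis by (simp add: alt_sum sum_constant_scaleR)
  qed
  also have "alt (K 0) us = (fact m * fact (n - 1)) *\<^sub>R ins n m P Q us"
  proof -
    let ?F = "\<lambda>\<sigma>. K 0 (permute_list \<sigma> us)"
    have perm: "length (permute_list \<sigma> us) = m + n" "set (permute_list \<sigma> us) \<subseteq> V"
      if "\<sigma> permutes {..<m + n}" for \<sigma> using that us by auto
    have "alt (K 0) us = (fact (card {..<m}) * fact (card {Suc m..<m + n})) *\<^sub>R
      (\<Sum>\<sigma> | \<sigma> permutes {..<m + n} \<and> strict_mono_on {..<m} \<sigma> \<and> strict_mono_on {Suc m..<m + n} \<sigma>.
        of_int (sign \<sigma>) *\<^sub>R ?F \<sigma>)"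
      unfolding alt_def us(1)
    proof (rule sum_permutes_strict_mono_on, goal_cases)
      case (4 \<sigma> a b)
      define w where "w = permute_list \<sigma> us"
      have w: "length w = m + n" "set w \<subseteq> V" using perm[OF 4(1)] by (auto simp: w_def)
      have "Q ((take m w)[a := take m w ! b, b := take m w ! a]) = - Q (take m w)"
        using 4 w by (intro asym_swap[OF Q]) (auto dest: in_set_takeD)
      then have "K 0 (w[a := w ! b, b := w ! a]) = - K 0 w"
        using 4 w False Qin[OF w] rin[OF w] P(1) nth_V[OF w(2), of m]
        by (simp add: K0 take_update_swap drop_update_cancel r_minus)
          (subst multilin_minus_Cons, auto dest: in_set_dropD)
      then show ?case
        using 4 us by (simp add: permute_list_comp_transpose w_def)
    next
      case (5 \<sigma> a b)
      define w where "w = permute_list \<sigma> us"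
      have w: "length w = m + n" "set w \<subseteq> V" using perm[OF 5(1)] by (auto simp: w_def)
      \<comment> \<open>Slot 0 of \<open>P\<close> holds the inserted vector, built from entry
        \<open>m\<close>, so entry \<open>a > m\<close> of \<open>w\<close> sits in slot
        \<open>a - m\<close>.\<close>
      define d where "d = r (Q (take m w)) (w ! m) # drop (Suc m) w"
      have d: "length d = n" "set d \<subseteq> V"
        using w False rin[OF w, of m] by (auto simp: d_def dest: in_set_dropD)
      have "P (d[a - m := d ! (b - m), b - m := d ! (a - m)]) = - P d"
        using 5 by (intro asym_swap[OF P d]) auto
      moreover obtain x y where "a = Suc m + x" "b = Suc m + y"
        using 5 by (metis atLeastLessThan_iff le_Suc_ex)
      then have "d[a - m := d ! (b - m), b - m := d ! (a - m)] =
          r (Q (take m w)) (w ! m) # drop (Suc m) (w[a := w ! b, b := w ! a])"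
        using w 5 by (simp add: d_def drop_update_swap Suc_diff_le)
      ultimately have "K 0 (w[a := w ! b, b := w ! a]) = - K 0 w"
        using 5 w by (simp add: K0 d_def)
      then show ?case
        using 5 us by (simp add: permute_list_comp_transpose w_def)
    qed auto
    moreover have "ins n m P Q us = (\<Sum>\<sigma> | \<sigma> permutes {..<m + n} \<and> strict_mono_on {..<m} \<sigma> \<and> strict_mono_on {Suc m..<m + n} \<sigma>.
        of_int (sign \<sigma>) *\<^sub>R ?F \<sigma>)"
      unfolding ins_def unshuffles_3[OF False] if_not_P[OF False]
    proof (rule sum.cong, goal_cases)
      case (2 \<sigma>)
      then have "\<sigma> permutes {..<m + n}" by simp
      then show ?case
        using us False by (simp add: K0 permute_list_slices[OF us(1)] permute_list_nth)
    qed simp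
    ultimately show ?thesis by simp
  qed
  finally show ?thesis
    using False by (simp add: fact_reduce[of n] mult_ac)
qed

lemma unshuffles_bracket_alt:
  assumes P: "multilin n P" "asym n P" and Q: "multilin m Q" "asym m Q"
    and us: "length us = m + n" "set us \<subseteq> V"
  shows "(fact n * fact m) *\<^sub>R (\<Sum>\<sigma>\<in>unshuffles [n, m]. of_int (sign \<sigma>) *\<^sub>R
      br (P (map (\<lambda>i. us ! \<sigma> i) [0..<n])) (Q (map (\<lambda>i. us ! \<sigma> i) [n..<m + n])))
    = alt (\<lambda>w. br (P (take n w)) (Q (drop n w))) us"
proof -
  define K where "K w = br (P (take n w)) (Q (drop n w))" for w
  have us': "length us = n + m" using us by simp
  let ?F = "\<lambda>\<sigma>. K (permute_list \<sigma> us)"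
  have w: "length (permute_list \<sigma> us) = n + m" "set (permute_list \<sigma> us) \<subseteq> V"
    "P (take n (permute_list \<sigma> us)) \<in> \<gg>" "Q (drop n (permute_list \<sigma> us)) \<in> \<gg>"
    if "\<sigma> permutes {..<n + m}" for \<sigma>
    using that us
    by (auto intro!: gvaluedD[OF multilin_gvalued[OF P(1)]] gvaluedD[OF multilin_gvalued[OF Q(1)]]
        dest!: in_set_takeD in_set_dropD simp: add.commute)
  have "alt K us = (fact (card {..<n}) * fact (card {n..<n + m})) *\<^sub>R
      (\<Sum>\<sigma> | \<sigma> permutes {..<n + m} \<and> strict_mono_on {..<n} \<sigma> \<and> strict_mono_on {n..<n + m} \<sigma>.
        of_int (sign \<sigma>) *\<^sub>R ?F \<sigma>)"
    unfolding alt_def us'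
  proof (rule sum_permutes_strict_mono_on, goal_cases)
    case (4 \<sigma> a b)
    define w where "w = permute_list \<sigma> us"
    note w' = w[OF 4(1), folded w_def]
    have "P ((take n w)[a := take n w ! b, b := take n w ! a]) = - P (take n w)"
      using 4 w' by (intro asym_swap[OF P]) (auto dest: in_set_takeD)
    then have "K (w[a := w ! b, b := w ! a]) = - K w"
      using 4 w' by (simp add: K_def take_update_swap drop_update_cancel br_minus)
    then show ?case
      using 4 us' by (simp add: permute_list_comp_transpose w_def)
  next
    case (5 \<sigma> a b)
    define w where "w = permute_list \<sigma> us"
    note w' = w[OF 5(1), folded w_def]
    have "Q ((drop n w)[a - n := drop n w ! (b - n), b - n := drop n w ! (a - n)]) = - Q (drop n w)"
      using 5 w' by (intro asym_swap[OF Q]) (auto dest: in_set_dropD)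
    then have "K (w[a := w ! b, b := w ! a]) = - K w"
      using 5 w' by (simp add: K_def drop_update_swap br_minus)
    then show ?case
      using 5 us' by (simp add: permute_list_comp_transpose w_def)
  qed auto
  moreover have "(\<Sum>\<sigma>\<in>unshuffles [n, m]. of_int (sign \<sigma>) *\<^sub>R
      br (P (map (\<lambda>i. us ! \<sigma> i) [0..<n])) (Q (map (\<lambda>i. us ! \<sigma> i) [n..<m + n]))) =
    (\<Sum>\<sigma> | \<sigma> permutes {..<n + m} \<and> strict_mono_on {..<n} \<sigma> \<and> strict_mono_on {n..<n + m} \<sigma>.
        of_int (sign \<sigma>) *\<^sub>R ?F \<sigma>)"
    unfolding unshuffles_2 K_def
    by (simp add: permute_list_slices[OF us(1)])
  ultimately show ?thesis unfolding K_def by simp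
qed

text \<open>In the second and third sums the arguments of \<open>P\<close> come first. Bringing them
  into the order of \<open>pb\<close> exchanges blocks of lengths n and m, and the resulting sign
  cancels the explicit sign factor of the formula.\<close>

lemma bracket_formula_bf:
  assumes P: "multilin n P" "asym n P" and Q: "multilin m Q" "asym m Q"
    and us: "length us = m + n" "set us \<subseteq> V"
  shows "ins n m P Q us - (-1) ^ (m * n) *\<^sub>R ins m n Q P us + (-1) ^ (m * n) *\<^sub>R
      (\<Sum>\<sigma>\<in>unshuffles [n, m]. of_int (sign \<sigma>) *\<^sub>R
        br (P (map (\<lambda>i. us ! \<sigma> i) [0..<n])) (Q (map (\<lambda>i. us ! \<sigma> i) [n..<m + n])))
    = bf n m P Q us" (is "?X - ?e *\<^sub>R ?Y + ?e *\<^sub>R ?Z = _")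
proof -
  let ?c = "fact n * fact m :: real"
  have us': "length us = n + m" using us by simp
  have swap: "alt (\<lambda>w. G (bswap 0 n w)) us = ?e *\<^sub>R alt G us" for G :: "'v list \<Rightarrow> 'g"
    using alt_comp_bswap[of 0 n us G] us' by (simp add: mult.commute)
  have "?c *\<^sub>R ?Y = alt (\<lambda>w. der Q (r (P (take n w))) (drop n w)) us"
    using ins_alt[OF Q P us' us(2)] by (simp add: mult.commute)
  also have "\<dots> = alt (\<lambda>w. (\<lambda>v. der Q (r (P (drop m v))) (take m v)) (bswap 0 n w)) us"
    by (rule alt_cong) (use us in \<open>simp add: bswap_def\<close>)
  also have "\<dots> = ?e *\<^sub>R alt (\<lambda>v. der Q (r (P (drop m v))) (take m v)) us"
    by (rule swap)
  finally have Y: "?c *\<^sub>R ?Y = \<dots>" .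
  have "?c *\<^sub>R ?Z = alt (\<lambda>w. br (P (take n w)) (Q (drop n w))) us"
    by (rule unshuffles_bracket_alt[OF P Q us])
  also have "\<dots> = alt (\<lambda>w. (\<lambda>v. br (P (drop m v)) (Q (take m v))) (bswap 0 n w)) us"
    by (rule alt_cong) (use us in \<open>simp add: bswap_def\<close>)
  also have "\<dots> = ?e *\<^sub>R alt (\<lambda>v. br (P (drop m v)) (Q (take m v))) us"
    by (rule swap)
  finally have Z: "?c *\<^sub>R ?Z = \<dots>" .
  have ee: "?e * ?e = 1" by (simp flip: power_mult_distrib)
  have "?c *\<^sub>R (?X - ?e *\<^sub>R ?Y + ?e *\<^sub>R ?Z) = ?c *\<^sub>R ?X - ?e *\<^sub>R (?c *\<^sub>R ?Y) + ?e *\<^sub>R (?c *\<^sub>R ?Z)"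
    by (simp only: scaleR_add_right scaleR_diff_right scaleR_scaleR mult.commute)
  also have "\<dots> = alt (pb m P Q) us"
    unfolding Y Z ins_alt[OF P Q us] scaleR_scaleR ee scaleR_one
    by (simp only: alt_diff[symmetric] alt_add[symmetric] pb_def[abs_def])
  finally have "(1 / ?c) *\<^sub>R (?c *\<^sub>R (?X - ?e *\<^sub>R ?Y + ?e *\<^sub>R ?Z)) = bf n m P Q us"
    unfolding bf_def by (rule arg_cong)
  then show ?thesis by simp
qed

end

section \<open>Calculus of \<open>C\<^sup>k\<close> functions\<close>

lemma openin_Euclidean_space_iff:
  "openin (Euclidean_space n) W \<longleftrightarrow> (\<exists>W0. open W0 \<and> W = W0 \<inter> {x. \<forall>i\<ge>n. x i = 0})"
  unfolding Euclidean_space_def openin_subtopology euclidean_product_topology by (auto simp: Int_commute)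

lemma isCont_fun_upd: "isCont (\<lambda>t. x(i := t :: real)) s"
proof -
  have "continuous_on UNIV (\<lambda>t. x(i := t))"
  proof (rule continuous_on_coordinatewise_then_product)
    show "continuous_on UNIV (\<lambda>t. (x(i := t)) j)" for j
      by (cases "j = i") simp_all
  qed
  then show ?thesis
    by (simp add: continuous_on_eq_continuous_at)
qed

text \<open>\<open>W\<close> is open in the model space only, so changing a coordinate
  \<open>i \<ge> n\<close> would leave it. For \<open>i < n\<close> a partial derivative at a point
  of \<open>W\<close> sees the values on \<open>W\<close> alone, which makes the C^k property
  local.\<close>

lemma eventually_fun_upd_mem:
  assumes W: "openin (Euclidean_space n) W" and x: "x \<in> W" and i: "i < n"
  shows "eventually (\<lambda>t. x(i := t) \<in> W) (nhds (x i))"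
proof -
  obtain W0 where W0: "open W0" "W = W0 \<inter> {x. \<forall>i\<ge>n. x i = 0}"
    using W by (auto simp: openin_Euclidean_space_iff)
  have "filterlim (\<lambda>t. x(i := t)) (nhds (x(i := x i))) (nhds (x i))"
    using isCont_fun_upd[where x = x and i = i and s = "x i"] unfolding isCont_def tendsto_at_iff_tendsto_nhds .
  then have "eventually (\<lambda>t. x(i := t) \<in> W0) (nhds (x i))"
    using W0 x by (intro eventually_compose_filterlim[OF eventually_nhds_in_open]) auto
  then show ?thesis
    by (rule eventually_mono) (use W0 x i in auto)
qed

lemma slice_derivative_cong:
  assumes W: "openin (Euclidean_space n) W" "x \<in> W" "i < n" and eq: "\<And>y. y \<in> W \<Longrightarrow> f y = g y"
  shows "((\<lambda>t. f (x(i := t))) has_field_derivative D) (at (x i)) \<longleftrightarrow>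
    ((\<lambda>t. g (x(i := t))) has_field_derivative D) (at (x i))"
  by (rule DERIV_cong_ev) (auto intro: eventually_mono[OF eventually_fun_upd_mem[OF W]] eq)

lemma Ck_on_SucI:
  assumes "continuous_on W f"
    and "\<And>i x. i < n \<Longrightarrow> x \<in> W \<Longrightarrow> ((\<lambda>t. f (x(i := t))) has_field_derivative f' i x) (at (x i))"
    and "\<And>i. i < n \<Longrightarrow> Ck_on n k W (partial_deriv i f)"
  shows "Ck_on n (Suc k) W f"
  using assms by (auto simp: real_differentiable_def)

lemma Ck_on_SucD:
  assumes "Ck_on n (Suc k) W f" "i < n"
  shows "x \<in> W \<Longrightarrow> ((\<lambda>t. f (x(i := t))) has_field_derivative partial_deriv i f x) (at (x i))"
    "Ck_on n k W (partial_deriv i f)"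
  using assms by (auto simp: partial_deriv_def DERIV_deriv_iff_real_differentiable)

lemma Ck_on_continuous: "Ck_on n k W f \<Longrightarrow> continuous_on W f"
  by (cases k) auto

lemma Ck_on_cong:
  assumes W: "openin (Euclidean_space n) W"
  shows "(\<And>y. y \<in> W \<Longrightarrow> f y = g y) \<Longrightarrow> Ck_on n k W f \<Longrightarrow> Ck_on n k W g"
proof (induction k arbitrary: f g)
  case (Suc k)
  note eq = Suc.prems(1)
  have D: "((\<lambda>t. g (x(i := t))) has_field_derivative partial_deriv i f x) (at (x i))" if "i < n" "x \<in> W" for i x
    using slice_derivative_cong[OF W that(2,1), of f g] eq Ck_on_SucD(1)[OF Suc.prems(2) that] by blast
  show ?case
  proof (rule Ck_on_SucI)
    show "continuous_on W g"
      using Ck_on_continuous[OF Suc.prems(2)] eq continuous_on_cong by force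
    show "Ck_on n k W (partial_deriv i g)" if "i < n" for i
      by (rule Suc.IH[OF _ Ck_on_SucD(2)[OF Suc.prems(2) that]])
        (simp add: partial_deriv_def[of i g] DERIV_imp_deriv[OF D[OF that]])
  qed (rule D)
qed (metis Ck_on.simps(1) continuous_on_cong)

lemma Ck_on_SucI':
  assumes W: "openin (Euclidean_space n) W" and cont: "continuous_on W f"
    and D: "\<And>i x. i < n \<Longrightarrow> x \<in> W \<Longrightarrow> ((\<lambda>t. f (x(i := t))) has_field_derivative f' i x) (at (x i))"
    and f': "\<And>i. i < n \<Longrightarrow> Ck_on n k W (f' i)"
  shows "Ck_on n (Suc k) W f"
proof (rule Ck_on_SucI[OF cont D])
  show "Ck_on n k W (partial_deriv i f)" if "i < n" for i
    by (rule Ck_on_cong[OF W _ f'[OF that]])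
      (simp add: partial_deriv_def DERIV_imp_deriv[OF D[OF that]])
qed

lemma Ck_on_Suc_imp: "Ck_on n (Suc k) W f \<Longrightarrow> Ck_on n k W f"
proof (induction k arbitrary: f)
  case (Suc k)
  then show ?case
    by (metis Ck_on.simps(2))
qed simp

lemma Ck_on_subset: "Ck_on n k W f \<Longrightarrow> W' \<subseteq> W \<Longrightarrow> Ck_on n k W' f"
  by (induction k arbitrary: f) (auto intro: continuous_on_subset)

text \<open>Partial derivatives are taken pointwise along coordinate lines, without reference to the
  set. Continuity is relative to \<open>\<Union>\<W>\<close>, and it is there that openness of the
  members enters.\<close>

lemma Ck_on_Union:
  assumes "\<And>W. W \<in> \<W> \<Longrightarrow> openin (Euclidean_space n) W"
  shows "(\<And>W. W \<in> \<W> \<Longrightarrow> Ck_on n k W f) \<Longrightarrow> Ck_on n k (\<Union>\<W>) f"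
proof (induction k arbitrary: f)
  have cont: "continuous_on (\<Union>\<W>) f" if "\<And>W. W \<in> \<W> \<Longrightarrow> continuous_on W f" for f
  proof -
    have "(f \<longlongrightarrow> f x) (at x within \<Union>\<W>)" if W: "W \<in> \<W>" and x: "x \<in> W" for W x
    proof -
      obtain W0 where W0: "open W0" "W = W0 \<inter> {x. \<forall>i\<ge>n. x i = 0}"
        using assms[OF W] by (auto simp: openin_Euclidean_space_iff)
      have "\<Union>\<W> \<subseteq> {x. \<forall>i\<ge>n. x i = 0}"
        using assms by (fastforce simp: openin_Euclidean_space_iff)
      then have "at x within \<Union>\<W> = at x within W"
        using W W0 x by (intro at_within_nhd[of x W0]) auto
      then show ?thesis
        using \<open>\<And>W. W \<in> \<W> \<Longrightarrow> continuous_on W f\<close>[OF W] x by (simp add: continuous_on_def)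
    qed
    then show ?thesis
      by (auto simp: continuous_on_def)
  qed
  {
    case 0
    show ?case
      unfolding Ck_on.simps(1) by (rule cont) (use 0 in simp)
  next
    case (Suc k)
    show ?case
      unfolding Ck_on.simps
    proof (intro conjI allI impI ballI)
      show "continuous_on (\<Union>\<W>) f"
        by (rule cont) (use Suc.prems in auto)
      fix i assume i: "i < n"
      show "(\<lambda>t. f (x(i := t))) differentiable at (x i)" if "x \<in> \<Union>\<W>" for x
        using Suc.prems that i by auto
      show "Ck_on n k (\<Union>\<W>) (partial_deriv i f)"
        using Suc.prems i by (intro Suc.IH) auto
    qed
  }
qed

lemma Ck_on_const: "Ck_on n k W (\<lambda>y. c)"
proof (induction k arbitrary: c)
  case (Suc k)
  have "partial_deriv i (\<lambda>y. c) = (\<lambda>y. 0)" for i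
    by (simp add: partial_deriv_def fun_eq_iff)
  then show ?case using Suc by simp
qed simp

lemma Ck_on_add:
  assumes W: "openin (Euclidean_space n) W"
  shows "Ck_on n k W f \<Longrightarrow> Ck_on n k W g \<Longrightarrow> Ck_on n k W (\<lambda>y. f y + g y)"
proof (induction k arbitrary: f g)
  case (Suc k)
  show ?case
  proof (rule Ck_on_SucI'[OF W, where f' = "\<lambda>i y. partial_deriv i f y + partial_deriv i g y"])
    show "continuous_on W (\<lambda>y. f y + g y)"
      using Suc.prems by (intro continuous_intros Ck_on_continuous)
    fix i assume i: "i < n"
    show "Ck_on n k W (\<lambda>y. partial_deriv i f y + partial_deriv i g y)"
      by (intro Suc.IH Ck_on_SucD(2)[OF Suc.prems(1) i] Ck_on_SucD(2)[OF Suc.prems(2) i])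
    show "((\<lambda>t. f (x(i := t)) + g (x(i := t))) has_field_derivative
        partial_deriv i f x + partial_deriv i g x) (at (x i))" if x: "x \<in> W" for x
      using DERIV_add[OF Ck_on_SucD(1)[OF Suc.prems(1) i x] Ck_on_SucD(1)[OF Suc.prems(2) i x]]
      by (simp del: fun_upd_apply)
  qed
qed (auto intro: continuous_intros)

lemma Ck_on_mult:
  assumes W: "openin (Euclidean_space n) W"
  shows "Ck_on n k W f \<Longrightarrow> Ck_on n k W g \<Longrightarrow> Ck_on n k W (\<lambda>y. f y * g y)"
proof (induction k arbitrary: f g)
  case (Suc k)
  note less = Ck_on_Suc_imp[OF Suc.prems(1)] Ck_on_Suc_imp[OF Suc.prems(2)]
  show ?case
  proof (rule Ck_on_SucI'[OF W, where f' = "\<lambda>i y. partial_deriv i f y * g y + f y * partial_deriv i g y"])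
    show "continuous_on W (\<lambda>y. f y * g y)"
      using less by (intro continuous_intros Ck_on_continuous)
    fix i assume i: "i < n"
    show "Ck_on n k W (\<lambda>y. partial_deriv i f y * g y + f y * partial_deriv i g y)"
      by (intro Ck_on_add[OF W] Suc.IH less Ck_on_SucD(2)[OF Suc.prems(1) i] Ck_on_SucD(2)[OF Suc.prems(2) i])
    show "((\<lambda>t. f (x(i := t)) * g (x(i := t))) has_field_derivative
        partial_deriv i f x * g x + f x * partial_deriv i g x) (at (x i))" if x: "x \<in> W" for x
      using DERIV_mult[OF Ck_on_SucD(1)[OF Suc.prems(1) i x] Ck_on_SucD(1)[OF Suc.prems(2) i x]]
      by (simp add: mult.commute del: fun_upd_apply)
  qed
qed (auto intro: continuous_intros)

lemma Ck_on_inverse: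
  assumes W: "openin (Euclidean_space n) W"
  shows "Ck_on n k W f \<Longrightarrow> (\<And>y. y \<in> W \<Longrightarrow> f y \<noteq> 0) \<Longrightarrow> Ck_on n k W (\<lambda>y. inverse (f y))"
proof (induction k)
  case (Suc k)
  note less = Ck_on_Suc_imp[OF Suc.prems(1)]
  note IH = Suc.IH[OF less Suc.prems(2)]
  show ?case
  proof (rule Ck_on_SucI'[OF W, where f' = "\<lambda>i y. (-1) * partial_deriv i f y * (inverse (f y) * inverse (f y))"])
    show "continuous_on W (\<lambda>y. inverse (f y))"
      using less Suc.prems(2) by (intro continuous_intros Ck_on_continuous) auto
    fix i assume i: "i < n"
    show "Ck_on n k W (\<lambda>y. (-1) * partial_deriv i f y * (inverse (f y) * inverse (f y)))"
      by (intro Ck_on_mult[OF W] Ck_on_const IH Ck_on_SucD(2)[OF Suc.prems(1) i] Suc.prems(2))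
    show "((\<lambda>t. inverse (f (x(i := t)))) has_field_derivative
        (-1) * partial_deriv i f x * (inverse (f x) * inverse (f x))) (at (x i))" if x: "x \<in> W" for x
      using DERIV_inverse_fun[OF Ck_on_SucD(1)[OF Suc.prems(1) i x]] Suc.prems(2)[OF x]
      by (simp add: power2_eq_square mult_ac del: fun_upd_apply)
  qed
qed (auto intro: continuous_intros)

text \<open>The family \<open>t \<mapsto> p(1/t) e\<^sup>-\<^sup>1\<^sup>/\<^sup>t\<close>, extended by \<open>0\<close> to \<open>t \<le> 0\<close>, is closed under derivatives.\<close>

definition flat :: "real poly \<Rightarrow> real \<Rightarrow> real" where
  "flat p t = (if t > 0 then poly p (1 / t) * exp (- (1 / t)) else 0)"

lemma tendsto_poly_exp: "((\<lambda>x. poly q x * exp (- x)) \<longlongrightarrow> (0::real)) at_top"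
proof -
  have "((\<lambda>x. \<Sum>i\<le>degree q. coeff q i * (x ^ i / exp x)) \<longlongrightarrow> (\<Sum>i\<le>degree q. coeff q i * 0)) at_top"
    by (intro tendsto_intros tendsto_power_div_exp_0)
  moreover have "(\<Sum>i\<le>degree q. coeff q i * (x ^ i / exp x)) = poly q x * exp (- x)" for x :: real
    by (simp add: poly_altdef sum_distrib_right exp_minus divide_inverse mult.assoc)
  ultimately show ?thesis by simp
qed

text \<open>With s = 1 / t one has d/dt = - s^2 d/ds, and the derivative of p(s) e^(-s) in s is (p'
  - p) e^(-s); hence the polynomial s^2 (p - p').\<close>

lemma DERIV_flat: "(flat p has_field_derivative flat ([:0, 0, 1:] * (p - pderiv p)) t) (at t)"
proof -
  consider "t > 0" | "t < 0" | "t = 0" by linarith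
  then show ?thesis
  proof cases
    case 1
    have "((\<lambda>t. poly p (1 / t) * exp (- (1 / t))) has_field_derivative
        flat ([:0, 0, 1:] * (p - pderiv p)) t) (at t)"
      using 1 by (auto intro!: derivative_eq_intros simp: flat_def field_simps power2_eq_square)
    moreover have "eventually (\<lambda>s. flat p s = poly p (1 / s) * exp (- (1 / s))) (nhds t)"
      using eventually_nhds_in_open[of "{0<..}" t] 1 by (auto elim!: eventually_mono simp: flat_def)
    ultimately show ?thesis
      by (subst DERIV_cong_ev[OF refl _ refl])
  next
    case 2
    have "eventually (\<lambda>s. flat p s = 0) (nhds t)"
      using eventually_nhds_in_open[of "{..<0}" t] 2 by (auto elim!: eventually_mono simp: flat_def)
    moreover have "((\<lambda>s. 0) has_field_derivative flat ([:0, 0, 1:] * (p - pderiv p)) t) (at t)"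
      using 2 by (simp add: flat_def)
    ultimately show ?thesis
      by (subst DERIV_cong_ev[OF refl _ refl])
  next
    case 3
    have "((\<lambda>h. flat p h / h) \<longlongrightarrow> 0) (at 0)"
    proof (rule filterlim_split_at_real)
      have "eventually (\<lambda>h. flat p h / h = 0) (at_left 0)"
        by (simp add: eventually_at_filter flat_def)
      then show "((\<lambda>h. flat p h / h) \<longlongrightarrow> 0) (at_left 0)"
        by (rule tendsto_eventually)
      \<comment> \<open>The difference quotient at 0 from the right is s p(s) e^(-s) with s = 1 / h,
        and the exponential wins as s grows.\<close>
      have "((\<lambda>h. poly ([:0, 1:] * p) (inverse h) * exp (- inverse h)) \<longlongrightarrow> (0::real)) (at_right 0)"
        by (rule filterlim_compose[OF tendsto_poly_exp filterlim_inverse_at_top_right])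
      moreover have "eventually (\<lambda>h. poly ([:0, 1:] * p) (inverse h) * exp (- inverse h) = flat p h / h) (at_right 0)"
        by (auto simp: eventually_at_filter flat_def field_simps)
      ultimately show "((\<lambda>h. flat p h / h) \<longlongrightarrow> 0) (at_right 0)"
        using tendsto_cong by fast
    qed
    then show ?thesis
      by (simp add: 3 DERIV_def) (simp add: flat_def)
  qed
qed

text \<open>The derivative of the composite involves \<open>flat\<close> with another polynomial, so
  the induction on k has to run over all \<open>p\<close>.\<close>

lemma Ck_on_flat:
  assumes W: "openin (Euclidean_space n) W"
  shows "Ck_on n k W f \<Longrightarrow> Ck_on n k W (\<lambda>y. flat p (f y))"
proof (induction k arbitrary: p)
  have cont: "continuous_on W (\<lambda>y. flat p (f y))" if "continuous_on W f" for p
    by (rule continuous_on_compose2[OF DERIV_continuous_on[OF DERIV_flat] that]) auto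
  {
    case 0
    then show ?case using cont by simp
  next
    case (Suc k)
    note less = Ck_on_Suc_imp[OF Suc.prems]
    show ?case
    proof (rule Ck_on_SucI'[OF W cont, where f' = "\<lambda>i y. flat ([:0, 0, 1:] * (p - pderiv p)) (f y) * partial_deriv i f y"])
      show "continuous_on W f" using less by (rule Ck_on_continuous)
      fix i assume i: "i < n"
      show "Ck_on n k W (\<lambda>y. flat ([:0, 0, 1:] * (p - pderiv p)) (f y) * partial_deriv i f y)"
        by (intro Ck_on_mult[OF W] Suc.IH less Ck_on_SucD(2)[OF Suc.prems i])
      show "((\<lambda>t. flat p (f (x(i := t)))) has_field_derivative
          flat ([:0, 0, 1:] * (p - pderiv p)) (f x) * partial_deriv i f x) (at (x i))" if x: "x \<in> W" for x
        using DERIV_chain2[where f = "flat p" and g = "\<lambda>t. f (x(i := t))" and x = "x i", OF _ Ck_on_SucD(1)[OF Suc.prems i x]]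
          DERIV_flat[of p "f x"] by simp
    qed
  }
qed

section \<open>Smooth functions on a manifold\<close>

lemma smooth_fun_on_iff:
  "smooth_fun_on M W f \<longleftrightarrow>
    (\<forall>U \<phi>. (U, \<phi>) \<in> charts M \<longrightarrow> (\<forall>k. Ck_on (mdim M) k (\<phi> ` (U \<inter> W)) (\<lambda>y. f (inv_into U \<phi> y))))"
  by (auto simp: smooth_fun_on_def Cinf_on_def)

lemma smooth_fun_on_subset: "smooth_fun_on M W f \<Longrightarrow> W' \<subseteq> W \<Longrightarrow> smooth_fun_on M W' f"
  unfolding smooth_fun_on_iff by (meson Ck_on_subset Int_mono image_mono subset_refl)

lemma smooth_fun_on_const: "smooth_fun_on M W (\<lambda>x. c)"
  by (simp add: smooth_fun_on_iff Ck_on_const)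

section \<open>Bump functions in charts\<close>

lemma open_contains_box:
  fixes p :: "nat \<Rightarrow> real"
  assumes "open W" "p \<in> W"
  obtains \<delta> where "\<delta> > 0" "\<And>y. (\<And>i. i < n \<Longrightarrow> \<bar>y i - p i\<bar> \<le> \<delta>) \<Longrightarrow> (\<And>i. i \<ge> n \<Longrightarrow> y i = p i) \<Longrightarrow> y \<in> W"
proof -
  have "openin (product_topology (\<lambda>i. euclidean) UNIV) W"
    unfolding euclidean_product_topology by (rule open_openin[THEN iffD1]) fact
  from product_topology_open_contains_basis[OF this assms(2)]
  obtain X where X: "p \<in> (\<Pi>\<^sub>E i\<in>UNIV. X i)" "\<And>i. open (X i)" "(\<Pi>\<^sub>E i\<in>UNIV. X i) \<subseteq> W"
    by (auto simp: open_openin[symmetric])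
  have "\<exists>d>0. cball (p i) d \<subseteq> X i" for i
    using X(1,2) by (auto simp: PiE_iff intro: open_contains_cball[THEN iffD1, rule_format])
  then obtain d where d: "\<And>i. d i > 0" "\<And>i. cball (p i) (d i) \<subseteq> X i"
    by metis
  \<comment> \<open>Finitely many radii suffice because the coordinates from n on are held fixed;
    the inserted 1 keeps the set nonempty when n = 0.\<close>
  define \<delta> where "\<delta> = Min (insert 1 (d ` {..<n}))"
  show ?thesis
  proof
    show "\<delta> > 0" using d(1) by (simp add: \<delta>_def)
    fix y assume y: "\<And>i. i < n \<Longrightarrow> \<bar>y i - p i\<bar> \<le> \<delta>" "\<And>i. i \<ge> n \<Longrightarrow> y i = p i"
    have "y i \<in> X i" for i
    proof (cases "i < n")
      case True
      then have "\<delta> \<le> d i" by (auto simp: \<delta>_def)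
      then have "y i \<in> cball (p i) (d i)"
        using y(1)[OF True] by (simp add: dist_real_def abs_minus_commute)
      then show ?thesis using d(2) by blast
    next
      case False
      then show ?thesis using y(2) X(1) by (simp add: PiE_iff)
    qed
    then show "y \<in> W" using X(3) by (auto simp: PiE_iff)
  qed
qed

lemma compact_box: "compact {y :: nat \<Rightarrow> real. (\<forall>i<n. \<bar>y i - p i\<bar> \<le> \<delta>) \<and> (\<forall>i\<ge>n. y i = 0)}" (is "compact ?S")
proof -
  have "?S = (\<Pi>\<^sub>E i\<in>UNIV. if i < n then cball (p i) \<delta> else {0})"
    by (auto simp: PiE_iff dist_real_def abs_minus_commute split: if_splits)
  moreover have "compactin (product_topology (\<lambda>i. euclidean) UNIV)
      (\<Pi>\<^sub>E i\<in>UNIV. if i < n then cball (p i) \<delta> else {0})"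
    by (simp add: compactin_PiE)
  ultimately show ?thesis
    by (simp add: euclidean_product_topology)
qed

locale smooth_mfd =
  fixes M :: "'m::{t2_space, second_countable_topology} manifold"
  assumes smooth: "smooth_manifold M"
begin

lemma charts_cover: "\<exists>U \<phi>. (U, \<phi>) \<in> charts M \<and> x \<in> U"
proof -
  have "x \<in> (\<Union>(U, \<phi>)\<in>charts M. U)"
    using smooth by (simp add: smooth_manifold_def)
  then show ?thesis by auto
qed

lemma chart:
  assumes "(U, \<phi>) \<in> charts M"
  shows "open U" "openin (Euclidean_space (mdim M)) (\<phi> ` U)" "homeomorphism U (\<phi> ` U) \<phi> (inv_into U \<phi>)"
  using smooth assms by (auto simp: smooth_manifold_def)

lemma chart_inv: "(U, \<phi>) \<in> charts M \<Longrightarrow> x \<in> U \<Longrightarrow> inv_into U \<phi> (\<phi> x) = x"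
  using chart(3) homeomorphism_apply1 by blast

lemma chart_openin:
  assumes c: "(U, \<phi>) \<in> charts M" and W: "open W"
  shows "openin (Euclidean_space (mdim M)) (\<phi> ` (U \<inter> W))"
proof -
  have "openin (top_of_set (\<phi> ` U)) (\<phi> ` (U \<inter> W))"
    by (rule homeomorphism_imp_open_map[OF chart(3)[OF c]]) (simp add: W openin_open_Int)
  then obtain T where T: "open T" "\<phi> ` (U \<inter> W) = \<phi> ` U \<inter> T"
    by (auto simp: openin_open)
  obtain W0 where "open W0" "\<phi> ` U = W0 \<inter> {x. \<forall>i\<ge>mdim M. x i = 0}"
    using chart(2)[OF c] by (auto simp: openin_Euclidean_space_iff)
  then have "open (W0 \<inter> T)" "\<phi> ` (U \<inter> W) = (W0 \<inter> T) \<inter> {x. \<forall>i\<ge>mdim M. x i = 0}"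
    using T by auto
  then show ?thesis
    unfolding openin_Euclidean_space_iff by blast
qed

lemma smooth_fun_on_cong:
  assumes W: "open W" and f: "smooth_fun_on M W f" and eq: "\<And>x. x \<in> W \<Longrightarrow> f x = g x"
  shows "smooth_fun_on M W g"
  unfolding smooth_fun_on_iff
proof (intro allI impI)
  fix U \<phi> k assume c: "(U, \<phi>) \<in> charts M"
  show "Ck_on (mdim M) k (\<phi> ` (U \<inter> W)) (\<lambda>y. g (inv_into U \<phi> y))"
    by (rule Ck_on_cong[OF chart_openin[OF c W], of "\<lambda>y. f (inv_into U \<phi> y)"])
      (use f c in \<open>auto simp: chart_inv eq smooth_fun_on_iff\<close>)
qed

lemma smooth_fun_on_add:
  "open W \<Longrightarrow> smooth_fun_on M W f \<Longrightarrow> smooth_fun_on M W g \<Longrightarrow> smooth_fun_on M W (\<lambda>x. f x + g x)"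
  unfolding smooth_fun_on_iff by (auto intro!: Ck_on_add chart_openin)

lemma smooth_fun_on_mult:
  "open W \<Longrightarrow> smooth_fun_on M W f \<Longrightarrow> smooth_fun_on M W g \<Longrightarrow> smooth_fun_on M W (\<lambda>x. f x * g x)"
  unfolding smooth_fun_on_iff by (auto intro!: Ck_on_mult chart_openin)

lemma smooth_fun_on_inverse:
  assumes "open W" "smooth_fun_on M W f" "\<And>x. x \<in> W \<Longrightarrow> f x \<noteq> 0"
  shows "smooth_fun_on M W (\<lambda>x. inverse (f x))"
  unfolding smooth_fun_on_iff
proof (intro allI impI)
  fix U \<phi> k assume c: "(U, \<phi>) \<in> charts M"
  show "Ck_on (mdim M) k (\<phi> ` (U \<inter> W)) (\<lambda>y. inverse (f (inv_into U \<phi> y)))"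
    by (rule Ck_on_inverse[OF chart_openin[OF c assms(1)]])
      (use assms(2,3) c in \<open>auto simp: chart_inv smooth_fun_on_iff\<close>)
qed

lemma smooth_fun_on_flat: "open W \<Longrightarrow> smooth_fun_on M W f \<Longrightarrow> smooth_fun_on M W (\<lambda>x. flat p (f x))"
  unfolding smooth_fun_on_iff by (auto intro!: Ck_on_flat chart_openin)

lemma smooth_fun_on_prod:
  "open W \<Longrightarrow> (\<And>i. i \<in> I \<Longrightarrow> smooth_fun_on M W (f i)) \<Longrightarrow> smooth_fun_on M W (\<lambda>x. \<Prod>i\<in>I. f i x)"
  by (induction I rule: infinite_finite_induct) (auto intro: smooth_fun_on_const smooth_fun_on_mult)

lemma smooth_fun_on_power:
  "open W \<Longrightarrow> smooth_fun_on M W f \<Longrightarrow> smooth_fun_on M W (\<lambda>x. f x ^ k)"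
  by (induction k) (auto intro: smooth_fun_on_const smooth_fun_on_mult)

lemma smooth_fun_on_Union:
  assumes "\<And>W. W \<in> \<W> \<Longrightarrow> open W" "\<And>W. W \<in> \<W> \<Longrightarrow> smooth_fun_on M W f"
  shows "smooth_fun_on M (\<Union>\<W>) f"
  unfolding smooth_fun_on_iff
proof (intro allI impI)
  fix U \<phi> k assume c: "(U, \<phi>) \<in> charts M"
  have "Ck_on (mdim M) k (\<Union>((\<lambda>W. \<phi> ` (U \<inter> W)) ` \<W>)) (\<lambda>y. f (inv_into U \<phi> y))"
    by (rule Ck_on_Union) (use assms c in \<open>auto intro: chart_openin simp: smooth_fun_on_iff\<close>)
  also have "\<Union>((\<lambda>W. \<phi> ` (U \<inter> W)) ` \<W>) = \<phi> ` (U \<inter> \<Union>\<W>)"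
    by blast
  finally show "Ck_on (mdim M) k (\<phi> ` (U \<inter> \<Union>\<W>)) (\<lambda>y. f (inv_into U \<phi> y))" .
qed

lemma smooth_fun_on_Un:
  assumes "open V" "open W" "smooth_fun_on M V f" "smooth_fun_on M W f"
  shows "smooth_fun_on M (V \<union> W) f"
  using smooth_fun_on_Union[of "{V, W}" f] assms by auto

lemma smooth_fun_on_chart:
  assumes "(U, \<phi>) \<in> charts M" "i < mdim M"
  shows "smooth_fun_on M U (\<lambda>x. \<phi> x i)"
  using smooth assms unfolding smooth_manifold_def smooth_fun_on_def by fast

lemma smooth_funs_const: "(\<lambda>x. c) \<in> smooth_funs M"
  by (simp add: smooth_funs_def smooth_fun_on_const)

lemma smooth_funs_add: "f \<in> smooth_funs M \<Longrightarrow> g \<in> smooth_funs M \<Longrightarrow> (\<lambda>x. f x + g x) \<in> smooth_funs M"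
  by (simp add: smooth_funs_def smooth_fun_on_add)

lemma smooth_funs_mult: "f \<in> smooth_funs M \<Longrightarrow> g \<in> smooth_funs M \<Longrightarrow> (\<lambda>x. f x * g x) \<in> smooth_funs M"
  by (simp add: smooth_funs_def smooth_fun_on_mult)

text \<open>The support \<open>K\<close> is compact, hence closed because the manifold is Hausdorff.\<close>

lemma bump:
  assumes W: "open W" and x: "x \<in> W"
  obtains f K V where "f \<in> smooth_funs M" "closed K" "K \<subseteq> W" "\<And>y. y \<notin> K \<Longrightarrow> f y = 0"
    "open V" "x \<in> V" "\<And>y. y \<in> V \<Longrightarrow> f y \<noteq> 0" "f x = 1"
proof -
  obtain U \<phi> where c: "(U, \<phi>) \<in> charts M" "x \<in> U"
    using charts_cover by blast
  define n where "n = mdim M"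
  obtain W0 where W0: "open W0" "\<phi> ` (U \<inter> W) = W0 \<inter> {x. \<forall>i\<ge>n. x i = 0}"
    using chart_openin[OF c(1) W] by (auto simp: openin_Euclidean_space_iff n_def)
  have p: "\<phi> x \<in> W0" "\<And>i. i \<ge> n \<Longrightarrow> \<phi> x i = 0"
    using W0(2) c(2) x by auto
  obtain \<delta> where \<delta>: "\<delta> > 0"
    "\<And>y. (\<And>i. i < n \<Longrightarrow> \<bar>y i - \<phi> x i\<bar> \<le> \<delta>) \<Longrightarrow> (\<And>i. i \<ge> n \<Longrightarrow> y i = \<phi> x i) \<Longrightarrow> y \<in> W0"
    using open_contains_box[OF W0(1) p(1)] by blast
  define S where "S = {y. (\<forall>i<n. \<bar>y i - \<phi> x i\<bar> \<le> \<delta>) \<and> (\<forall>i\<ge>n. y i = 0)}"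
  have S: "S \<subseteq> \<phi> ` (U \<inter> W)"
    unfolding W0(2) S_def using \<delta>(2) p(2) by auto
  define K where "K = inv_into U \<phi> ` S"
  have "compact K"
    unfolding K_def
  proof (rule compact_continuous_image)
    show "compact S" unfolding S_def by (rule compact_box)
    have "continuous_on (\<phi> ` U) (inv_into U \<phi>)"
      using chart(3)[OF c(1)] by (simp add: homeomorphism_def)
    then show "continuous_on S (inv_into U \<phi>)"
      by (rule continuous_on_subset) (use S in auto)
  qed
  then have K: "closed K" by (rule compact_imp_closed)
  have KW: "K \<subseteq> U \<inter> W"
    using S chart_inv[OF c(1)] by (fastforce simp: K_def)
  \<comment> \<open>\<open>flat 1 (\<delta>\<^sup>2 - d\<^sup>2)\<close> is nonzero exactly for |d|
    < \<delta>, so over the chart domain g is nonzero exactly on the open box \<open>V\<close>,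
    which lies inside \<open>K\<close>. In dimension 0 the product is empty and g is 1.\<close>
  define g where "g y = (\<Prod>i<n. flat 1 (\<delta>\<^sup>2 - (\<phi> y i - \<phi> x i)\<^sup>2))" for y
  define V where "V = {y\<in>U. \<forall>i<n. \<bar>\<phi> y i - \<phi> x i\<bar> < \<delta>}"
  have g: "g y \<noteq> 0 \<longleftrightarrow> (\<forall>i<n. \<bar>\<phi> y i - \<phi> x i\<bar> < \<delta>)" for y
  proof -
    have "flat 1 (\<delta>\<^sup>2 - d\<^sup>2) \<noteq> 0 \<longleftrightarrow> \<bar>d\<bar> < \<delta>" for d
      using abs_le_square_iff[of \<delta> d] \<delta>(1) by (auto simp: flat_def)
    then show ?thesis
      by (auto simp: g_def)
  qed
  have "V \<subseteq> K"
  proof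
    fix y assume y: "y \<in> V"
    then have "\<phi> y \<in> S"
      using chart(2)[OF c(1)] by (auto simp: V_def S_def n_def openin_Euclidean_space_iff less_imp_le)
    then show "y \<in> K"
      using y chart_inv[OF c(1), of y] by (force simp: V_def K_def)
  qed
  define f where "f y = (if y \<in> U then g y / g x else 0)" for y
  have fK: "f y = 0" if "y \<notin> K" for y
    using that \<open>V \<subseteq> K\<close> g[of y] by (auto simp: f_def V_def)
  have gx: "g x \<noteq> 0"
    using \<delta>(1) by (simp add: g)
  have "smooth_fun_on M U (\<lambda>y. g y * inverse (g x))"
  proof (intro smooth_fun_on_mult smooth_fun_on_const chart[OF c(1)])
    show "smooth_fun_on M U g"
      unfolding g_def
    proof (intro smooth_fun_on_prod smooth_fun_on_flat chart[OF c(1)])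
      fix i assume "i \<in> {..<n}"
      then have h: "smooth_fun_on M U (\<lambda>y. \<phi> y i + - \<phi> x i)"
        by (intro smooth_fun_on_add smooth_fun_on_const smooth_fun_on_chart[OF c(1)] chart[OF c(1)]) (simp add: n_def)
      note o = chart(1)[OF c(1)]
      have "smooth_fun_on M U (\<lambda>y. \<delta>\<^sup>2 + (- 1) * ((\<phi> y i + - \<phi> x i) * (\<phi> y i + - \<phi> x i)))"
        by (rule smooth_fun_on_add[OF o smooth_fun_on_const smooth_fun_on_mult[OF o smooth_fun_on_const
              smooth_fun_on_mult[OF o h h]]])
      then show "smooth_fun_on M U (\<lambda>y. \<delta>\<^sup>2 - (\<phi> y i - \<phi> x i)\<^sup>2)"
        by (simp add: power2_eq_square)
    qed
  qed
  then have "smooth_fun_on M U f"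
    by (rule smooth_fun_on_cong[OF chart(1)[OF c(1)]]) (simp add: f_def divide_inverse)
  moreover have "smooth_fun_on M (- K) f"
    by (rule smooth_fun_on_cong[OF _ smooth_fun_on_const[of _ _ 0]]) (use K fK in auto)
  ultimately have "smooth_fun_on M (U \<union> - K) f"
    using K chart(1)[OF c(1)] by (intro smooth_fun_on_Un) auto
  moreover have "U \<union> - K = UNIV" using KW by auto
  ultimately have "f \<in> smooth_funs M"
    by (simp add: smooth_funs_def)
  moreover have "open V"
  proof -
    have cont: "continuous_on U (\<lambda>y. \<phi> y i)" for i
      using chart(3)[OF c(1)]
      by (auto simp: homeomorphism_def intro: continuous_on_product_then_coordinatewise)
    have "open (U \<inter> (\<Inter>i<n. U \<inter> (\<lambda>y. \<bar>\<phi> y i - \<phi> x i\<bar>) -` {..<\<delta>}))"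
      by (intro open_Int chart[OF c(1)] open_INT finite_lessThan ballI
          continuous_open_preimage continuous_intros cont open_lessThan)
    also have "U \<inter> (\<Inter>i<n. U \<inter> (\<lambda>y. \<bar>\<phi> y i - \<phi> x i\<bar>) -` {..<\<delta>}) = V"
      by (auto simp: V_def)
    finally show ?thesis .
  qed
  moreover have "x \<in> V" using c(2) \<delta>(1) by (simp add: V_def)
  moreover have "f y \<noteq> 0" if "y \<in> V" for y
    using that g[of y] gx by (simp add: V_def f_def)
  moreover have "f x = 1" using c(2) gx by (simp add: f_def)
  ultimately show ?thesis
    using that K KW fK by blast
qed

text \<open>The product is smooth on \<open>U\<close> and zero on the complement of
  \<open>K\<close>; both sets are open and together they cover the manifold. Local coefficients
  become global functions in this way.\<close>

lemma smooth_funs_extend: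
  assumes g: "g \<in> smooth_funs M" "closed K" "K \<subseteq> U" "\<And>y. y \<notin> K \<Longrightarrow> g y = 0" and U: "open U" "smooth_fun_on M U c"
  shows "(\<lambda>x. if x \<in> U then g x * c x else 0) \<in> smooth_funs M"
proof -
  let ?f = "\<lambda>x. if x \<in> U then g x * c x else 0"
  have "smooth_fun_on M U (\<lambda>x. g x * c x)"
    using g(1) U by (intro smooth_fun_on_mult) (auto simp: smooth_funs_def intro: smooth_fun_on_subset)
  then have "smooth_fun_on M U ?f"
    by (rule smooth_fun_on_cong[OF U(1)]) simp
  moreover have "smooth_fun_on M (- K) ?f"
    by (rule smooth_fun_on_cong[OF _ smooth_fun_on_const[of _ _ 0]]) (use g in auto)
  ultimately have "smooth_fun_on M (U \<union> - K) ?f"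
    using g(2) U by (intro smooth_fun_on_Un) auto
  moreover have "U \<union> - K = UNIV" using g(3) by auto
  ultimately show ?thesis by (simp add: smooth_funs_def)
qed

end

section \<open>Sections of vector bundles\<close>

lemma smooth_section_onD:
  assumes "smooth_section_on M E W u"
  shows "x \<in> W \<Longrightarrow> u x \<in> fibre E x"
    "(U, r, e) \<in> frames E \<Longrightarrow> \<exists>c. (\<forall>i<r. smooth_fun_on M (U \<inter> W) (c i)) \<and>
        (\<forall>x\<in>U \<inter> W. u x = (\<Sum>i<r. c i x *\<^sub>R e i x))"
  using assms unfolding smooth_section_on_def by (simp, fast)

lemma smooth_section_onI:
  assumes "\<And>x. x \<in> W \<Longrightarrow> u x \<in> fibre E x"
    and "\<And>U r e. (U, r, e) \<in> frames E \<Longrightarrow> \<exists>c. (\<forall>i<r. smooth_fun_on M (U \<inter> W) (c i)) \<and>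
        (\<forall>x\<in>U \<inter> W. u x = (\<Sum>i<r. c i x *\<^sub>R e i x))"
  shows "smooth_section_on M E W u"
  using assms unfolding smooth_section_on_def by auto

lemma smooth_section_on_cong:
  assumes "smooth_section_on M E W u" "\<And>x. x \<in> W \<Longrightarrow> u x = v x"
  shows "smooth_section_on M E W v"
proof (rule smooth_section_onI)
  show "v x \<in> fibre E x" if "x \<in> W" for x
    using smooth_section_onD(1)[OF assms(1) that] assms(2)[OF that] by simp
  fix U r e assume "(U, r, e) \<in> frames E"
  from smooth_section_onD(2)[OF assms(1) this]
  show "\<exists>c. (\<forall>i<r. smooth_fun_on M (U \<inter> W) (c i)) \<and> (\<forall>x\<in>U \<inter> W. v x = (\<Sum>i<r. c i x *\<^sub>R e i x))"
    using assms(2) by (metis IntD2)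
qed

lemma smooth_section_on_subset:
  assumes "smooth_section_on M E W u" "W' \<subseteq> W"
  shows "smooth_section_on M E W' u"
proof (rule smooth_section_onI)
  show "u x \<in> fibre E x" if "x \<in> W'" for x
    using smooth_section_onD(1)[OF assms(1)] assms(2) that by blast
  fix U r e assume "(U, r, e) \<in> frames E"
  from smooth_section_onD(2)[OF assms(1) this]
  show "\<exists>c. (\<forall>i<r. smooth_fun_on M (U \<inter> W') (c i)) \<and> (\<forall>x\<in>U \<inter> W'. u x = (\<Sum>i<r. c i x *\<^sub>R e i x))"
    using assms(2) smooth_fun_on_subset by (metis Int_iff Int_mono order_refl subsetD)
qed

locale smooth_vb = smooth_mfd M
  for M :: "'m::{t2_space, second_countable_topology} manifold" +
  fixes E :: "('m, 'e::real_vector) vbundle"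
  assumes vb: "vector_bundle M E"
begin

lemma fibre_subspace: "subspace (fibre E x)"
  using vb by (simp add: vector_bundle_def)

lemma frame_exists:
  obtains U r e where "(U, r, e) \<in> frames E" "x \<in> U"
proof -
  have "x \<in> (\<Union>(U, r, e)\<in>frames E. U)"
    using vb by (simp add: vector_bundle_def)
  then show ?thesis using that by auto
qed

lemma frame:
  assumes "(U, r, e) \<in> frames E"
  shows "open U"
    "x \<in> U \<Longrightarrow> inj_on (\<lambda>i. e i x) {..<r}" "x \<in> U \<Longrightarrow> independent ((\<lambda>i. e i x) ` {..<r})"
    "x \<in> U \<Longrightarrow> span ((\<lambda>i. e i x) ` {..<r}) = fibre E x"
    "i < r \<Longrightarrow> smooth_section_on M E U (e i)"
  using vb assms unfolding vector_bundle_def by fast+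

lemma frame_in_fibre: "(U, r, e) \<in> frames E \<Longrightarrow> x \<in> U \<Longrightarrow> i < r \<Longrightarrow> e i x \<in> fibre E x"
  using smooth_section_onD(1)[OF frame(5)] by blast

text \<open>Independence is stated for the set of frame vectors; injectivity of the indexing turns
  it into uniqueness of indexed coefficients.\<close>

lemma frame_unique:
  assumes f: "(U, r, e) \<in> frames E" and x: "x \<in> U"
    and eq: "(\<Sum>i<r. c i *\<^sub>R e i x) = (\<Sum>i<r. d i *\<^sub>R e i x)" and i: "i < r"
  shows "c i = d i"
proof -
  let ?b = "\<lambda>i. e i x"
  note inj = frame(2)[OF f x]
  define g where "g v = c (inv_into {..<r} ?b v) - d (inv_into {..<r} ?b v)" for v
  have gb: "g (?b j) = c j - d j" if "j < r" for j
    using inv_into_f_f[OF inj, of j] that by (simp add: g_def)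
  have "(\<Sum>v\<in>?b ` {..<r}. g v *\<^sub>R v) = (\<Sum>j<r. (c j - d j) *\<^sub>R ?b j)"
    by (subst sum.reindex[OF inj]) (simp add: gb)
  also have "\<dots> = 0"
    using eq by (simp add: scaleR_diff_left sum_subtractf)
  finally have "g (?b i) = 0"
    using independentD[OF frame(3)[OF f x], of "?b ` {..<r}" g "?b i"] i by simp
  then show ?thesis using gb i by simp
qed

lemma smooth_section_on_add:
  assumes W: "open W" and u: "smooth_section_on M E W u" and v: "smooth_section_on M E W v"
  shows "smooth_section_on M E W (\<lambda>x. u x + v x)"
proof (rule smooth_section_onI)
  show "u x + v x \<in> fibre E x" if "x \<in> W" for x
    using smooth_section_onD(1)[OF u that] smooth_section_onD(1)[OF v that] fibre_subspace subspace_add by blast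
  fix U r e assume f: "(U, r, e) \<in> frames E"
  obtain c d where c: "\<And>i. i < r \<Longrightarrow> smooth_fun_on M (U \<inter> W) (c i)" "\<And>x. x \<in> U \<inter> W \<Longrightarrow> u x = (\<Sum>i<r. c i x *\<^sub>R e i x)"
    and d: "\<And>i. i < r \<Longrightarrow> smooth_fun_on M (U \<inter> W) (d i)" "\<And>x. x \<in> U \<inter> W \<Longrightarrow> v x = (\<Sum>i<r. d i x *\<^sub>R e i x)"
    using smooth_section_onD(2)[OF u f] smooth_section_onD(2)[OF v f] by blast
  show "\<exists>c. (\<forall>i<r. smooth_fun_on M (U \<inter> W) (c i)) \<and>
      (\<forall>x\<in>U \<inter> W. u x + v x = (\<Sum>i<r. c i x *\<^sub>R e i x))"
    using c d frame(1)[OF f] W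
    by (intro exI[of _ "\<lambda>i x. c i x + d i x"])
      (auto intro!: smooth_fun_on_add simp: scaleR_add_left sum.distrib)
qed

lemma smooth_section_on_smult:
  assumes W: "open W" and g: "smooth_fun_on M W g" and u: "smooth_section_on M E W u"
  shows "smooth_section_on M E W (\<lambda>x. g x *\<^sub>R u x)"
proof (rule smooth_section_onI)
  show "g x *\<^sub>R u x \<in> fibre E x" if "x \<in> W" for x
    using smooth_section_onD(1)[OF u that] fibre_subspace subspace_scale by blast
  fix U r e assume f: "(U, r, e) \<in> frames E"
  obtain c where c: "\<And>i. i < r \<Longrightarrow> smooth_fun_on M (U \<inter> W) (c i)" "\<And>x. x \<in> U \<inter> W \<Longrightarrow> u x = (\<Sum>i<r. c i x *\<^sub>R e i x)"
    using smooth_section_onD(2)[OF u f] by blast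
  have "smooth_fun_on M (U \<inter> W) g"
    using g by (rule smooth_fun_on_subset) simp
  then show "\<exists>c. (\<forall>i<r. smooth_fun_on M (U \<inter> W) (c i)) \<and>
      (\<forall>x\<in>U \<inter> W. g x *\<^sub>R u x = (\<Sum>i<r. c i x *\<^sub>R e i x))"
    using c frame(1)[OF f] W
    by (intro exI[of _ "\<lambda>i x. g x * c i x"])
      (auto intro!: smooth_fun_on_mult simp: scaleR_sum_right)
qed

lemma smooth_section_on_zero: "smooth_section_on M E W (\<lambda>x. 0)"
proof (rule smooth_section_onI)
  show "0 \<in> fibre E x" for x using fibre_subspace subspace_0 by blast
  fix U r e assume "(U, r, e) \<in> frames E"
  show "\<exists>c. (\<forall>i<r. smooth_fun_on M (U \<inter> W) (c i)) \<and> (\<forall>x\<in>U \<inter> W. 0 = (\<Sum>i<r. c i x *\<^sub>R e i x))"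
    by (intro exI[of _ "\<lambda>i x. 0"]) (simp add: smooth_fun_on_const)
qed

lemma smooth_section_on_sum:
  assumes "open W" "\<And>i. i \<in> I \<Longrightarrow> smooth_section_on M E W (u i)"
  shows "smooth_section_on M E W (\<lambda>x. \<Sum>i\<in>I. u i x)"
  using assms(2)
  by (induction I rule: infinite_finite_induct) (auto intro: smooth_section_on_zero smooth_section_on_add assms(1))

text \<open>Each piece has its own coefficient functions, while a section over the union needs one
  family. Coefficients are chosen pointwise, and uniqueness in a frame makes the choice agree with
  the smooth coefficients on each piece.\<close>

lemma smooth_section_on_Union:
  assumes W: "\<And>W. W \<in> \<W> \<Longrightarrow> open W" and u: "\<And>W. W \<in> \<W> \<Longrightarrow> smooth_section_on M E W u"
  shows "smooth_section_on M E (\<Union>\<W>) u"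
proof (rule smooth_section_onI)
  show "u x \<in> fibre E x" if "x \<in> \<Union>\<W>" for x
    using that smooth_section_onD(1)[OF u] by blast
  fix U r e assume f: "(U, r, e) \<in> frames E"
  define c where "c i x = (SOME c. u x = (\<Sum>i<r. c i *\<^sub>R e i x)) i" for i x
  have c: "smooth_fun_on M (U \<inter> W) (c i)" "\<And>x. x \<in> U \<inter> W \<Longrightarrow> u x = (\<Sum>i<r. c i x *\<^sub>R e i x)"
    if Wi: "W \<in> \<W>" "i < r" for W i
  proof -
    obtain d where d: "\<And>i. i < r \<Longrightarrow> smooth_fun_on M (U \<inter> W) (d i)"
      "\<And>x. x \<in> U \<inter> W \<Longrightarrow> u x = (\<Sum>i<r. d i x *\<^sub>R e i x)"
      using smooth_section_onD(2)[OF u[OF Wi(1)] f] by blast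
    show e: "u x = (\<Sum>i<r. c i x *\<^sub>R e i x)" if "x \<in> U \<inter> W" for x
      unfolding c_def by (rule someI[of _ "\<lambda>i. d i x"]) (rule d(2)[OF that])
    show "smooth_fun_on M (U \<inter> W) (c i)"
    proof (rule smooth_fun_on_cong[OF _ d(1)[OF Wi(2)]])
      show "open (U \<inter> W)" using frame(1)[OF f] W[OF Wi(1)] by blast
      show "d i x = c i x" if x: "x \<in> U \<inter> W" for x
        by (rule frame_unique[OF f]) (use x d(2) e Wi in auto)
    qed
  qed
  have "smooth_fun_on M (\<Union>((\<inter>) U ` \<W>)) (c i)" if "i < r" for i
    by (rule smooth_fun_on_Union) (use c(1) that W frame(1)[OF f] in auto)
  moreover have "\<Union>((\<inter>) U ` \<W>) = U \<inter> \<Union>\<W>" by blast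
  ultimately have 1: "\<forall>i<r. smooth_fun_on M (U \<inter> \<Union>\<W>) (c i)" by simp
  have 2: "u x = (\<Sum>i<r. c i x *\<^sub>R e i x)" if x: "x \<in> U \<inter> \<Union>\<W>" for x
  proof -
    obtain W where "W \<in> \<W>" "x \<in> U \<inter> W" using x by blast
    then obtain d where "u x = (\<Sum>i<r. d i x *\<^sub>R e i x)"
      using smooth_section_onD(2)[OF u f] by blast
    then show ?thesis unfolding c_def by (rule someI[of _ "\<lambda>i. d i x"])
  qed
  show "\<exists>c. (\<forall>i<r. smooth_fun_on M (U \<inter> \<Union>\<W>) (c i)) \<and> (\<forall>x\<in>U \<inter> \<Union>\<W>. u x = (\<Sum>i<r. c i x *\<^sub>R e i x))"
    using 1 2 by blast
qed

abbreviation "\<Gamma> \<equiv> sections M E"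

lemma sectionsD: "u \<in> \<Gamma> \<Longrightarrow> u x \<in> fibre E x"
  by (simp add: sections_def smooth_section_onD(1))

lemma smult_section: "f \<in> smooth_funs M \<Longrightarrow> u \<in> \<Gamma> \<Longrightarrow> f \<cdot>\<^sub>C u \<in> \<Gamma>"
  by (simp add: sections_def smooth_funs_def fun_smult_def smooth_section_on_smult)

lemma smult_const: "(\<lambda>x. c) \<cdot>\<^sub>C u = c *\<^sub>R u"
  by (simp add: fun_smult_def scaleR_fun_def)

lemma subspace_sections: "subspace \<Gamma>"
proof (rule subspaceI)
  show "0 \<in> \<Gamma>" by (simp add: sections_def zero_fun_def smooth_section_on_zero)
  show "u + v \<in> \<Gamma>" if "u \<in> \<Gamma>" "v \<in> \<Gamma>" for u v
    using that by (simp add: sections_def plus_fun_def smooth_section_on_add)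
  show "c *\<^sub>R u \<in> \<Gamma>" if "u \<in> \<Gamma>" for c u
    using smult_section[OF smooth_funs_const that, of c] by (simp add: smult_const)
qed

lemma section_extend:
  assumes g: "g \<in> smooth_funs M" "closed K" "K \<subseteq> U" "\<And>y. y \<notin> K \<Longrightarrow> g y = 0"
    and U: "open U" "smooth_section_on M E U u"
  shows "(\<lambda>x. if x \<in> U then g x *\<^sub>R u x else 0) \<in> \<Gamma>"
proof -
  let ?f = "\<lambda>x. if x \<in> U then g x *\<^sub>R u x else 0"
  have "smooth_fun_on M U g"
    using g(1) by (auto simp: smooth_funs_def intro: smooth_fun_on_subset)
  then have "smooth_section_on M E U (\<lambda>x. g x *\<^sub>R u x)"
    using U by (intro smooth_section_on_smult) auto
  then have "smooth_section_on M E U ?f"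
    by (rule smooth_section_on_cong) simp
  moreover have "smooth_section_on M E (- K) ?f"
    by (rule smooth_section_on_cong[OF smooth_section_on_zero]) (use g in auto)
  ultimately have "smooth_section_on M E (\<Union>{U, - K}) ?f"
    using g(2) U by (intro smooth_section_on_Union) auto
  moreover have "\<Union>{U, - K} = UNIV" using g(3) by auto
  ultimately show ?thesis by (simp add: sections_def)
qed

text \<open>Because of this a cochain is determined by its values on global sections. The vector is
  given constant coefficients in a local frame, and the resulting local section is cut off by a bump
  function.\<close>

lemma section_through:
  assumes "v \<in> fibre E x"
  shows "\<exists>u\<in>\<Gamma>. u x = v"
proof -
  obtain U r e where f: "(U, r, e) \<in> frames E" "x \<in> U" by (rule frame_exists)
  obtain g K V where g: "g \<in> smooth_funs M" "closed K" "K \<subseteq> U" "\<And>y. y \<notin> K \<Longrightarrow> g y = 0" "g x = 1"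
    using bump[OF frame(1)[OF f(1)] f(2)] by metis
  let ?b = "\<lambda>i. e i x"
  have "v \<in> span (?b ` {..<r})" using assms frame(4)[OF f] by simp
  then obtain c where "v = (\<Sum>w\<in>?b ` {..<r}. c w *\<^sub>R w)"
    by (auto simp: span_finite)
  then have v: "v = (\<Sum>i<r. c (?b i) *\<^sub>R ?b i)"
    by (simp add: sum.reindex[OF frame(2)[OF f]])
  have sm: "smooth_section_on M E U (\<lambda>y. \<Sum>i<r. c (?b i) *\<^sub>R e i y)"
    by (intro smooth_section_on_sum smooth_section_on_smult smooth_fun_on_const frame[OF f(1)]) auto
  define w where "w y = (if y \<in> U then g y *\<^sub>R (\<Sum>i<r. c (?b i) *\<^sub>R e i y) else 0)" for y
  have "w \<in> \<Gamma>"
    unfolding w_def by (rule section_extend[OF g(1-4) frame(1)[OF f(1)] sm])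
  moreover have "w x = v"
    unfolding v w_def using f(2) g(5) by simp
  ultimately show ?thesis by blast
qed

end

section \<open>Cochains and multilinear maps of sections\<close>

lemma sum_fun_apply: "(\<Sum>i\<in>I. f i) x = (\<Sum>i\<in>I. f i x)" for f :: "'i \<Rightarrow> 'a \<Rightarrow> 'b::comm_monoid_add"
  by (induction I rule: infinite_finite_induct) auto

lemma scaleR_fun_apply: "(c *\<^sub>R f) x = c *\<^sub>R f x"
  by (simp add: scaleR_fun_def)

locale two_bundles = E: smooth_vb M E + A: smooth_vb M A
  for M :: "'m::{t2_space, second_countable_topology} manifold"
    and E :: "('m, 'e::real_vector) vbundle"
    and A :: "('m, 'a::real_vector) vbundle"
begin

lemma cochainsD:
  assumes "P \<in> cochains M E A k"
  shows "\<not> (length vs = k \<and> set vs \<subseteq> fibre E x) \<Longrightarrow> P x vs = 0"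
    "length vs = k \<Longrightarrow> set vs \<subseteq> fibre E x \<Longrightarrow> P x vs \<in> fibre A x"
    "length vs = k \<Longrightarrow> set vs \<subseteq> fibre E x \<Longrightarrow> i < k \<Longrightarrow> v \<in> fibre E x \<Longrightarrow> w \<in> fibre E x \<Longrightarrow>
      P x (vs[i := c *\<^sub>R v + d *\<^sub>R w]) = c *\<^sub>R P x (vs[i := v]) + d *\<^sub>R P x (vs[i := w])"
    "length vs = k \<Longrightarrow> set vs \<subseteq> fibre E x \<Longrightarrow> i < k \<Longrightarrow> j < k \<Longrightarrow> i \<noteq> j \<Longrightarrow> vs ! i = vs ! j \<Longrightarrow> P x vs = 0"
    "(U, r, e) \<in> frames E \<Longrightarrow> length js = k \<Longrightarrow> set js \<subseteq> {..<r} \<Longrightarrow>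
      smooth_section_on M A U (\<lambda>x. P x (map (\<lambda>j. e j x) js))"
proof -
  note P = assms[unfolded cochains_def mem_Collect_eq]
  note P1 = P[THEN conjunct1] and P2 = P[THEN conjunct2, THEN conjunct1] and P3 = P[THEN conjunct2, THEN conjunct2]
  show "\<not> (length vs = k \<and> set vs \<subseteq> fibre E x) \<Longrightarrow> P x vs = 0" using P1 by blast
  {
    assume "length vs = k" "set vs \<subseteq> fibre E x"
    then have *: "P x vs \<in> fibre A x \<and>
        (\<forall>i<k. \<forall>v\<in>fibre E x. \<forall>w\<in>fibre E x. \<forall>c d.
           P x (vs[i := c *\<^sub>R v + d *\<^sub>R w]) = c *\<^sub>R P x (vs[i := v]) + d *\<^sub>R P x (vs[i := w])) \<and>
        (\<forall>i<k. \<forall>j<k. i \<noteq> j \<and> vs ! i = vs ! j \<longrightarrow> P x vs = 0)"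
      using P2 by simp
    show "P x vs \<in> fibre A x" using * by simp
    show "i < k \<Longrightarrow> v \<in> fibre E x \<Longrightarrow> w \<in> fibre E x \<Longrightarrow>
      P x (vs[i := c *\<^sub>R v + d *\<^sub>R w]) = c *\<^sub>R P x (vs[i := v]) + d *\<^sub>R P x (vs[i := w])"
      using * by simp
    show "i < k \<Longrightarrow> j < k \<Longrightarrow> i \<noteq> j \<Longrightarrow> vs ! i = vs ! j \<Longrightarrow> P x vs = 0"
      using * by blast
  }
  show "(U, r, e) \<in> frames E \<Longrightarrow> length js = k \<Longrightarrow> set js \<subseteq> {..<r} \<Longrightarrow>
      smooth_section_on M A U (\<lambda>x. P x (map (\<lambda>j. e j x) js))"
    using P3 by fastforce
qed

lemma cochain_sum:
  assumes P: "P \<in> cochains M E A k" and xs: "set xs \<subseteq> fibre E x" and ys: "set ys \<subseteq> fibre E x"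
    and len: "Suc (length xs + length ys) = k" and v: "\<And>j. j \<in> J \<Longrightarrow> v j \<in> fibre E x"
  shows "P x (xs @ (\<Sum>j\<in>J. c j *\<^sub>R v j) # ys) = (\<Sum>j\<in>J. c j *\<^sub>R P x (xs @ v j # ys))"
proof -
  have z: "0 \<in> fibre E x" using E.fibre_subspace subspace_0 by blast
  have lin: "P x (xs @ (c *\<^sub>R v + d *\<^sub>R w) # ys) = c *\<^sub>R P x (xs @ v # ys) + d *\<^sub>R P x (xs @ w # ys)"
    if "v \<in> fibre E x" "w \<in> fibre E x" for c d v w
    using cochainsD(3)[OF P, of "xs @ 0 # ys" x "length xs" v w c d] that xs ys len z by simp
  have 0: "P x (xs @ 0 # ys) = 0"
    using lin[OF z z, of 0 0] by simp
  show ?thesis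
    using v
  proof (induction J rule: infinite_finite_induct)
    case (insert j J)
    have "(\<Sum>j\<in>J. c j *\<^sub>R v j) \<in> fibre E x"
      using insert.prems by (intro subspace_sum[OF E.fibre_subspace] subspace_scale[OF E.fibre_subspace]) auto
    then show ?case
      using lin[of "v j" "\<Sum>j\<in>J. c j *\<^sub>R v j" "c j" 1] insert by simp
  qed (simp_all add: 0)
qed

text \<open>Smoothness of a cochain is required on frame vectors only. A section has smooth
  coefficients in a frame, so sections can replace frame vectors one argument at a time.\<close>

lemma eval_cochain_section:
  assumes P: "P \<in> cochains M E A k" and us: "length us = k" "set us \<subseteq> E.\<Gamma>"
  shows "eval_cochain P us \<in> A.\<Gamma>"
proof -
  \<comment> \<open>Mixed lists, sections followed by frame vectors, let the induction expand the
    last remaining section and move its frame vectors to the tail.\<close>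
  have *: "smooth_section_on M A U (\<lambda>x. P x (map (\<lambda>u. u x) us @ map (\<lambda>j. e j x) js))"
    if f: "(U, r, e) \<in> frames E" and "set us \<subseteq> E.\<Gamma>" "set js \<subseteq> {..<r}" "length us + length js = k" for U r e us js
    using that(2-)
  proof (induction us arbitrary: js rule: rev_induct)
    case Nil
    then show ?case using cochainsD(5)[OF P f, of js] by simp
  next
    case (snoc u us)
    note o = E.frame(1)[OF f]
    have u: "smooth_section_on M E UNIV u" using snoc.prems by (simp add: sections_def)
    obtain c where c: "\<And>i. i < r \<Longrightarrow> smooth_fun_on M U (c i)" "\<And>x. x \<in> U \<Longrightarrow> u x = (\<Sum>i<r. c i x *\<^sub>R e i x)"
      using smooth_section_onD(2)[OF u f] by auto
    have "smooth_section_on M A U (\<lambda>x. \<Sum>i<r. c i x *\<^sub>R P x (map (\<lambda>u. u x) us @ map (\<lambda>j. e j x) (i # js)))"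
      by (intro A.smooth_section_on_sum A.smooth_section_on_smult o c snoc.IH) (use snoc.prems in auto)
    then show ?case
    proof (rule smooth_section_on_cong)
      fix x assume x: "x \<in> U"
      have "P x (map (\<lambda>u. u x) us @ (\<Sum>i<r. c i x *\<^sub>R e i x) # map (\<lambda>j. e j x) js)
          = (\<Sum>i<r. c i x *\<^sub>R P x (map (\<lambda>u. u x) us @ e i x # map (\<lambda>j. e j x) js))"
        by (rule cochain_sum[OF P]) (use snoc.prems E.sectionsD E.frame_in_fibre[OF f x] in auto)
      then show "(\<Sum>i<r. c i x *\<^sub>R P x (map (\<lambda>u. u x) us @ map (\<lambda>j. e j x) (i # js))) =
          P x (map (\<lambda>u. u x) (us @ [u]) @ map (\<lambda>j. e j x) js)"
        using c(2)[OF x] by simp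
    qed
  qed
  have "smooth_section_on M A (\<Union>{U. \<exists>r e. (U, r, e) \<in> frames E}) (eval_cochain P us)"
  proof (rule A.smooth_section_on_Union)
    fix W assume "W \<in> {U. \<exists>r e. (U, r, e) \<in> frames E}"
    then obtain r e where f: "(W, r, e) \<in> frames E" by blast
    then show "open W" by (rule E.frame)
    show "smooth_section_on M A W (eval_cochain P us)"
      using *[OF f us(2), of "[]"] us(1) by (simp add: eval_cochain_def)
  qed
  moreover have "\<Union>{U. \<exists>r e. (U, r, e) \<in> frames E} = UNIV"
    using E.frame_exists by (metis (mono_tags, lifting) UNIV_eq_I Union_iff mem_Collect_eq)
  ultimately show ?thesis by (simp add: sections_def)
qed

lemma cochain_eqI:
  assumes P: "P \<in> cochains M E A k" and Q: "Q \<in> cochains M E A k"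
    and eq: "\<And>us. length us = k \<Longrightarrow> set us \<subseteq> E.\<Gamma> \<Longrightarrow> eval_cochain P us = eval_cochain Q us"
  shows "P = Q"
proof (intro ext)
  fix x vs
  show "P x vs = Q x vs"
  proof (cases "length vs = k \<and> set vs \<subseteq> fibre E x")
    case True
    have "\<forall>v\<in>fibre E x. \<exists>u. u \<in> E.\<Gamma> \<and> u x = v"
      using E.section_through by blast
    then obtain s where s: "\<And>v. v \<in> fibre E x \<Longrightarrow> s v \<in> E.\<Gamma> \<and> s v x = v"
      by metis
    have "map (\<lambda>u. u x) (map s vs) = vs"
      using True s by (auto intro!: map_idI)
    moreover have "eval_cochain P (map s vs) = eval_cochain Q (map s vs)"
      using True s by (intro eq) auto
    ultimately show ?thesis
      unfolding eval_cochain_def by metis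
  next
    case False
    then show ?thesis using cochainsD(1)[OF P False] cochainsD(1)[OF Q False] by simp
  qed
qed

text \<open>By additivity it suffices to treat a section vanishing at x. Such a section is a
  C^infty-combination of global sections with coefficients vanishing at x, and these coefficients
  can be pulled out of \<open>F\<close>.\<close>

lemma tensorial_local:
  assumes cl: "\<And>us. length us = k \<Longrightarrow> set us \<subseteq> E.\<Gamma> \<Longrightarrow> F us \<in> A.\<Gamma>"
    and add: "\<And>us i u v. length us = k \<Longrightarrow> set us \<subseteq> E.\<Gamma> \<Longrightarrow> i < k \<Longrightarrow> u \<in> E.\<Gamma> \<Longrightarrow> v \<in> E.\<Gamma> \<Longrightarrow>
      F (us[i := u + v]) = F (us[i := u]) + F (us[i := v])"
    and smult: "\<And>us i u f. length us = k \<Longrightarrow> set us \<subseteq> E.\<Gamma> \<Longrightarrow> i < k \<Longrightarrow> u \<in> E.\<Gamma> \<Longrightarrow> f \<in> smooth_funs M \<Longrightarrow>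
      F (us[i := f \<cdot>\<^sub>C u]) = f \<cdot>\<^sub>C F (us[i := u])"
    and us: "length us = k" "set us \<subseteq> E.\<Gamma>" and i: "i < k" and u: "u \<in> E.\<Gamma>" "v \<in> E.\<Gamma>" and eq: "u x = v x"
  shows "F (us[i := u]) x = F (us[i := v]) x"
proof -
  have zero: "F (us[i := u]) x = 0" if u: "u \<in> E.\<Gamma>" and ux: "u x = 0" for u
  proof -
    obtain U r e where f: "(U, r, e) \<in> frames E" "x \<in> U" by (rule E.frame_exists)
    obtain g K V where g: "g \<in> smooth_funs M" "closed K" "K \<subseteq> U" "\<And>y. y \<notin> K \<Longrightarrow> g y = 0" "g x = 1"
      using E.bump[OF E.frame(1)[OF f(1)] f(2)] by metis
    have us': "smooth_section_on M E UNIV u" using u by (simp add: sections_def)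
    obtain c where c: "\<And>i. i < r \<Longrightarrow> smooth_fun_on M U (c i)" "\<And>x. x \<in> U \<Longrightarrow> u x = (\<Sum>i<r. c i x *\<^sub>R e i x)"
      using smooth_section_onD(2)[OF us' f(1)] by auto
    define h where "h j = (\<lambda>y. if y \<in> U then g y * c j y else 0)" for j
    define s where "s j = (\<lambda>y. if y \<in> U then g y *\<^sub>R e j y else 0)" for j
    \<comment> \<open>The bump function is spent twice, on \<open>c j\<close> and on
      \<open>e j\<close>, to make both global. The remainder of u therefore has the coefficient 1 -
      g^2, which vanishes at x since g x = 1.\<close>
    define q where "q = (\<lambda>y. 1 + (-1) * (g y * g y))"
    have h: "h j \<in> smooth_funs M" if "j < r" for j
      unfolding h_def by (rule E.smooth_funs_extend[OF g(1-4) E.frame(1)[OF f(1)] c(1)[OF that]])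
    have s: "s j \<in> E.\<Gamma>" if "j < r" for j
      unfolding s_def by (rule E.section_extend[OF g(1-4) E.frame(1)[OF f(1)] E.frame(5)[OF f(1) that]])
    have q: "q \<in> smooth_funs M"
      unfolding q_def by (intro E.smooth_funs_add E.smooth_funs_mult E.smooth_funs_const g(1))
    have decomp: "u = q \<cdot>\<^sub>C u + (\<Sum>j<r. h j \<cdot>\<^sub>C s j)"
    proof
      fix y
      show "u y = (q \<cdot>\<^sub>C u + (\<Sum>j<r. h j \<cdot>\<^sub>C s j)) y"
      proof (cases "y \<in> U")
        case True
        then have "(\<Sum>j<r. h j \<cdot>\<^sub>C s j) y = (g y * g y) *\<^sub>R u y"
          by (simp add: sum_fun_apply fun_smult_def h_def s_def c(2) scaleR_sum_right mult_ac)
        then show ?thesis by (simp add: fun_smult_def q_def algebra_simps)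
      next
        case False
        then have "g y = 0" using g by blast
        then show ?thesis
          using False by (simp add: sum_fun_apply fun_smult_def h_def s_def q_def)
      qed
    qed
    have sum: "F (us[i := \<Sum>j\<in>J. h j \<cdot>\<^sub>C s j]) x = (\<Sum>j\<in>J. h j x *\<^sub>R F (us[i := s j]) x) \<and> (\<Sum>j\<in>J. h j \<cdot>\<^sub>C s j) \<in> E.\<Gamma>"
      if "J \<subseteq> {..<r}" for J
    proof -
      have "finite J" using that finite_subset by blast
      then show ?thesis
        using that
      proof (induction J)
        case empty
        have "0 \<in> E.\<Gamma>" by (rule subspace_0[OF E.subspace_sections])
        then have "F (us[i := (\<lambda>x. 0) \<cdot>\<^sub>C 0]) = (\<lambda>x. 0) \<cdot>\<^sub>C F (us[i := 0])"
          by (intro smult us i E.smooth_funs_const)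
        then show ?case
          using \<open>0 \<in> E.\<Gamma>\<close> unfolding E.smult_const A.smult_const by (simp add: zero_fun_def)
      next
        case (insert j J)
        then have j: "j < r" by auto
        have hs: "h j \<cdot>\<^sub>C s j \<in> E.\<Gamma>" by (rule E.smult_section[OF h[OF j] s[OF j]])
        have IH: "F (us[i := \<Sum>j\<in>J. h j \<cdot>\<^sub>C s j]) x = (\<Sum>j\<in>J. h j x *\<^sub>R F (us[i := s j]) x)"
          "(\<Sum>j\<in>J. h j \<cdot>\<^sub>C s j) \<in> E.\<Gamma>"
          using insert by auto
        have "F (us[i := h j \<cdot>\<^sub>C s j + (\<Sum>j\<in>J. h j \<cdot>\<^sub>C s j)]) =
            h j \<cdot>\<^sub>C F (us[i := s j]) + F (us[i := \<Sum>j\<in>J. h j \<cdot>\<^sub>C s j])"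
          unfolding add[OF us i hs IH(2)] smult[OF us i s[OF j] h[OF j]] ..
        then have "F (us[i := h j \<cdot>\<^sub>C s j + (\<Sum>j\<in>J. h j \<cdot>\<^sub>C s j)]) x =
            h j x *\<^sub>R F (us[i := s j]) x + (\<Sum>j\<in>J. h j x *\<^sub>R F (us[i := s j]) x)"
          by (simp only: plus_fun_apply fun_smult_def IH(1)[unfolded fun_smult_def])
        then show ?case
          using subspace_add[OF E.subspace_sections hs IH(2)]
          by (simp only: sum.insert[OF insert.hyps(1,2)] simp_thms)
      qed
    qed
    have "h j x = 0" if j: "j < r" for j
    proof -
      have "(\<Sum>i<r. c i x *\<^sub>R e i x) = (\<Sum>i<r. 0 *\<^sub>R e i x)"
        using c(2)[OF f(2)] ux by simp
      then have "c j x = 0" by (rule E.frame_unique[OF f _ j])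
      then show ?thesis by (simp add: h_def)
    qed
    then have z: "F (us[i := \<Sum>j<r. h j \<cdot>\<^sub>C s j]) x = 0"
      using sum[OF order_refl] by simp
    have "F (us[i := q \<cdot>\<^sub>C u + (\<Sum>j<r. h j \<cdot>\<^sub>C s j)]) = F (us[i := q \<cdot>\<^sub>C u]) + F (us[i := \<Sum>j<r. h j \<cdot>\<^sub>C s j])"
      by (rule add[OF us i E.smult_section[OF q u]]) (use sum[OF order_refl] in simp)
    then have "F (us[i := u]) = q \<cdot>\<^sub>C F (us[i := u]) + F (us[i := \<Sum>j<r. h j \<cdot>\<^sub>C s j])"
      unfolding decomp[symmetric] smult[OF us i u q] .
    from fun_cong[OF this, of x] have "F (us[i := u]) x = q x *\<^sub>R F (us[i := u]) x"
      unfolding plus_fun_apply z by (simp add: fun_smult_def)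
    then show ?thesis by (simp add: q_def g(5))
  qed
  have "(-1) *\<^sub>R v \<in> E.\<Gamma>" using u(2) by (rule subspace_scale[OF E.subspace_sections])
  then have d: "u + (-1) *\<^sub>R v \<in> E.\<Gamma>" using u(1) by (intro subspace_add[OF E.subspace_sections])
  have "F (us[i := v + (u + (-1) *\<^sub>R v)]) = F (us[i := v]) + F (us[i := u + (-1) *\<^sub>R v])"
    by (rule add[OF us i u(2) d])
  moreover have "v + (u + (-1) *\<^sub>R v) = u" by simp
  moreover have "F (us[i := u + (-1) *\<^sub>R v]) x = 0"
    by (rule zero[OF d]) (simp add: eq)
  ultimately show ?thesis by simp
qed

text \<open>The value on fibre vectors is obtained by extending them to arbitrarily chosen sections;
  \<open>tensorial_local\<close> makes the result independent of the choice, hence multilinear and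
  compatible with evaluation.\<close>

lemma tensorial_imp_cochain:
  assumes cl: "\<And>us. length us = k \<Longrightarrow> set us \<subseteq> E.\<Gamma> \<Longrightarrow> F us \<in> A.\<Gamma>"
    and add: "\<And>us i u v. length us = k \<Longrightarrow> set us \<subseteq> E.\<Gamma> \<Longrightarrow> i < k \<Longrightarrow> u \<in> E.\<Gamma> \<Longrightarrow> v \<in> E.\<Gamma> \<Longrightarrow>
      F (us[i := u + v]) = F (us[i := u]) + F (us[i := v])"
    and smult: "\<And>us i u f. length us = k \<Longrightarrow> set us \<subseteq> E.\<Gamma> \<Longrightarrow> i < k \<Longrightarrow> u \<in> E.\<Gamma> \<Longrightarrow> f \<in> smooth_funs M \<Longrightarrow>
      F (us[i := f \<cdot>\<^sub>C u]) = f \<cdot>\<^sub>C F (us[i := u])"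
    and alt: "\<And>us i j. length us = k \<Longrightarrow> set us \<subseteq> E.\<Gamma> \<Longrightarrow> i < k \<Longrightarrow> j < k \<Longrightarrow> i \<noteq> j \<Longrightarrow> us ! i = us ! j \<Longrightarrow> F us = 0"
  shows "\<exists>R\<in>cochains M E A k. \<forall>us. length us = k \<and> set us \<subseteq> E.\<Gamma> \<longrightarrow> eval_cochain R us = F us"
proof -
  have indep: "F us x = F vs x"
    if uv: "length us = k" "set us \<subseteq> E.\<Gamma>" "length vs = k" "set vs \<subseteq> E.\<Gamma>" "map (\<lambda>u. u x) us = map (\<lambda>u. u x) vs" for us vs x
  proof -
    have nth: "(us ! j) x = (vs ! j) x" if "j < k" for j
      using \<open>map _ us = map _ vs\<close> that \<open>length us = k\<close> \<open>length vs = k\<close> by (metis nth_map)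
    \<comment> \<open>Interpolation between the two lists: each step changes a single argument to
      one with the same value at x.\<close>
    have "F (take j us @ drop j vs) x = F vs x" if "j \<le> k" for j
      using that
    proof (induction j)
      case (Suc j)
      let ?ws = "take j us @ drop j vs"
      have j: "j < k" using Suc.prems by simp
      have ws: "length ?ws = k" "set ?ws \<subseteq> E.\<Gamma>"
        using uv j by (auto dest: in_set_takeD in_set_dropD)
      have "F (?ws[j := us ! j]) x = F (?ws[j := vs ! j]) x"
        by (rule tensorial_local[OF cl add smult ws j]) (use uv j nth in auto)
      moreover have "?ws[j := vs ! j] = ?ws"
        using uv j by (intro nth_equalityI) (auto simp: nth_list_update nth_append)
      moreover have "?ws[j := us ! j] = take (Suc j) us @ drop (Suc j) vs"
        using uv j by (intro nth_equalityI) (auto simp: nth_list_update nth_append less_Suc_eq)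
      ultimately show ?case using Suc by simp
    qed simp
    from this[of k] show ?thesis using uv by simp
  qed
  have "\<forall>x. \<forall>v\<in>fibre E x. \<exists>u. u \<in> E.\<Gamma> \<and> u x = v"
    using E.section_through by blast
  then obtain s where s: "\<And>x v. v \<in> fibre E x \<Longrightarrow> s x v \<in> E.\<Gamma>" "\<And>x v. v \<in> fibre E x \<Longrightarrow> s x v x = v"
    by metis
  define R where "R x vs = (if length vs = k \<and> set vs \<subseteq> fibre E x then F (map (s x) vs) x else 0)" for x vs
  have R_eval: "R x (map (\<lambda>u. u x) us) = F us x" if us: "length us = k" "set us \<subseteq> E.\<Gamma>" for us x
  proof -
    have fib: "set (map (\<lambda>u. u x) us) \<subseteq> fibre E x"
      using us E.sectionsD by auto
    then have "F (map (s x) (map (\<lambda>u. u x) us)) x = F us x"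
      by (intro indep) (use us s in auto)
    then show ?thesis using us fib by (simp add: R_def)
  qed
  have lin: "R x (vs[i := c *\<^sub>R v + d *\<^sub>R w]) = c *\<^sub>R R x (vs[i := v]) + d *\<^sub>R R x (vs[i := w])"
    if vs: "length vs = k" "set vs \<subseteq> fibre E x" and i: "i < k" and v: "v \<in> fibre E x" and w: "w \<in> fibre E x"
    for x vs i c d v w
  proof -
    define us where "us = map (s x) vs"
    have us: "length us = k" "set us \<subseteq> E.\<Gamma>" "map (\<lambda>u. u x) us = vs"
      using vs s by (auto simp: us_def intro!: map_idI)
    have upd: "set (us[i := u]) \<subseteq> E.\<Gamma>" if "u \<in> E.\<Gamma>" for i u
      using us(2) that set_update_subset_insert by fastforce
    let ?v = "s x v" and ?w = "s x w"
    have V: "c *\<^sub>R ?v \<in> E.\<Gamma>" "d *\<^sub>R ?w \<in> E.\<Gamma>" "?v \<in> E.\<Gamma>" "?w \<in> E.\<Gamma>"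
      using s v w subspace_scale[OF E.subspace_sections] by auto
    have ev: "R x (vs[i := u x]) = F (us[i := u]) x" if "u \<in> E.\<Gamma>" for u
      using R_eval[of "us[i := u]" x] us upd[OF that] by (simp add: map_update)
    have "R x (vs[i := c *\<^sub>R v + d *\<^sub>R w]) = F (us[i := c *\<^sub>R ?v + d *\<^sub>R ?w]) x"
      using ev[OF subspace_add[OF E.subspace_sections V(1,2)]] s v w by (simp add: scaleR_fun_apply)
    also have "\<dots> = F (us[i := c *\<^sub>R ?v]) x + F (us[i := d *\<^sub>R ?w]) x"
      by (simp add: add[OF us(1,2) i V(1,2)])
    also have "\<dots> = c *\<^sub>R F (us[i := ?v]) x + d *\<^sub>R F (us[i := ?w]) x"
      using smult[OF us(1,2) i V(3) E.smooth_funs_const[of c]] smult[OF us(1,2) i V(4) E.smooth_funs_const[of d]]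
      by (simp add: E.smult_const A.smult_const scaleR_fun_apply)
    also have "\<dots> = c *\<^sub>R R x (vs[i := v]) + d *\<^sub>R R x (vs[i := w])"
      using ev[OF V(3)] ev[OF V(4)] s v w by simp
    finally show ?thesis .
  qed
  have "R \<in> cochains M E A k"
    unfolding cochains_def mem_Collect_eq
  proof (intro conjI allI impI)
    fix x vs assume "\<not> (length vs = k \<and> set vs \<subseteq> fibre E x)"
    then show "R x vs = 0" by (auto simp: R_def)
  next
    fix x vs assume vs: "length vs = k \<and> set vs \<subseteq> fibre E x"
    define us where "us = map (s x) vs"
    have us: "length us = k" "set us \<subseteq> E.\<Gamma>" "map (\<lambda>u. u x) us = vs"
      using vs s by (auto simp: us_def intro!: map_idI)
    show "R x vs \<in> fibre A x"
      using R_eval[OF us(1,2), of x] us(3) A.sectionsD[OF cl[OF us(1,2)], of x] by simp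
    show "\<forall>v\<in>fibre E x. \<forall>w\<in>fibre E x. \<forall>c d.
        R x (vs[i := c *\<^sub>R v + d *\<^sub>R w]) = c *\<^sub>R R x (vs[i := v]) + d *\<^sub>R R x (vs[i := w])" if "i < k" for i
      using lin vs that by blast
    fix i j assume "i < k" "j < k" "i \<noteq> j \<and> vs ! i = vs ! j"
    then have "F us = 0"
      using alt[OF us(1,2), of i j] vs by (simp add: us_def)
    then show "R x vs = 0"
      using R_eval[OF us(1,2), of x] us(3) by simp
  next
    have "smooth_section_on M A U (\<lambda>x. R x (map (\<lambda>j. e j x) js))"
      if f: "(U, r, e) \<in> frames E" and js: "length js = k" "set js \<subseteq> {..<r}" for U r e js
    proof -
      define Rs where "Rs x = R x (map (\<lambda>j. e j x) js)" for x
      \<comment> \<open>Linearity is available one slot at a time, so the factors are pulled out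
        from right to left, with a mixed list as the intermediate stage.\<close>
      have scale: "R z (map (\<lambda>j. c *\<^sub>R e j z) ms @ map (\<lambda>j. e j z) ls) =
          c ^ length ms *\<^sub>R R z (map (\<lambda>j. e j z) (ms @ ls))"
        if "z \<in> U" "set ms \<subseteq> {..<r}" "set ls \<subseteq> {..<r}" "length ms + length ls = k" for z c ms ls
        using that(2-)
      proof (induction ms arbitrary: ls rule: rev_induct)
        case (snoc m ms)
        have fib: "e j z \<in> fibre E z" "c *\<^sub>R e j z \<in> fibre E z" if "j < r" for j
          using E.frame_in_fibre[OF f \<open>z \<in> U\<close> that] subspace_scale[OF E.fibre_subspace] by auto
        let ?vs = "map (\<lambda>j. c *\<^sub>R e j z) ms @ e m z # map (\<lambda>j. e j z) ls"
        have "R z (?vs[length ms := c *\<^sub>R e m z + 0 *\<^sub>R e m z]) =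
            c *\<^sub>R R z (?vs[length ms := e m z]) + 0 *\<^sub>R R z (?vs[length ms := e m z])"
          by (rule lin) (use snoc.prems fib in auto)
        then have "R z (map (\<lambda>j. c *\<^sub>R e j z) (ms @ [m]) @ map (\<lambda>j. e j z) ls) =
            c *\<^sub>R R z (map (\<lambda>j. c *\<^sub>R e j z) ms @ map (\<lambda>j. e j z) (m # ls))"
          by (simp add: list_update_append)
        also have "\<dots> = c *\<^sub>R c ^ length ms *\<^sub>R R z (map (\<lambda>j. e j z) (ms @ m # ls))"
          by (subst snoc.IH) (use snoc.prems in auto)
        finally show ?case by simp
      qed simp
      have loc: "\<exists>V. open V \<and> y \<in> V \<and> V \<subseteq> U \<and> smooth_section_on M A V Rs" if y: "y \<in> U" for y
      proof -
        obtain g K V where g: "g \<in> smooth_funs M" "closed K" "K \<subseteq> U" "\<And>y. y \<notin> K \<Longrightarrow> g y = 0"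
          and V: "open V" "y \<in> V" "\<And>z. z \<in> V \<Longrightarrow> g z \<noteq> 0"
          using E.bump[OF E.frame(1)[OF f] y] by metis
        have VU: "V \<subseteq> U" using V(3) g(3,4) by blast
        define t where "t j = (\<lambda>y. if y \<in> U then g y *\<^sub>R e j y else 0)" for j
        have t: "t j \<in> E.\<Gamma>" if "j < r" for j
          unfolding t_def by (rule E.section_extend[OF g E.frame(1)[OF f] E.frame(5)[OF f that]])
        have us: "length (map t js) = k" "set (map t js) \<subseteq> E.\<Gamma>"
          using js t by auto
        have gV: "smooth_fun_on M V g"
          using g(1) by (auto simp: smooth_funs_def intro: smooth_fun_on_subset)
        \<comment> \<open>Frame sections exist over \<open>U\<close> only, whereas \<open>F\<close>
          takes global sections. Multiplying each of the k arguments by g changes the value by g^k,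
          which is divided out where g does not vanish.\<close>
        have "smooth_section_on M A V (\<lambda>z. inverse (g z ^ k) *\<^sub>R F (map t js) z)"
        proof (intro A.smooth_section_on_smult E.smooth_fun_on_inverse E.smooth_fun_on_power V(1) gV)
          show "g z ^ k \<noteq> 0" if "z \<in> V" for z using V(3)[OF that] by simp
          show "smooth_section_on M A V (F (map t js))"
            using cl[OF us] by (auto simp: sections_def intro: smooth_section_on_subset)
        qed
        then have "smooth_section_on M A V Rs"
        proof (rule smooth_section_on_cong)
          fix z assume z: "z \<in> V"
          then have "z \<in> U" using VU by blast
          then have "F (map t js) z = g z ^ k *\<^sub>R Rs z"
            using R_eval[OF us, of z] scale[of z js "[]" "g z"] js by (simp add: t_def Rs_def o_def)
          then show "inverse (g z ^ k) *\<^sub>R F (map t js) z = Rs z"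
            using V(3)[OF z] by simp
        qed
        then show ?thesis using V VU by blast
      qed
      have "smooth_section_on M A (\<Union>{V. open V \<and> V \<subseteq> U \<and> smooth_section_on M A V Rs}) Rs"
        by (rule A.smooth_section_on_Union) auto
      moreover have "\<Union>{V. open V \<and> V \<subseteq> U \<and> smooth_section_on M A V Rs} = U"
        using loc by blast
      ultimately show ?thesis by (simp add: Rs_def[abs_def])
    qed
    then show "\<forall>(U, r, e)\<in>frames E. \<forall>js. length js = k \<and> set js \<subseteq> {..<r} \<longrightarrow>
        smooth_section_on M A U (\<lambda>x. R x (map (\<lambda>j. e j x) js))"
      by blast
  qed
  then show ?thesis
    using R_eval by (intro bexI[of _ R]) (auto simp: eval_cochain_def)
qed

end

section \<open>The bracket on cochains\<close>

lemma fun_smult_apply: "(f \<cdot>\<^sub>C u) x = f x *\<^sub>R u x"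
  by (simp add: fun_smult_def)

lemma fun_smult_linear:
  "f \<cdot>\<^sub>C (u + v) = f \<cdot>\<^sub>C u + f \<cdot>\<^sub>C v" "f \<cdot>\<^sub>C (u - v) = f \<cdot>\<^sub>C u - f \<cdot>\<^sub>C v"
  "f \<cdot>\<^sub>C (c *\<^sub>R u) = c *\<^sub>R (f \<cdot>\<^sub>C u)" "f \<cdot>\<^sub>C 0 = 0"
  by (auto simp: fun_eq_iff fun_smult_apply scaleR_fun_apply algebra_simps)

lemma fun_smult_zero: "(\<lambda>x. 0) \<cdot>\<^sub>C u = 0"
  by (simp add: fun_eq_iff fun_smult_apply)

lemma fun_smult_sum: "f \<cdot>\<^sub>C (\<Sum>i\<in>I. u i) = (\<Sum>i\<in>I. f \<cdot>\<^sub>C u i)"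
  by (induction I rule: infinite_finite_induct) (simp_all only: sum.insert sum.empty sum.infinite fun_smult_linear not_False_eq_True)

lemma alt_smult:
  assumes "\<And>v j. length v = length w \<Longrightarrow> set v = set w \<Longrightarrow> j < length w \<Longrightarrow> F (v[j := f \<cdot>\<^sub>C u]) = f \<cdot>\<^sub>C F (v[j := u])"
    and "i < length w"
  shows "alt F (w[i := f \<cdot>\<^sub>C u]) = f \<cdot>\<^sub>C alt F (w[i := u])"
proof -
  have "F ((permute_list \<sigma> w)[inv \<sigma> i := f \<cdot>\<^sub>C u]) = f \<cdot>\<^sub>C F ((permute_list \<sigma> w)[inv \<sigma> i := u])"
    if "\<sigma> permutes {..<length w}" for \<sigma>
    by (rule assms(1)) (use that assms(2) inv_permutes_less in auto)
  then show ?thesis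
    unfolding alt_update[OF assms(2)] fun_smult_sum fun_smult_linear
    by (intro sum.cong) simp_all
qed

lemma eval_cochain_update:
  "eval_cochain P (us[i := u]) x = P x ((map (\<lambda>u. u x) us)[i := u x])"
  by (simp add: eval_cochain_def map_update)

context two_bundles
begin

lemma eval_fibre: "set us \<subseteq> E.\<Gamma> \<Longrightarrow> set (map (\<lambda>u. u x) us) \<subseteq> fibre E x"
  using E.sectionsD by auto

lemma eval_smult_add:
  assumes P: "P \<in> cochains M E A k" and us: "length us = k" "set us \<subseteq> E.\<Gamma>" and i: "i < k"
    and u: "u \<in> E.\<Gamma>" "v \<in> E.\<Gamma>"
  shows "eval_cochain P (us[i := f \<cdot>\<^sub>C u + g \<cdot>\<^sub>C v]) = f \<cdot>\<^sub>C eval_cochain P (us[i := u]) + g \<cdot>\<^sub>C eval_cochain P (us[i := v])"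
proof
  fix x
  show "eval_cochain P (us[i := f \<cdot>\<^sub>C u + g \<cdot>\<^sub>C v]) x = (f \<cdot>\<^sub>C eval_cochain P (us[i := u]) + g \<cdot>\<^sub>C eval_cochain P (us[i := v])) x"
    unfolding plus_fun_apply fun_smult_apply eval_cochain_update
    by (rule cochainsD(3)[OF P]) (use us i u E.sectionsD in auto)
qed

lemma eval_smult:
  assumes P: "P \<in> cochains M E A k" and us: "length us = k" "set us \<subseteq> E.\<Gamma>" and i: "i < k" and u: "u \<in> E.\<Gamma>"
  shows "eval_cochain P (us[i := f \<cdot>\<^sub>C u]) = f \<cdot>\<^sub>C eval_cochain P (us[i := u])"
  using eval_smult_add[OF P us i u u, of f "\<lambda>x. 0"] unfolding fun_smult_zero add_0_right .

lemma cochainsI: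
  assumes "\<And>x vs. \<not> (length vs = k \<and> set vs \<subseteq> fibre E x) \<Longrightarrow> P x vs = 0"
    "\<And>x vs. length vs = k \<Longrightarrow> set vs \<subseteq> fibre E x \<Longrightarrow> P x vs \<in> fibre A x"
    "\<And>x vs i v w c d. length vs = k \<Longrightarrow> set vs \<subseteq> fibre E x \<Longrightarrow> i < k \<Longrightarrow> v \<in> fibre E x \<Longrightarrow> w \<in> fibre E x \<Longrightarrow>
      P x (vs[i := c *\<^sub>R v + d *\<^sub>R w]) = c *\<^sub>R P x (vs[i := v]) + d *\<^sub>R P x (vs[i := w])"
    "\<And>x vs i j. length vs = k \<Longrightarrow> set vs \<subseteq> fibre E x \<Longrightarrow> i < k \<Longrightarrow> j < k \<Longrightarrow> i \<noteq> j \<Longrightarrow> vs ! i = vs ! j \<Longrightarrow> P x vs = 0"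
    "\<And>U r e js. (U, r, e) \<in> frames E \<Longrightarrow> length js = k \<Longrightarrow> set js \<subseteq> {..<r} \<Longrightarrow>
      smooth_section_on M A U (\<lambda>x. P x (map (\<lambda>j. e j x) js))"
  shows "P \<in> cochains M E A k"
  unfolding cochains_def mem_Collect_eq
proof (intro conjI allI impI ballI)
  fix z assume "z \<in> frames E"
  then show "case z of (U, r, e) \<Rightarrow> \<forall>js. length js = k \<and> set js \<subseteq> {..<r} \<longrightarrow>
      smooth_section_on M A U (\<lambda>x. P x (map (\<lambda>j. e j x) js))"
    using assms(5) by (cases z) simp
next
  fix x vs i j assume "length vs = k \<and> set vs \<subseteq> fibre E x" "i < k" "j < k" "i \<noteq> j \<and> vs ! i = vs ! j"
  then show "P x vs = 0" using assms(4)[of vs x i j] by simp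
qed (use assms(1-3) in blast)+

lemma subspace_cochains: "subspace (cochains M E A k)"
proof -
  have lin: "c *\<^sub>R P + d *\<^sub>R Q \<in> cochains M E A k" if P: "P \<in> cochains M E A k" and Q: "Q \<in> cochains M E A k" for c d P Q
  proof (rule cochainsI, unfold plus_fun_apply scaleR_fun_apply, goal_cases)
    case (1 x vs)
    show ?case unfolding cochainsD(1)[OF P 1] cochainsD(1)[OF Q 1] by simp
  next
    case (2 x vs)
    show ?case
      using cochainsD(2)[OF P 2] cochainsD(2)[OF Q 2] A.fibre_subspace
      by (simp add: subspace_add subspace_scale)
  next
    case (3 x vs i v w c d)
    show ?case unfolding cochainsD(3)[OF P 3] cochainsD(3)[OF Q 3] by (simp add: algebra_simps)
  next
    case (4 x vs i j)
    show ?case unfolding cochainsD(4)[OF P 4] cochainsD(4)[OF Q 4] by simp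
  next
    case (5 U r e js)
    show ?case
      by (intro A.smooth_section_on_add A.smooth_section_on_smult smooth_fun_on_const
          cochainsD(5)[OF P 5] cochainsD(5)[OF Q 5] E.frame(1)[OF 5(1)])
  qed
  have "0 \<in> cochains M E A k"
    by (rule cochainsI) (simp_all add: A.smooth_section_on_zero subspace_0[OF A.fibre_subspace])
  then show ?thesis
    using lin[of _ _ 1 1] lin[where d = 0] by (intro subspaceI) fastforce+
qed

lemma degree_part_cochain:
  assumes "P \<in> cochains M E A n"
  shows "degree_part k P = (if k = n then P else 0)"
  using cochainsD(1)[OF assms] by (auto simp: degree_part_def fun_eq_iff)

lemma degree_part_linear:
  "degree_part k (c *\<^sub>R P + d *\<^sub>R Q) = c *\<^sub>R degree_part k P + d *\<^sub>R degree_part k (Q :: 'm \<Rightarrow> 'e list \<Rightarrow> 'a)"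
  by (auto simp: degree_part_def fun_eq_iff scaleR_fun_apply)

lemma degree_part_sum: "degree_part k (\<Sum>j\<in>J. P j) = (\<Sum>j\<in>J. degree_part k (P j :: 'm \<Rightarrow> 'e list \<Rightarrow> 'a))"
  by (auto simp: degree_part_def fun_eq_iff sum_fun_apply)

text \<open>Degrees are read off from list lengths, so \<open>degree_part\<close> projects onto the
  homogeneous parts. On the direct sum the index sets in \<open>cochain_bracket\<close> are thus
  finite.\<close>

lemma span_cochains_degree_part:
  assumes "P \<in> span (\<Union>k. cochains M E A k)"
  shows "finite {k. degree_part k P \<noteq> 0} \<and> (\<forall>k. degree_part k P \<in> cochains M E A k)"
  using assms
proof (induction rule: span_induct_alt)
  case base
  have z: "degree_part k 0 = (0 :: 'm \<Rightarrow> 'e list \<Rightarrow> 'a)" for k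
    by (auto simp: degree_part_def fun_eq_iff)
  show ?case
    unfolding z by (intro conjI allI subspace_0[OF subspace_cochains]) simp
next
  case (step c P Q)
  then obtain n where P: "P \<in> cochains M E A n" by blast
  have eq: "degree_part k (c *\<^sub>R P + Q) = c *\<^sub>R degree_part k P + degree_part k Q" for k
    using degree_part_linear[of k c P 1 Q] by simp
  have "{k. degree_part k (c *\<^sub>R P + Q) \<noteq> 0} \<subseteq> insert n {k. degree_part k Q \<noteq> 0}"
    unfolding eq degree_part_cochain[OF P] by auto
  moreover have "degree_part k P \<in> cochains M E A k" for k
    using P subspace_0[OF subspace_cochains] by (simp add: degree_part_cochain)
  ultimately show ?case
    using step.IH unfolding eq
    by (meson finite_insert finite_subset subspace_add subspace_cochains subspace_scale)
qed

end

section \<open>Congruence and linearity of the antisymmetrised bracket\<close>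

context lie_representation
begin

lemma der_cong:
  assumes "lin \<phi>" "set a \<subseteq> V" "\<And>ws. length ws = length a \<Longrightarrow> set ws \<subseteq> V \<Longrightarrow> F ws = G ws"
  shows "der F \<phi> a = der G \<phi> a"
  unfolding der_def using set_update_lin[OF assms(1,2)] by (intro sum.cong assms(3)) auto

text \<open>The evaluation of a homogeneous bracket is known to be \<open>bf\<close> on lists of
  sections of the right length; this allows the substitution inside an outer
  \<open>bf\<close>.\<close>

lemma bf_cong:
  assumes P: "gvalued n P" and Q: "gvalued m Q" and w: "length w = m + n" "set w \<subseteq> V"
    and eqP: "\<And>ws. length ws = n \<Longrightarrow> set ws \<subseteq> V \<Longrightarrow> P ws = P' ws"
    and eqQ: "\<And>ws. length ws = m \<Longrightarrow> set ws \<subseteq> V \<Longrightarrow> Q ws = Q' ws"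
  shows "bf n m P Q w = bf n m P' Q' w"
proof -
  have "alt (pb m P Q) w = alt (pb m P' Q') w"
  proof (rule alt_cong_V[OF w(2)])
    fix v assume "length v = length w" "set v \<subseteq> V"
    then obtain b a where v: "v = b @ a" "length b = m" "length a = n" "set b \<subseteq> V" "set a \<subseteq> V"
      using pb_split w(1) by metis
    have g: "P a \<in> \<gg>" "Q b \<in> \<gg>"
      using gvaluedD[OF P v(3,5)] gvaluedD[OF Q v(2,4)] .
    have "der P (r (Q b)) a = der P' (r (Q b)) a"
      by (rule der_cong[OF lin_r[OF g(2)] v(5)]) (use v eqP in simp)
    moreover have "der Q (r (P a)) b = der Q' (r (P a)) b"
      by (rule der_cong[OF lin_r[OF g(1)] v(4)]) (use v eqQ in simp)
    ultimately show "pb m P Q v = pb m P' Q' v"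
      using v eqP[of a] eqQ[of b] by (simp add: pb_append)
  qed
  then show ?thesis by (simp add: bf_def)
qed

lemma bf_linear_left:
  assumes P: "multilin n P" "multilin n P'" and Q: "multilin m Q" and w: "length w = m + n" "set w \<subseteq> V"
  shows "bf n m (\<lambda>ws. c *\<^sub>R P ws + d *\<^sub>R P' ws) Q w = c *\<^sub>R bf n m P Q w + d *\<^sub>R bf n m P' Q w"
proof -
  have "alt (pb m (\<lambda>ws. c *\<^sub>R P ws + d *\<^sub>R P' ws) Q) w = alt (\<lambda>v. c *\<^sub>R pb m P Q v + d *\<^sub>R pb m P' Q v) w"
  proof (rule alt_cong_V[OF w(2)])
    fix v assume "length v = length w" "set v \<subseteq> V"
    then obtain b a where v: "v = b @ a" "length b = m" "length a = n" "set b \<subseteq> V" "set a \<subseteq> V"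
      using pb_split w(1) by metis
    have g: "P a \<in> \<gg>" "P' a \<in> \<gg>" "Q b \<in> \<gg>"
      using v P Q by (auto intro: gvaluedD multilin_gvalued)
    have "der (\<lambda>ws. c *\<^sub>R P ws + d *\<^sub>R P' ws) (r (Q b)) a = c *\<^sub>R der P (r (Q b)) a + d *\<^sub>R der P' (r (Q b)) a"
      by (simp add: der_def sum.distrib scaleR_sum_right)
    then show "pb m (\<lambda>ws. c *\<^sub>R P ws + d *\<^sub>R P' ws) Q v = c *\<^sub>R pb m P Q v + d *\<^sub>R pb m P' Q v"
      using v g Q by (simp add: pb_append br_linear der_r_linear algebra_simps)
  qed
  then show ?thesis
    by (simp add: bf_def alt_add alt_scaleR algebra_simps)
qed

end

section \<open>LieRep pairs and C^infty-linearity\<close>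

locale lie_rep =
  fixes M :: "'m::{t2_space, second_countable_topology} manifold"
    and A :: "('m, 'a::real_vector) vbundle"
    and br :: "('m \<Rightarrow> 'a) \<Rightarrow> ('m \<Rightarrow> 'a) \<Rightarrow> ('m \<Rightarrow> 'a)"
    and an :: "'m \<Rightarrow> 'a \<Rightarrow> ('m \<Rightarrow> real) \<Rightarrow> real"
    and E :: "('m, 'e::real_vector) vbundle"
    and \<rho> :: "'m \<Rightarrow> 'a \<Rightarrow> ('m \<Rightarrow> 'e) \<Rightarrow> 'e"
  assumes smooth_M: "smooth_manifold M"
    and pair: "lie_rep_pair M A br an E \<rho>"
begin

sublocale two_bundles M E A
  using smooth_M pair by unfold_locales (auto simp: lie_rep_pair_def lie_algebroid_def)

lemma algebroid: "lie_algebroid M A br an"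
  and rep: "lie_algebroid_rep M A br an E \<rho>"
  using pair by (auto simp: lie_rep_pair_def)

lemma cdo: "a \<in> A.\<Gamma> \<Longrightarrow> covariant_diff_op M E (rep_op \<rho> a) (on_sections an a)"
  using rep by (simp add: lie_algebroid_rep_def)

lemma rho_linear:
  "a \<in> fibre A x \<Longrightarrow> b \<in> fibre A x \<Longrightarrow> u \<in> E.\<Gamma> \<Longrightarrow> \<rho> x (c *\<^sub>R a + d *\<^sub>R b) u = c *\<^sub>R \<rho> x a u + d *\<^sub>R \<rho> x b u"
  using rep by (simp add: lie_algebroid_rep_def)

sublocale L: lie_representation "sections M A" br "sections M E" "rep_op \<rho>"
proof
  show "lie_algebra_on A.\<Gamma> br" using algebroid by (simp add: lie_algebroid_def)
  show "subspace E.\<Gamma>" by (rule E.subspace_sections)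
  fix x assume x: "x \<in> A.\<Gamma>"
  note D = cdo[OF x, unfolded covariant_diff_op_def]
  fix v assume v: "v \<in> E.\<Gamma>"
  show "rep_op \<rho> x v \<in> E.\<Gamma>" using D v by blast
  show "rep_op \<rho> x (c *\<^sub>R v + d *\<^sub>R w) = c *\<^sub>R rep_op \<rho> x v + d *\<^sub>R rep_op \<rho> x w" if "w \<in> E.\<Gamma>" for w c d
    using D v that by blast
  fix y assume y: "y \<in> A.\<Gamma>"
  show "rep_op \<rho> (c *\<^sub>R x + d *\<^sub>R y) v = c *\<^sub>R rep_op \<rho> x v + d *\<^sub>R rep_op \<rho> y v" for c d
    using rho_linear[OF A.sectionsD[OF x] A.sectionsD[OF y] v]
    by (simp add: fun_eq_iff rep_op_def scaleR_fun_apply)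
  show "rep_op \<rho> (br x y) v = rep_op \<rho> x (rep_op \<rho> y v) - rep_op \<rho> y (rep_op \<rho> x v)"
    using rep x y v by (simp add: lie_algebroid_rep_def)
qed

abbreviation X :: "('m \<Rightarrow> 'a) \<Rightarrow> ('m \<Rightarrow> real) \<Rightarrow> 'm \<Rightarrow> real" where
  "X a f \<equiv> apply_field (on_sections an a) f"

lemma rep_smult_left:
  assumes "a \<in> A.\<Gamma>" "u \<in> E.\<Gamma>"
  shows "rep_op \<rho> (f \<cdot>\<^sub>C a) u = f \<cdot>\<^sub>C rep_op \<rho> a u"
proof
  fix x
  show "rep_op \<rho> (f \<cdot>\<^sub>C a) u x = (f \<cdot>\<^sub>C rep_op \<rho> a u) x"
    using rho_linear[OF A.sectionsD[OF assms(1)] A.sectionsD[OF assms(1)] assms(2), where x = x and c = "f x" and d = 0]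
    by (simp add: rep_op_def fun_smult_apply)
qed

lemma rep_leibniz:
  "a \<in> A.\<Gamma> \<Longrightarrow> u \<in> E.\<Gamma> \<Longrightarrow> f \<in> smooth_funs M \<Longrightarrow> rep_op \<rho> a (f \<cdot>\<^sub>C u) = f \<cdot>\<^sub>C rep_op \<rho> a u + X a f \<cdot>\<^sub>C u"
  using cdo[of a] by (simp add: covariant_diff_op_def)

lemma br_leibniz:
  assumes "f \<in> smooth_funs M" "a \<in> A.\<Gamma>" "b \<in> A.\<Gamma>"
  shows "br a (f \<cdot>\<^sub>C b) = f \<cdot>\<^sub>C br a b + X a f \<cdot>\<^sub>C b"
    "br (f \<cdot>\<^sub>C a) b = f \<cdot>\<^sub>C br a b - X b f \<cdot>\<^sub>C a"
proof -
  have 1: "br a (f \<cdot>\<^sub>C b) = f \<cdot>\<^sub>C br a b + X a f \<cdot>\<^sub>C b" if "a \<in> A.\<Gamma>" "b \<in> A.\<Gamma>" for a b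
    using algebroid assms(1) that by (simp add: lie_algebroid_def)
  then show "br a (f \<cdot>\<^sub>C b) = f \<cdot>\<^sub>C br a b + X a f \<cdot>\<^sub>C b"
    using assms by blast
  have "br (f \<cdot>\<^sub>C a) b = - br b (f \<cdot>\<^sub>C a)"
    by (rule L.br_skew[OF assms(3) A.smult_section[OF assms(1,2)]])
  also have "\<dots> = - (f \<cdot>\<^sub>C br b a + X b f \<cdot>\<^sub>C a)"
    by (simp only: 1[OF assms(3,2)])
  also have "br b a = - br a b" by (rule L.br_skew[OF assms(2,3)])
  finally have *: "br (f \<cdot>\<^sub>C a) b = - (f \<cdot>\<^sub>C - br a b + X b f \<cdot>\<^sub>C a)" .
  show "br (f \<cdot>\<^sub>C a) b = f \<cdot>\<^sub>C br a b - X b f \<cdot>\<^sub>C a"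
    unfolding * by (simp add: fun_eq_iff fun_smult_apply)
qed

lemma multilin_eval:
  assumes P: "P \<in> cochains M E A k"
  shows "L.multilin k (eval_cochain P)"
  unfolding L.multilin_def
proof (intro allI impI conjI ballI; elim conjE)
  fix ws assume ws: "length ws = k" "set ws \<subseteq> E.\<Gamma>"
  show "eval_cochain P ws \<in> A.\<Gamma>" by (rule eval_cochain_section[OF P ws])
  show "eval_cochain P (ws[i := c *\<^sub>R v + d *\<^sub>R w]) = c *\<^sub>R eval_cochain P (ws[i := v]) + d *\<^sub>R eval_cochain P (ws[i := w])"
    if "i < k" "v \<in> E.\<Gamma>" "w \<in> E.\<Gamma>" for i v w c d
    using eval_smult_add[OF P ws that, of "\<lambda>x. c" "\<lambda>x. d"] unfolding E.smult_const A.smult_const .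
qed

lemma asym_eval:
  assumes P: "P \<in> cochains M E A k"
  shows "L.asym k (eval_cochain P)"
  unfolding L.asym_def
proof (intro allI impI; elim conjE)
  fix ws i j assume ws: "length ws = k" "set ws \<subseteq> E.\<Gamma>" "i < k" "j < k" "i \<noteq> j" "ws ! i = ws ! j"
  have "P x (map (\<lambda>u. u x) ws) = 0" for x
    by (rule cochainsD(4)[OF P, of _ _ i j]) (use ws eval_fibre in auto)
  then show "eval_cochain P ws = 0" by (simp add: eval_cochain_def fun_eq_iff)
qed

lemma gvalued_eval: "P \<in> cochains M E A k \<Longrightarrow> L.gvalued k (eval_cochain P)"
  by (rule L.multilin_gvalued[OF multilin_eval])

text \<open>The Leibniz rule adds a derivative of f only in the summand where the operator acts on
  slot i itself; the other summands are C^infty-linear in that slot.\<close>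

lemma der_smult:
  assumes P: "P \<in> cochains M E A k" and us: "length us = k" "set us \<subseteq> E.\<Gamma>" and i: "i < k"
    and u: "u \<in> E.\<Gamma>" and f: "f \<in> smooth_funs M" and a: "a \<in> A.\<Gamma>"
  shows "der (eval_cochain P) (rep_op \<rho> a) (us[i := f \<cdot>\<^sub>C u]) =
    f \<cdot>\<^sub>C der (eval_cochain P) (rep_op \<rho> a) (us[i := u]) + X a f \<cdot>\<^sub>C eval_cochain P (us[i := u])"
proof -
  let ?G = "eval_cochain P" and ?\<phi> = "rep_op \<rho> a"
  have "?G (us[i := f \<cdot>\<^sub>C u, j := ?\<phi> (us[i := f \<cdot>\<^sub>C u] ! j)]) =
      f \<cdot>\<^sub>C ?G (us[i := u, j := ?\<phi> (us[i := u] ! j)]) + (if j = i then X a f \<cdot>\<^sub>C ?G (us[i := u]) else 0)"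
    if j: "j < k" for j
  proof (cases "j = i")
    case True
    then show ?thesis
      using us i by (simp add: rep_leibniz[OF a u f] eval_smult_add[OF P us i L.r_closed[OF a u] u])
  next
    case False
    have V: "set (us[j := ?\<phi> (us ! j)]) \<subseteq> E.\<Gamma>"
      by (rule L.set_update_lin[OF L.lin_r[OF a] us(2)]) (use j us in simp)
    show ?thesis
      using False us j i eval_smult[OF P _ V i u, of f] by (simp add: list_update_swap[of i j])
  qed
  then have "der ?G ?\<phi> (us[i := f \<cdot>\<^sub>C u]) =
      (\<Sum>j<k. f \<cdot>\<^sub>C ?G (us[i := u, j := ?\<phi> (us[i := u] ! j)]) + (if j = i then X a f \<cdot>\<^sub>C ?G (us[i := u]) else 0))"
    unfolding der_def using us by (intro sum.cong) auto
  also have "\<dots> = f \<cdot>\<^sub>C der ?G ?\<phi> (us[i := u]) + X a f \<cdot>\<^sub>C ?G (us[i := u])"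
    unfolding der_def fun_smult_sum sum.distrib using us i by (simp add: sum.delta)
  finally show ?thesis .
qed

lemma der_smult_op:
  assumes P: "P \<in> cochains M E A k" and us: "length us = k" "set us \<subseteq> E.\<Gamma>" and a: "a \<in> A.\<Gamma>"
  shows "der (eval_cochain P) (rep_op \<rho> (f \<cdot>\<^sub>C a)) us = f \<cdot>\<^sub>C der (eval_cochain P) (rep_op \<rho> a) us"
  unfolding der_def fun_smult_sum
proof (rule sum.cong[OF refl])
  fix j assume "j \<in> {..<length us}"
  then have j: "j < k" "us ! j \<in> E.\<Gamma>" using us by (auto simp: subset_iff)
  show "eval_cochain P (us[j := rep_op \<rho> (f \<cdot>\<^sub>C a) (us ! j)]) = f \<cdot>\<^sub>C eval_cochain P (us[j := rep_op \<rho> a (us ! j)])"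
    unfolding rep_smult_left[OF a j(2)] by (rule eval_smult[OF P us j(1) L.r_closed[OF a j(2)]])
qed

text \<open>The terms containing a derivative of \<open>f\<close> cancel.\<close>

lemma pb_smult:
  assumes P: "P \<in> cochains M E A n" and Q: "Q \<in> cochains M E A m"
    and w: "length w = m + n" "set w \<subseteq> E.\<Gamma>" and i: "i < m + n" and u: "u \<in> E.\<Gamma>" and f: "f \<in> smooth_funs M"
  shows "L.pb m (eval_cochain P) (eval_cochain Q) (w[i := f \<cdot>\<^sub>C u]) =
    f \<cdot>\<^sub>C L.pb m (eval_cochain P) (eval_cochain Q) (w[i := u])"
proof -
  let ?G = "eval_cochain P" and ?H = "eval_cochain Q"
  obtain b a where v: "w = b @ a" "length b = m" "length a = n" "set b \<subseteq> E.\<Gamma>" "set a \<subseteq> E.\<Gamma>"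
    by (rule L.pb_split[OF w])
  show ?thesis
  proof (cases "i < m")
    case True
    have a: "?G a \<in> A.\<Gamma>" and b: "?H (b[i := u]) \<in> A.\<Gamma>"
      using eval_cochain_section[OF P v(3,5)] eval_cochain_section[OF Q _ L.set_update_V[OF v(4) u]] v(2) by auto
    \<comment> \<open>In a slot of \<open>Q\<close> the derivative of f along \<open>P a\<close>
      comes from the \<open>der\<close> term of \<open>Q\<close> and from \<open>br\<close>, with
      opposite signs. In the \<open>der\<close> term of \<open>P\<close> the function enters through
      the operator, where \<rho> is pointwise linear.\<close>
    show ?thesis
      unfolding v(1) list_update_append using True v(2)
      by (simp add: L.pb_append eval_smult[OF Q v(2,4) True u] der_smult_op[OF P v(3,5) b]
          der_smult[OF Q v(2,4) True u f a] br_leibniz(1)[OF f a b] fun_smult_linear)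
  next
    case False
    define l where "l = i - m"
    have l: "l < n" "i = m + l" using False i by (auto simp: l_def)
    have a: "?G (a[l := u]) \<in> A.\<Gamma>" and b: "?H b \<in> A.\<Gamma>"
      using eval_cochain_section[OF Q v(2,4)] eval_cochain_section[OF P _ L.set_update_V[OF v(5) u]] v(3) by auto
    \<comment> \<open>In a slot of \<open>P\<close> the derivative of f is along \<open>Q b\<close>,
      with a plus sign from the \<open>der\<close> term of \<open>P\<close> and a minus sign from
      the left argument of \<open>br\<close>.\<close>
    show ?thesis
      unfolding v(1) list_update_append using l v(2)
      by (simp add: L.pb_append eval_smult[OF P v(3,5) l(1) u] der_smult_op[OF Q v(2,4) a]
          der_smult[OF P v(3,5) l(1) u f b] br_leibniz(2)[OF f a b] fun_smult_linear)
  qed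
qed

section \<open>The bracket as an operation on cochains\<close>

abbreviation "hb \<equiv> homogeneous_bracket M A br E \<rho>"
abbreviation "cbr \<equiv> cochain_bracket M A br E \<rho>"
abbreviation "Co \<equiv> cochains M E A"

lemma bracket_formula_eq:
  assumes P: "P \<in> Co n" and Q: "Q \<in> Co m" and us: "length us = m + n" "set us \<subseteq> E.\<Gamma>"
  shows "bracket_formula br \<rho> n m P Q us = L.bf n m (eval_cochain P) (eval_cochain Q) us"
  using L.bracket_formula_bf[OF multilin_eval[OF P] asym_eval[OF P] multilin_eval[OF Q] asym_eval[OF Q] us]
  unfolding bracket_formula_def insertion_sum_def L.ins_def by (simp only: add.commute[of n m])

lemma exists_bracket:
  assumes P: "P \<in> Co n" and Q: "Q \<in> Co m"
  shows "\<exists>R\<in>Co (n + m). \<forall>us. length us = n + m \<and> set us \<subseteq> E.\<Gamma> \<longrightarrow>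
    eval_cochain R us = L.bf n m (eval_cochain P) (eval_cochain Q) us"
proof -
  let ?F = "L.bf n m (eval_cochain P) (eval_cochain Q)"
  have ml: "L.multilin (n + m) ?F"
    unfolding L.bf_def[abs_def]
    using L.multilin_scaleR[OF L.multilin_alt[OF L.multilin_pb[OF multilin_eval[OF P] multilin_eval[OF Q]]]]
    by (simp only: add.commute)
  show ?thesis
  proof (rule tensorial_imp_cochain)
    show "?F us \<in> A.\<Gamma>" if "length us = n + m" "set us \<subseteq> E.\<Gamma>" for us
      using L.gvaluedD[OF L.multilin_gvalued[OF ml] that] .
    show "?F (us[i := u + v]) = ?F (us[i := u]) + ?F (us[i := v])"
      if "length us = n + m" "set us \<subseteq> E.\<Gamma>" "i < n + m" "u \<in> E.\<Gamma>" "v \<in> E.\<Gamma>" for us i u v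
      using L.multilinD[OF ml that, of 1 1] unfolding scaleR_one .
    show "?F (us[i := f \<cdot>\<^sub>C u]) = f \<cdot>\<^sub>C ?F (us[i := u])"
      if us: "length us = n + m" "set us \<subseteq> E.\<Gamma>" "i < n + m" "u \<in> E.\<Gamma>" "f \<in> smooth_funs M" for us i u f
    proof -
      have "alt (L.pb m (eval_cochain P) (eval_cochain Q)) (us[i := f \<cdot>\<^sub>C u]) =
          f \<cdot>\<^sub>C alt (L.pb m (eval_cochain P) (eval_cochain Q)) (us[i := u])"
        by (rule alt_smult, rule pb_smult[OF P Q]) (use us in auto)
      then show ?thesis unfolding L.bf_def fun_smult_linear by simp
    qed
    show "?F us = 0" if "length us = n + m" "i < n + m" "j < n + m" "i \<noteq> j" "us ! i = us ! j" for us i j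
      using alt_eq_nth[of i us j] that by (simp add: L.bf_def)
  qed
qed

text \<open>Existence together with \<open>cochain_eqI\<close> shows that the description in
  \<open>homogeneous_bracket\<close> has exactly one solution. Afterwards the bracket is handled
  through its values \<open>bf\<close> on sections.\<close>

lemma hb:
  assumes P: "P \<in> Co n" and Q: "Q \<in> Co m"
  shows "hb n m P Q \<in> Co (n + m)"
    "length us = n + m \<Longrightarrow> set us \<subseteq> E.\<Gamma> \<Longrightarrow>
      eval_cochain (hb n m P Q) us = L.bf n m (eval_cochain P) (eval_cochain Q) us"
proof -
  let ?p = "\<lambda>R. R \<in> Co (n + m) \<and> (\<forall>us. length us = m + n \<and> set us \<subseteq> E.\<Gamma> \<longrightarrow>
      eval_cochain R us = bracket_formula br \<rho> n m P Q us)"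
  obtain R where "R \<in> Co (n + m)" "\<And>us. length us = n + m \<Longrightarrow> set us \<subseteq> E.\<Gamma> \<Longrightarrow>
      eval_cochain R us = L.bf n m (eval_cochain P) (eval_cochain Q) us"
    using exists_bracket[OF P Q] by blast
  then have "?p R" using bracket_formula_eq[OF P Q] by (simp add: add.commute)
  moreover have "R' = R" if "?p R'" for R'
    using that \<open>?p R\<close> by (intro cochain_eqI[of R' "n + m"]) (auto simp: add.commute)
  ultimately have "?p (THE R. ?p R)"
    by (rule theI)
  then have *: "?p (hb n m P Q)" unfolding homogeneous_bracket_def .
  then show "hb n m P Q \<in> Co (n + m)" by blast
  show "length us = n + m \<Longrightarrow> set us \<subseteq> E.\<Gamma> \<Longrightarrow>
      eval_cochain (hb n m P Q) us = L.bf n m (eval_cochain P) (eval_cochain Q) us"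
    using * bracket_formula_eq[OF P Q] by (simp add: add.commute)
qed

lemma eval_linear: "eval_cochain (c *\<^sub>R P + d *\<^sub>R Q) us = c *\<^sub>R eval_cochain P us + d *\<^sub>R eval_cochain (Q :: 'm \<Rightarrow> 'e list \<Rightarrow> 'a) us"
  by (simp add: eval_cochain_def fun_eq_iff scaleR_fun_apply)

lemma Co_linear: "P \<in> Co n \<Longrightarrow> Q \<in> Co n \<Longrightarrow> c *\<^sub>R P + d *\<^sub>R Q \<in> Co n"
  by (simp add: subspace_add subspace_scale subspace_cochains)

lemma hb_linear_left:
  assumes P: "P \<in> Co n" "P' \<in> Co n" and Q: "Q \<in> Co m"
  shows "hb n m (c *\<^sub>R P + d *\<^sub>R P') Q = c *\<^sub>R hb n m P Q + d *\<^sub>R hb n m P' Q"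
proof (rule cochain_eqI)
  note PP = Co_linear[OF P, of c d]
  show "hb n m (c *\<^sub>R P + d *\<^sub>R P') Q \<in> Co (n + m)" by (rule hb(1)[OF PP Q])
  show "c *\<^sub>R hb n m P Q + d *\<^sub>R hb n m P' Q \<in> Co (n + m)"
    by (rule Co_linear[OF hb(1)[OF P(1) Q] hb(1)[OF P(2) Q]])
  fix us assume us: "length us = n + m" "set us \<subseteq> E.\<Gamma>"
  then have us': "length us = m + n" by simp
  show "eval_cochain (hb n m (c *\<^sub>R P + d *\<^sub>R P') Q) us = eval_cochain (c *\<^sub>R hb n m P Q + d *\<^sub>R hb n m P' Q) us"
    unfolding hb(2)[OF PP Q us] eval_linear hb(2)[OF P(1) Q us] hb(2)[OF P(2) Q us] eval_linear[abs_def]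
    by (rule L.bf_linear_left[OF multilin_eval[OF P(1)] multilin_eval[OF P(2)] multilin_eval[OF Q] us' us(2)])
qed

lemma hb_skew:
  assumes P: "P \<in> Co n" and Q: "Q \<in> Co m"
  shows "hb n m P Q = - ((-1) ^ (n * m) *\<^sub>R hb m n Q P)"
proof -
  have QP: "hb m n Q P \<in> Co (n + m)" using hb(1)[OF Q P] by (simp add: add.commute)
  \<comment> \<open>The zero summand gives the right side the shape of \<open>Co_linear\<close> and
    \<open>eval_linear\<close>.\<close>
  have "hb n m P Q = (- ((-1) ^ (n * m))) *\<^sub>R hb m n Q P + 0 *\<^sub>R hb m n Q P"
  proof (rule cochain_eqI[OF hb(1)[OF P Q] Co_linear[OF QP QP]])
    fix us assume us: "length us = n + m" "set us \<subseteq> E.\<Gamma>"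
    then have us': "length us = m + n" by simp
    show "eval_cochain (hb n m P Q) us = eval_cochain ((- ((-1) ^ (n * m))) *\<^sub>R hb m n Q P + 0 *\<^sub>R hb m n Q P) us"
      unfolding hb(2)[OF P Q us] eval_linear hb(2)[OF Q P us' us(2)]
        L.bf_skew[OF multilin_eval[OF P] multilin_eval[OF Q] us' us(2)] by simp
  qed
  then show ?thesis by simp
qed

lemma hb_linear_right:
  assumes P: "P \<in> Co n" "P' \<in> Co n" and Q: "Q \<in> Co m"
  shows "hb m n Q (c *\<^sub>R P + d *\<^sub>R P') = c *\<^sub>R hb m n Q P + d *\<^sub>R hb m n Q P'"
  unfolding hb_skew[OF Q Co_linear[OF P]] hb_skew[OF Q P(1)] hb_skew[OF Q P(2)] hb_linear_left[OF P Q]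
  by (simp add: scaleR_add_right mult.commute)

lemma zero_Co: "0 \<in> Co n"
  by (rule subspace_0[OF subspace_cochains])

lemma hb_zero:
  assumes "P \<in> Co n"
  shows "hb m n 0 P = 0" "hb n m P 0 = 0"
  using hb_linear_left[OF zero_Co zero_Co assms, of m 0 0] hb_linear_right[OF zero_Co zero_Co assms, of m 0 0] by simp_all

text \<open>The index sets in the definition depend on the arguments. Over a common finite index
  set, the extra terms being zero, bilinearity reduces to that of each homogeneous bracket.\<close>

lemma cbr_sum:
  assumes P: "\<And>k. degree_part k P \<in> Co k" and Q: "\<And>k. degree_part k Q \<in> Co k"
    and N: "finite N" "\<And>n. n \<notin> N \<Longrightarrow> degree_part n P = 0"
    and K: "finite K" "\<And>m. m \<notin> K \<Longrightarrow> degree_part m Q = 0"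
  shows "cbr P Q = (\<Sum>n\<in>N. \<Sum>m\<in>K. hb n m (degree_part n P) (degree_part m Q))"
proof -
  have 1: "(\<Sum>m | degree_part m Q \<noteq> 0. hb n m (degree_part n P) (degree_part m Q)) =
      (\<Sum>m\<in>K. hb n m (degree_part n P) (degree_part m Q))" for n
    by (rule sum.mono_neutral_left) (use K hb_zero(2)[OF P] in auto)
  show ?thesis
    unfolding cochain_bracket_def 1
    by (rule sum.mono_neutral_left) (use N hb_zero(1)[OF Q] in auto)
qed

lemma degree_part_Co: "P \<in> Co n \<Longrightarrow> degree_part k P \<in> Co k"
  by (simp add: degree_part_cochain zero_Co)

lemma cbr_hb:
  assumes P: "P \<in> Co n" and Q: "Q \<in> Co m"
  shows "cbr P Q = hb n m P Q"
proof -
  have "cbr P Q = (\<Sum>n\<in>{n}. \<Sum>m\<in>{m}. hb n m (degree_part n P) (degree_part m Q))"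
    by (rule cbr_sum[OF degree_part_Co[OF P] degree_part_Co[OF Q]])
      (simp_all add: degree_part_cochain[OF P] degree_part_cochain[OF Q])
  then show ?thesis
    by (simp add: degree_part_cochain[OF P] degree_part_cochain[OF Q])
qed

lemma cbr_jacobi:
  assumes x: "x \<in> Co i" and y: "y \<in> Co j" and z: "z \<in> Co k"
  shows "cbr x (cbr y z) = cbr (cbr x y) z + (-1) ^ (i * j) *\<^sub>R cbr y (cbr x z)"
proof -
  note xy = hb(1)[OF x y] and yz = hb(1)[OF y z] and xz = hb(1)[OF x z]
  \<comment> \<open>The three nested brackets arise in differently associated degrees;
    \<open>cochain_eqI\<close> compares cochains of one degree.\<close>
  have c: "hb i (j + k) x (hb j k y z) \<in> Co (i + j + k)" "hb (i + j) k (hb i j x y) z \<in> Co (i + j + k)"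
    "hb j (i + k) y (hb i k x z) \<in> Co (i + j + k)"
    using hb(1)[OF x yz] hb(1)[OF xy z] hb(1)[OF y xz] by (simp_all add: ac_simps)
  have "hb i (j + k) x (hb j k y z) =
      1 *\<^sub>R hb (i + j) k (hb i j x y) z + (-1) ^ (i * j) *\<^sub>R hb j (i + k) y (hb i k x z)"
  proof (rule cochain_eqI[OF c(1) Co_linear[OF c(2,3)]])
    fix us assume us: "length us = i + j + k" "set us \<subseteq> E.\<Gamma>"
    then have len: "length us = i + (j + k)" "length us = j + (i + k)"
      "length us = (j + k) + i" "length us = k + (i + j)" "length us = (i + k) + j" by auto
    note g = gvalued_eval[OF x] gvalued_eval[OF y] gvalued_eval[OF z]
      gvalued_eval[OF xy] gvalued_eval[OF yz] gvalued_eval[OF xz]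
    have 1: "eval_cochain (hb i (j + k) x (hb j k y z)) us =
        L.bf i (j + k) (eval_cochain x) (L.bf j k (eval_cochain y) (eval_cochain z)) us"
      unfolding hb(2)[OF x yz len(1) us(2)]
      by (rule L.bf_cong[OF g(1,5) len(3) us(2) refl hb(2)[OF y z]])
    have 2: "eval_cochain (hb (i + j) k (hb i j x y) z) us =
        L.bf (i + j) k (L.bf i j (eval_cochain x) (eval_cochain y)) (eval_cochain z) us"
      unfolding hb(2)[OF xy z us]
      by (rule L.bf_cong[OF g(4,3) len(4) us(2) hb(2)[OF x y] refl])
    have 3: "eval_cochain (hb j (i + k) y (hb i k x z)) us =
        L.bf j (i + k) (eval_cochain y) (L.bf i k (eval_cochain x) (eval_cochain z)) us"
      unfolding hb(2)[OF y xz len(2) us(2)]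
      by (rule L.bf_cong[OF g(2,6) len(5) us(2) refl hb(2)[OF x z]])
    show "eval_cochain (hb i (j + k) x (hb j k y z)) us =
        eval_cochain (1 *\<^sub>R hb (i + j) k (hb i j x y) z + (-1) ^ (i * j) *\<^sub>R hb j (i + k) y (hb i k x z)) us"
      unfolding eval_linear 1 2 3
      using L.bf_jacobi[OF multilin_eval[OF x] multilin_eval[OF y] multilin_eval[OF z] us] by simp
  qed
  then show ?thesis
    using x y z by (simp add: cbr_hb[OF x y] cbr_hb[OF y z] cbr_hb[OF x z] cbr_hb[OF x yz] cbr_hb[OF xy z] cbr_hb[OF y xz])
qed

lemma bilinear_cbr: "bilinear_on (span (\<Union>k. Co k)) cbr"
  unfolding bilinear_on_def
proof (intro ballI allI)
  fix x y z and c d :: real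
  assume "x \<in> span (\<Union>k. Co k)" "y \<in> span (\<Union>k. Co k)" "z \<in> span (\<Union>k. Co k)"
  note dp = this[THEN span_cochains_degree_part]
  define N where "N = {k. degree_part k x \<noteq> 0} \<union> {k. degree_part k y \<noteq> 0}"
  define K where "K = {k. degree_part k z \<noteq> 0}"
  have N: "finite N" "\<And>n. n \<notin> N \<Longrightarrow> degree_part n x = 0" "\<And>n. n \<notin> N \<Longrightarrow> degree_part n y = 0"
    "\<And>n. n \<notin> N \<Longrightarrow> degree_part n (c *\<^sub>R x + d *\<^sub>R y) = 0"
    using dp by (auto simp: N_def degree_part_linear)
  have K: "finite K" "\<And>n. n \<notin> K \<Longrightarrow> degree_part n z = 0"
    using dp by (auto simp: K_def)
  have D: "\<And>k. degree_part k x \<in> Co k" "\<And>k. degree_part k y \<in> Co k" "\<And>k. degree_part k z \<in> Co k"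
    "\<And>k. degree_part k (c *\<^sub>R x + d *\<^sub>R y) \<in> Co k"
    using dp by (auto simp: degree_part_linear Co_linear)
  let ?w = "c *\<^sub>R x + d *\<^sub>R y"
  have left: "cbr u z = (\<Sum>n\<in>N. \<Sum>m\<in>K. hb n m (degree_part n u) (degree_part m z))"
    and right: "cbr z u = (\<Sum>m\<in>K. \<Sum>n\<in>N. hb m n (degree_part m z) (degree_part n u))"
    if "u \<in> {x, y, ?w}" for u
    by (rule cbr_sum; use that D N K in blast)+
  have "cbr ?w z = c *\<^sub>R cbr x z + d *\<^sub>R cbr y z"
    by (simp only: left insert_iff simp_thms degree_part_linear hb_linear_left[OF D(1,2,3)] sum.distrib scaleR_sum_right)
  moreover have "cbr z ?w = c *\<^sub>R cbr z x + d *\<^sub>R cbr z y"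
    by (simp only: right insert_iff simp_thms degree_part_linear hb_linear_right[OF D(1,2,3)] sum.distrib scaleR_sum_right)
  ultimately show "cbr (c *\<^sub>R x + d *\<^sub>R y) z = c *\<^sub>R cbr x z + d *\<^sub>R cbr y z \<and>
      cbr z (c *\<^sub>R x + d *\<^sub>R y) = c *\<^sub>R cbr z x + d *\<^sub>R cbr z y" ..
qed

lemma graded_lie: "graded_lie_algebra Co cbr"
  unfolding graded_lie_algebra_def
proof (intro conjI allI impI ballI)
  show "subspace (Co k)" for k by (rule subspace_cochains)
  show "bilinear_on (span (\<Union>k. Co k)) cbr" by (rule bilinear_cbr)
  show "cbr x y \<in> Co (i + j)" if "x \<in> Co i" "y \<in> Co j" for i j x y
    using hb(1)[OF that] cbr_hb[OF that] by simp
  show "cbr x y = - ((-1) ^ (i * j) *\<^sub>R cbr y x)" if "x \<in> Co i" "y \<in> Co j" for i j x y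
    using hb_skew[OF that] cbr_hb[OF that] cbr_hb[OF that(2,1)] by simp
  show "cbr x (cbr y z) = cbr (cbr x y) z + (-1) ^ (i * j) *\<^sub>R cbr y (cbr x z)"
    if "x \<in> Co i" "y \<in> Co j" "z \<in> Co k" for i j k x y z
    using cbr_jacobi that .
  fix c K k assume *: "(\<forall>k. c k \<in> Co k) \<and> finite K \<and> (\<Sum>k\<in>K. c k) = 0" and k: "k \<in> K"
  \<comment> \<open>Comparison of the parts of degree k: the summand c j contributes only for j =
    k.\<close>
  have "(0 :: 'm \<Rightarrow> 'e list \<Rightarrow> 'a) = degree_part k (\<Sum>j\<in>K. c j)"
    using * by (simp add: degree_part_def fun_eq_iff)
  also have "\<dots> = (\<Sum>j\<in>K. if k = j then c j else 0)"
    unfolding degree_part_sum using * by (intro sum.cong refl degree_part_cochain) auto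
  also have "\<dots> = c k" using * k by simp
  finally show "c k = 0" by simp
qed

section \<open>Maurer--Cartan elements and Rota--Baxter operators\<close>

lemma maurer_cartan_iff:
  assumes \<theta>: "\<theta> \<in> Co 1"
  shows "cbr \<theta> \<theta> = 0 \<longleftrightarrow> (\<forall>u\<in>E.\<Gamma>. \<forall>v\<in>E.\<Gamma>.
    br (eval_cochain \<theta> [u]) (eval_cochain \<theta> [v]) =
    eval_cochain \<theta> [rep_op \<rho> (eval_cochain \<theta> [u]) v - rep_op \<rho> (eval_cochain \<theta> [v]) u])"
proof -
  let ?T = "\<lambda>u. eval_cochain \<theta> [u]"
  have T: "?T u \<in> A.\<Gamma>" if "u \<in> E.\<Gamma>" for u
    using eval_cochain_section[OF \<theta>, of "[u]"] that by simp
  have Tdiff: "?T (u - v) = ?T u - ?T v" if "u \<in> E.\<Gamma>" "v \<in> E.\<Gamma>" for u v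
    using L.multilin_diff[OF multilin_eval[OF \<theta>], of "[u]" 0 u v] that by simp
  \<comment> \<open>For two arguments the antisymmetrisation has two terms, and skewness of
    \<open>br\<close> makes them equal. Their sum is twice the defect of the Rota--Baxter
    identity.\<close>
  have eval: "eval_cochain (cbr \<theta> \<theta>) [u, v] =
      2 *\<^sub>R (?T (rep_op \<rho> (?T u) v - rep_op \<rho> (?T v) u) - br (?T u) (?T v))" if uv: "u \<in> E.\<Gamma>" "v \<in> E.\<Gamma>" for u v
  proof -
    let ?p = "L.pb 1 (eval_cochain \<theta>) (eval_cochain \<theta>)"
    have p: "?p [u, v] = ?T (rep_op \<rho> (?T u) v) - ?T (rep_op \<rho> (?T v) u) + br (?T v) (?T u)" for u v
      by (simp add: L.pb_def der_def)
    have skew: "br (?T v) (?T u) = - br (?T u) (?T v)"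
      by (rule L.br_skew[OF T T]) (use uv in auto)
    have "eval_cochain (cbr \<theta> \<theta>) [u, v] = ?p [u, v] - ?p [v, u]"
      using hb(2)[OF \<theta> \<theta>, of "[u, v]"] uv by (simp add: cbr_hb[OF \<theta> \<theta>] L.bf_def alt_2)
    then have "eval_cochain (cbr \<theta> \<theta>) [u, v] =
        2 *\<^sub>R (?T (rep_op \<rho> (?T u) v) - ?T (rep_op \<rho> (?T v) u) - br (?T u) (?T v))"
      unfolding p skew by (simp add: scaleR_2 algebra_simps)
    then show ?thesis
      using uv T by (simp add: Tdiff L.r_closed)
  qed
  have deg: "cbr \<theta> \<theta> \<in> Co 2"
    using hb(1)[OF \<theta> \<theta>] unfolding cbr_hb[OF \<theta> \<theta>] by (simp add: numeral_2_eq_2)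
  have "cbr \<theta> \<theta> = 0 \<longleftrightarrow> (\<forall>us. length us = 2 \<and> set us \<subseteq> E.\<Gamma> \<longrightarrow> eval_cochain (cbr \<theta> \<theta>) us = 0)"
  proof
    assume "\<forall>us. length us = 2 \<and> set us \<subseteq> E.\<Gamma> \<longrightarrow> eval_cochain (cbr \<theta> \<theta>) us = 0"
    then show "cbr \<theta> \<theta> = 0"
      by (intro cochain_eqI[OF deg zero_Co]) (auto simp: eval_cochain_def fun_eq_iff)
  qed (simp add: eval_cochain_def fun_eq_iff)
  also have "\<dots> \<longleftrightarrow> (\<forall>u\<in>E.\<Gamma>. \<forall>v\<in>E.\<Gamma>. eval_cochain (cbr \<theta> \<theta>) [u, v] = 0)"
    by (auto simp: numeral_2_eq_2 length_Suc_conv)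
  also have "\<dots> \<longleftrightarrow> (\<forall>u\<in>E.\<Gamma>. \<forall>v\<in>E.\<Gamma>. br (?T u) (?T v) = ?T (rep_op \<rho> (?T u) v - rep_op \<rho> (?T v) u))"
    by (intro ball_cong refl) (auto simp: eval)
  finally show ?thesis .
qed

lemma eval_as_cochain: "eval_cochain (as_cochain T) [u] = on_sections T u"
  by (simp add: eval_cochain_def as_cochain_def on_sections_def)

text \<open>On lists of length 1 alternation is an empty condition, and bundle maps and cochains are
  both set to 0 off the fibres; so the two notions correspond exactly, with
  \<open>Co_1_as_cochain\<close> as the converse.\<close>

lemma as_cochain_in_Co:
  assumes T: "bundle_map M E A T"
  shows "as_cochain T \<in> Co 1"
proof -
  note T1 = T[unfolded bundle_map_def, THEN conjunct1]
    and T2 = T[unfolded bundle_map_def, THEN conjunct2, THEN conjunct1]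
    and T3 = T[unfolded bundle_map_def, THEN conjunct2, THEN conjunct2, THEN conjunct1]
    and T4 = T[unfolded bundle_map_def, THEN conjunct2, THEN conjunct2, THEN conjunct2]
  show ?thesis
  proof (rule cochainsI, goal_cases)
    case (1 x vs)
    show ?case
    proof (cases "length vs = 1")
      case True
      then obtain v where "vs = [v]" by (auto simp: length_Suc_conv)
      moreover from this 1 have "v \<notin> fibre E x" by simp
      ultimately show ?thesis using T1 by (simp add: as_cochain_def)
    qed (simp add: as_cochain_def)
  next
    case (2 x vs)
    then show ?case using T2 by (auto simp: as_cochain_def length_Suc_conv)
  next
    case (3 x vs i v w c d)
    then show ?case using T3 by (auto simp: as_cochain_def length_Suc_conv)
  next
    case (5 U r e js)
    then obtain j where "js = [j]" "j < r" by (auto simp: length_Suc_conv)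
    then show ?case using T4 5(1) by (fastforce simp: as_cochain_def)
  qed simp
qed

lemma Co_1_as_cochain:
  assumes \<theta>: "\<theta> \<in> Co 1"
  shows "bundle_map M E A (\<lambda>x v. \<theta> x [v])" "as_cochain (\<lambda>x v. \<theta> x [v]) = \<theta>"
proof -
  have "\<theta> x [c *\<^sub>R v + d *\<^sub>R w] = c *\<^sub>R \<theta> x [v] + d *\<^sub>R \<theta> x [w]" if "v \<in> fibre E x" "w \<in> fibre E x" for x v w c d
    using cochainsD(3)[OF \<theta>, of "[v]" x 0 v w c d] that by simp
  moreover have "smooth_section_on M A U (\<lambda>x. \<theta> x [e i x])" if "(U, r, e) \<in> frames E" "i < r" for U r e i
    using cochainsD(5)[OF \<theta> that(1), of "[i]"] that(2) by simp
  ultimately show "bundle_map M E A (\<lambda>x v. \<theta> x [v])"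
    unfolding bundle_map_def using cochainsD(1,2)[OF \<theta>] by auto
  have "\<theta> x vs = 0" if "length vs \<noteq> 1" for x vs
    using cochainsD(1)[OF \<theta>] that by blast
  then show "as_cochain (\<lambda>x v. \<theta> x [v]) = \<theta>"
    by (auto simp: as_cochain_def fun_eq_iff length_Suc_conv)
qed

lemma maurer_cartan_rota_baxter:
  "maurer_cartan_elements Co cbr = as_cochain ` {T. relative_rota_baxter M A br E \<rho> T}"
proof (intro equalityI subsetI)
  fix \<theta> assume "\<theta> \<in> maurer_cartan_elements Co cbr"
  then have \<theta>: "\<theta> \<in> Co 1" "cbr \<theta> \<theta> = 0" by (auto simp: maurer_cartan_elements_def)
  let ?T = "\<lambda>x v. \<theta> x [v]"
  have "on_sections ?T u = eval_cochain \<theta> [u]" for u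
    by (simp add: on_sections_def eval_cochain_def)
  then have "relative_rota_baxter M A br E \<rho> ?T"
    using Co_1_as_cochain(1)[OF \<theta>(1)] maurer_cartan_iff[OF \<theta>(1)] \<theta>(2)
    by (simp add: relative_rota_baxter_def)
  then show "\<theta> \<in> as_cochain ` {T. relative_rota_baxter M A br E \<rho> T}"
    using Co_1_as_cochain(2)[OF \<theta>(1)] by (intro image_eqI[of _ _ ?T]) auto
next
  fix \<theta> assume "\<theta> \<in> as_cochain ` {T. relative_rota_baxter M A br E \<rho> T}"
  then obtain T where T: "relative_rota_baxter M A br E \<rho> T" "\<theta> = as_cochain T" by blast
  then have "\<theta> \<in> Co 1" using as_cochain_in_Co by (simp add: relative_rota_baxter_def)
  then show "\<theta> \<in> maurer_cartan_elements Co cbr"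
    using T maurer_cartan_iff by (simp add: maurer_cartan_elements_def eval_as_cochain relative_rota_baxter_def)
qed

end

theorem theorem2p5:
  fixes M :: "'m::{t2_space, second_countable_topology} manifold"
    and A :: "('m, 'a::real_vector) vbundle"
    and br :: "('m \<Rightarrow> 'a) \<Rightarrow> ('m \<Rightarrow> 'a) \<Rightarrow> ('m \<Rightarrow> 'a)"
    and an :: "'m \<Rightarrow> 'a \<Rightarrow> ('m \<Rightarrow> real) \<Rightarrow> real"
    and E :: "('m, 'e::real_vector) vbundle"
    and \<rho> :: "'m \<Rightarrow> 'a \<Rightarrow> ('m \<Rightarrow> 'e) \<Rightarrow> 'e"
  assumes "smooth_manifold M"
    and "lie_rep_pair M A br an E \<rho>"
  shows "(\<forall>n m. \<forall>P\<in>cochains M E A n. \<forall>Q\<in>cochains M E A m.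
            cochain_bracket M A br E \<rho> P Q \<in> cochains M E A (n + m) \<and>
            (\<forall>us. length us = m + n \<and> set us \<subseteq> sections M E \<longrightarrow>
               eval_cochain (cochain_bracket M A br E \<rho> P Q) us = bracket_formula br \<rho> n m P Q us)) \<and>
         graded_lie_algebra (cochains M E A) (cochain_bracket M A br E \<rho>) \<and>
         maurer_cartan_elements (cochains M E A) (cochain_bracket M A br E \<rho>) =
           as_cochain ` {T. relative_rota_baxter M A br E \<rho> T}"
proof -
  interpret lie_rep M A br an E \<rho>
    using assms by unfold_locales
  have "cbr P Q \<in> Co (n + m) \<and> (\<forall>us. length us = m + n \<and> set us \<subseteq> E.\<Gamma> \<longrightarrow>
      eval_cochain (cbr P Q) us = bracket_formula br \<rho> n m P Q us)" if "P \<in> Co n" "Q \<in> Co m" for n m P Q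
    using hb[OF that] bracket_formula_eq[OF that] cbr_hb[OF that] by (simp add: add.commute)
  then show ?thesis
    using graded_lie maurer_cartan_rota_baxter by blast
qed

end
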